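(* Let $X$ be a compact metrizable Hausdorff space and $\varphi:X\to X$ a continuous locally injective map. Assume that $\{x\in X:\varphi^k(x)=x\}$ is discrete in the topology inherited from $X$ for all $k=1,2,3,\dots$. Then $D'_{\Gamma_\varphi}$ is a Cartan subalgebra of $C^*_r(\Gamma_\varphi)$.
   Context: The groupoid $\Gamma_\varphi$. $\Gamma_\varphi=\{(x,k,y)\in X\times\mathbb Z\times X:\ \exists a,b\in\mathbb N,\ k=a-b,\ \varphi^a(x)=\varphi^b(y)\}$ with composable pairs $((x,k,y),(y,k',y'))$, product $(x,k,y)(y,k',y')=(x,k+k',y')$ and inverse $(x,k,y)^{-1}=(y,-k,x)$; here $\mathbb N=\{0,1,2,\dots\}$. For $k\in\mathbb Z$ and $n\in\mathbb N$ with $n+k\ge0$ let $\Gamma_\varphi(k,n)=\{(x,k,y):\varphi^{k+i}(x)=\varphi^i(y)\ \forall i\ge n\}$ with the relative topology from $X\times\mathbb Z\times X$. $\Gamma_\varphi(k,n)$ is open in $\Gamma_\varphi(k,n+1)$; $\Gamma_\varphi(k)=\bigcup_n\Gamma_\varphi(k,n)$ has the inductive limit topology, and $\Gamma_\varphi=\bigsqcup_{k\in\mathbb Z}\Gamma_\varphi(k)$ has the topology in which each $\Gamma_\varphi(k)$ is open and closed. This is a locally compact Hausdorff groupoid $G$ whose range map $r$ is locally injective (a semi étale groupoid); its unit space is $X$ via $x\mapsto(x,0,x)$. The $C^*$-algebra. For a locally compact Hausdorff groupoid $G$ (unit space $G^0$, range and source maps $r,s$) with $r$ locally injective, let $B_c(G)$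 be the $*$-algebra of bounded compactly supported (not necessarily continuous) functions $f:G\to\mathbb C$ with product $(f\star g)(\gamma)=\sum_{\gamma_1\gamma_2=\gamma}f(\gamma_1)g(\gamma_2)$ and involution $f^*(\gamma)=\overline{f(\gamma^{-1})}$. For $x\in G^0$ let $\pi_x$ be the representation of $B_c(G)$ on $l^2(s^{-1}(x))$ given by $(\pi_x(f)\psi)(\gamma)=\sum_{\gamma_1\gamma_2=\gamma}f(\gamma_1)\psi(\gamma_2)$. $B^*_r(G)$ is the completion of $B_c(G)$ in the norm $\|f\|=\sup_{x}\|\pi_x(f)\|$, and $C^*_r(G)$ is the $C^*$-subalgebra of $B^*_r(G)$ generated by the continuous compactly supported functions $C_c(G)$. The inclusion of $B_c(G)$ into the bounded functions on $G$ vanishing at infinity (supremum norm) extends to an injective norm-decreasing linear map $j$ on $B^*_r(G)$. Put $\mathrm{Is}\,G=\{\gamma\in G:r(\gamma)=s(\gamma)\}$ and $D'_G=\{a\in C^*_r(G):\mathrm{supp}\,j(a)\subseteq\mathrm{Is}\,G\}$, a $C^*$-subalgebra. Cartan subalgebra (Renault). For an abelian $C^*$-subalgebra $D$ of a $C^*$-algebra $A$, let $N(D)=\{a\in A: a^*Da\subseteq D,\ aDa^*\subseteq D\}$. $D$ is a Cartan subalgebra of $A$ if (i) $D$ contains an approximate unit of $A$; (ii) $D$ is maximal abelian; (iii) $A$ is generated as a $C^*$-algebra by $N(D)$; (iv) there is a faithful conditional expectation of $A$ onto $D$. *)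

theory Defs
  imports "HOL-Analysis.Analysis"
begin

section \<open>C*-algebras with explicit carriers\<close>

text \<open>The algebras below depend on a groupoid, hence on terms, so they cannot be type-class
  instances; operations are only meaningful on the carrier. No unit is assumed.\<close>

record 'e star_alg =
  alg_carrier :: "'e set"
  alg_zero :: 'e
  alg_add :: "'e \<Rightarrow> 'e \<Rightarrow> 'e"
  alg_scale :: "complex \<Rightarrow> 'e \<Rightarrow> 'e"
  alg_mult :: "'e \<Rightarrow> 'e \<Rightarrow> 'e"
  alg_star :: "'e \<Rightarrow> 'e"
  alg_norm :: "'e \<Rightarrow> real"

definition alg_dist :: "'e star_alg \<Rightarrow> 'e \<Rightarrow> 'e \<Rightarrow> real" where
  "alg_dist A a b = alg_norm A (alg_add A a (alg_scale A (-1) b))"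

definition alg_Cauchy :: "'e star_alg \<Rightarrow> (nat \<Rightarrow> 'e) \<Rightarrow> bool" where
  "alg_Cauchy A u \<longleftrightarrow> (\<forall>n. u n \<in> alg_carrier A) \<and>
     (\<forall>e>0. \<exists>N. \<forall>m\<ge>N. \<forall>n\<ge>N. alg_dist A (u m) (u n) < e)"

locale cstar_algebra =
  fixes A :: "'e star_alg"
  assumes zero_closed: "alg_zero A \<in> alg_carrier A"
    and add_closed: "\<lbrakk>a \<in> alg_carrier A; b \<in> alg_carrier A\<rbrakk> \<Longrightarrow> alg_add A a b \<in> alg_carrier A"
    and scale_closed: "a \<in> alg_carrier A \<Longrightarrow> alg_scale A c a \<in> alg_carrier A"
    and mult_closed: "\<lbrakk>a \<in> alg_carrier A; b \<in> alg_carrier A\<rbrakk> \<Longrightarrow> alg_mult A a b \<in> alg_carrier A"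
    and star_closed: "a \<in> alg_carrier A \<Longrightarrow> alg_star A a \<in> alg_carrier A"
    and add_assoc: "\<lbrakk>a \<in> alg_carrier A; b \<in> alg_carrier A; d \<in> alg_carrier A\<rbrakk>
      \<Longrightarrow> alg_add A (alg_add A a b) d = alg_add A a (alg_add A b d)"
    and add_commute: "\<lbrakk>a \<in> alg_carrier A; b \<in> alg_carrier A\<rbrakk> \<Longrightarrow> alg_add A a b = alg_add A b a"
    and add_zero: "a \<in> alg_carrier A \<Longrightarrow> alg_add A (alg_zero A) a = a"
    and add_minus: "a \<in> alg_carrier A \<Longrightarrow> alg_add A a (alg_scale A (-1) a) = alg_zero A"
    and scale_one: "a \<in> alg_carrier A \<Longrightarrow> alg_scale A 1 a = a"
    and scale_scale: "a \<in> alg_carrier A \<Longrightarrow> alg_scale A c (alg_scale A c' a) = alg_scale A (c * c') a"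
    and scale_add_left: "a \<in> alg_carrier A
      \<Longrightarrow> alg_scale A (c + c') a = alg_add A (alg_scale A c a) (alg_scale A c' a)"
    and scale_add_right: "\<lbrakk>a \<in> alg_carrier A; b \<in> alg_carrier A\<rbrakk>
      \<Longrightarrow> alg_scale A c (alg_add A a b) = alg_add A (alg_scale A c a) (alg_scale A c b)"
    and mult_assoc: "\<lbrakk>a \<in> alg_carrier A; b \<in> alg_carrier A; d \<in> alg_carrier A\<rbrakk>
      \<Longrightarrow> alg_mult A (alg_mult A a b) d = alg_mult A a (alg_mult A b d)"
    and mult_add_left: "\<lbrakk>a \<in> alg_carrier A; b \<in> alg_carrier A; d \<in> alg_carrier A\<rbrakk>
      \<Longrightarrow> alg_mult A (alg_add A a b) d = alg_add A (alg_mult A a d) (alg_mult A b d)"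
    and mult_add_right: "\<lbrakk>a \<in> alg_carrier A; b \<in> alg_carrier A; d \<in> alg_carrier A\<rbrakk>
      \<Longrightarrow> alg_mult A a (alg_add A b d) = alg_add A (alg_mult A a b) (alg_mult A a d)"
    and mult_scale_left: "\<lbrakk>a \<in> alg_carrier A; b \<in> alg_carrier A\<rbrakk>
      \<Longrightarrow> alg_mult A (alg_scale A c a) b = alg_scale A c (alg_mult A a b)"
    and mult_scale_right: "\<lbrakk>a \<in> alg_carrier A; b \<in> alg_carrier A\<rbrakk>
      \<Longrightarrow> alg_mult A a (alg_scale A c b) = alg_scale A c (alg_mult A a b)"
    and star_add: "\<lbrakk>a \<in> alg_carrier A; b \<in> alg_carrier A\<rbrakk>
      \<Longrightarrow> alg_star A (alg_add A a b) = alg_add A (alg_star A a) (alg_star A b)"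
    and star_scale: "a \<in> alg_carrier A
      \<Longrightarrow> alg_star A (alg_scale A c a) = alg_scale A (cnj c) (alg_star A a)"
    and star_mult: "\<lbrakk>a \<in> alg_carrier A; b \<in> alg_carrier A\<rbrakk>
      \<Longrightarrow> alg_star A (alg_mult A a b) = alg_mult A (alg_star A b) (alg_star A a)"
    and star_star: "a \<in> alg_carrier A \<Longrightarrow> alg_star A (alg_star A a) = a"
    and norm_nonneg: "a \<in> alg_carrier A \<Longrightarrow> 0 \<le> alg_norm A a"
    and norm_eq_zero: "a \<in> alg_carrier A \<Longrightarrow> alg_norm A a = 0 \<longleftrightarrow> a = alg_zero A"
    and norm_triangle: "\<lbrakk>a \<in> alg_carrier A; b \<in> alg_carrier A\<rbrakk>
      \<Longrightarrow> alg_norm A (alg_add A a b) \<le> alg_norm A a + alg_norm A b"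
    and norm_scale: "a \<in> alg_carrier A \<Longrightarrow> alg_norm A (alg_scale A c a) = cmod c * alg_norm A a"
    and norm_mult: "\<lbrakk>a \<in> alg_carrier A; b \<in> alg_carrier A\<rbrakk>
      \<Longrightarrow> alg_norm A (alg_mult A a b) \<le> alg_norm A a * alg_norm A b"
    and cstar_identity: "a \<in> alg_carrier A
      \<Longrightarrow> alg_norm A (alg_mult A (alg_star A a) a) = (alg_norm A a)\<^sup>2"
    and complete: "alg_Cauchy A u
      \<Longrightarrow> \<exists>a\<in>alg_carrier A. (\<lambda>n. alg_dist A (u n) a) \<longlonglongrightarrow> 0"

definition cstar_subalgebra :: "'e star_alg \<Rightarrow> 'e set \<Rightarrow> bool" where
  "cstar_subalgebra A D \<longleftrightarrow> D \<subseteq> alg_carrier A \<and> alg_zero A \<in> D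
     \<and> (\<forall>a\<in>D. \<forall>b\<in>D. alg_add A a b \<in> D \<and> alg_mult A a b \<in> D)
     \<and> (\<forall>a\<in>D. \<forall>c. alg_scale A c a \<in> D)
     \<and> (\<forall>a\<in>D. alg_star A a \<in> D)
     \<and> (\<forall>u. \<forall>a\<in>alg_carrier A. (\<forall>n. u n \<in> D) \<and> (\<lambda>n. alg_dist A (u n) a) \<longlonglongrightarrow> 0 \<longrightarrow> a \<in> D)"

definition cstar_generated :: "'e star_alg \<Rightarrow> 'e set \<Rightarrow> 'e set" where
  "cstar_generated A S = \<Inter>{D. cstar_subalgebra A D \<and> S \<subseteq> D}"

definition alg_restrict :: "'e star_alg \<Rightarrow> 'e set \<Rightarrow> 'e star_alg" where
  "alg_restrict A D = A\<lparr>alg_carrier := D\<rparr>"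

definition alg_abelian :: "'e star_alg \<Rightarrow> 'e set \<Rightarrow> bool" where
  "alg_abelian A D \<longleftrightarrow> (\<forall>a\<in>D. \<forall>b\<in>D. alg_mult A a b = alg_mult A b a)"

definition alg_positive :: "'e star_alg \<Rightarrow> 'e \<Rightarrow> bool" where
  "alg_positive A a \<longleftrightarrow> (\<exists>b\<in>alg_carrier A. a = alg_mult A (alg_star A b) b)"


section \<open>Cartan subalgebras\<close>

text \<open>An approximate unit is a net of positive contractions; the net is represented by the
  filter \<open>F\<close> of its tails on the algebra.\<close>

definition contains_approximate_unit :: "'e star_alg \<Rightarrow> 'e set \<Rightarrow> bool" where
  "contains_approximate_unit A D \<longleftrightarrow> (\<exists>F :: 'e filter. F \<noteq> bot
     \<and> eventually (\<lambda>e. e \<in> D \<and> alg_positive A e \<and> alg_norm A e \<le> 1) F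
     \<and> (\<forall>a\<in>alg_carrier A. ((\<lambda>e. alg_dist A (alg_mult A e a) a) \<longlongrightarrow> 0) F
                        \<and> ((\<lambda>e. alg_dist A (alg_mult A a e) a) \<longlongrightarrow> 0) F))"

definition maximal_abelian :: "'e star_alg \<Rightarrow> 'e set \<Rightarrow> bool" where
  "maximal_abelian A D \<longleftrightarrow> cstar_subalgebra A D \<and> alg_abelian A D
     \<and> (\<forall>E. cstar_subalgebra A E \<and> alg_abelian A E \<and> D \<subseteq> E \<longrightarrow> E = D)"

definition normalizers :: "'e star_alg \<Rightarrow> 'e set \<Rightarrow> 'e set" where
  "normalizers A D = {a \<in> alg_carrier A.
     (\<forall>d\<in>D. alg_mult A (alg_mult A (alg_star A a) d) a \<in> D) \<and>
     (\<forall>d\<in>D. alg_mult A (alg_mult A a d) (alg_star A a) \<in> D)}"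

definition conditional_expectation :: "'e star_alg \<Rightarrow> 'e set \<Rightarrow> ('e \<Rightarrow> 'e) \<Rightarrow> bool" where
  "conditional_expectation A D P \<longleftrightarrow>
       (\<forall>a\<in>alg_carrier A. P a \<in> D)
     \<and> (\<forall>a\<in>alg_carrier A. \<forall>b\<in>alg_carrier A. P (alg_add A a b) = alg_add A (P a) (P b))
     \<and> (\<forall>a\<in>alg_carrier A. \<forall>c. P (alg_scale A c a) = alg_scale A c (P a))
     \<and> (\<forall>d\<in>D. P d = d)
     \<and> (\<forall>a\<in>alg_carrier A. alg_norm A (P a) \<le> alg_norm A a)
     \<and> (\<forall>a\<in>alg_carrier A. alg_positive A a \<longrightarrow> alg_positive A (P a))
     \<and> (\<forall>a\<in>alg_carrier A. \<forall>d\<in>D. \<forall>d'\<in>D.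
          P (alg_mult A (alg_mult A d a) d') = alg_mult A (alg_mult A d (P a)) d')"

definition faithful_map :: "'e star_alg \<Rightarrow> ('e \<Rightarrow> 'e) \<Rightarrow> bool" where
  "faithful_map A P \<longleftrightarrow> (\<forall>a\<in>alg_carrier A.
     P (alg_mult A (alg_star A a) a) = alg_zero A \<longrightarrow> a = alg_zero A)"

definition cartan_subalgebra :: "'e star_alg \<Rightarrow> 'e set \<Rightarrow> bool" where
  "cartan_subalgebra A D \<longleftrightarrow>
       cstar_algebra A \<and> cstar_subalgebra A D \<and> alg_abelian A D
     \<and> contains_approximate_unit A D
     \<and> maximal_abelian A D
     \<and> cstar_generated A (normalizers A D) = alg_carrier A
     \<and> (\<exists>P. conditional_expectation A D P \<and> faithful_map A P)"


section \<open>Completion of a normed *-algebra\<close>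

definition completion_rel :: "'e star_alg \<Rightarrow> ((nat \<Rightarrow> 'e) \<times> (nat \<Rightarrow> 'e)) set" where
  "completion_rel A = {(u, v). alg_Cauchy A u \<and> alg_Cauchy A v
     \<and> (\<lambda>n. alg_dist A (u n) (v n)) \<longlonglongrightarrow> 0}"

definition cclass :: "'e star_alg \<Rightarrow> (nat \<Rightarrow> 'e) \<Rightarrow> (nat \<Rightarrow> 'e) set" where
  "cclass A u = completion_rel A `` {u}"

definition crep :: "(nat \<Rightarrow> 'e) set \<Rightarrow> nat \<Rightarrow> 'e" where
  "crep a = (SOME u. u \<in> a)"

definition completion :: "'e star_alg \<Rightarrow> (nat \<Rightarrow> 'e) set star_alg" where
  "completion A = \<lparr>
     alg_carrier = {u. alg_Cauchy A u} // completion_rel A,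
     alg_zero = cclass A (\<lambda>n. alg_zero A),
     alg_add = (\<lambda>a b. cclass A (\<lambda>n. alg_add A (crep a n) (crep b n))),
     alg_scale = (\<lambda>c a. cclass A (\<lambda>n. alg_scale A c (crep a n))),
     alg_mult = (\<lambda>a b. cclass A (\<lambda>n. alg_mult A (crep a n) (crep b n))),
     alg_star = (\<lambda>a. cclass A (\<lambda>n. alg_star A (crep a n))),
     alg_norm = (\<lambda>a. lim (\<lambda>n. alg_norm A (crep a n))) \<rparr>"

definition completion_embed :: "'e star_alg \<Rightarrow> 'e \<Rightarrow> (nat \<Rightarrow> 'e) set" where
  "completion_embed A f = cclass A (\<lambda>n. f)"


section \<open>Topological groupoids and their reduced algebras\<close>

text \<open>The underlying set of the groupoid is the topspace. The multiplication is a total function,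
  but only its values on composable pairs of elements matter.\<close>

record 'g top_groupoid =
  gtop :: "'g topology"
  gmult :: "'g \<Rightarrow> 'g \<Rightarrow> 'g"
  ginv :: "'g \<Rightarrow> 'g"

definition gcarrier :: "'g top_groupoid \<Rightarrow> 'g set" where
  "gcarrier G = topspace (gtop G)"

definition grange :: "'g top_groupoid \<Rightarrow> 'g \<Rightarrow> 'g" where
  "grange G \<gamma> = gmult G \<gamma> (ginv G \<gamma>)"

definition gsource :: "'g top_groupoid \<Rightarrow> 'g \<Rightarrow> 'g" where
  "gsource G \<gamma> = gmult G (ginv G \<gamma>) \<gamma>"

definition gunits :: "'g top_groupoid \<Rightarrow> 'g set" where
  "gunits G = grange G ` gcarrier G"

definition gfactor :: "'g top_groupoid \<Rightarrow> 'g \<Rightarrow> ('g \<times> 'g) set" where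
  "gfactor G \<gamma> = {(\<gamma>1, \<gamma>2). \<gamma>1 \<in> gcarrier G \<and> \<gamma>2 \<in> gcarrier G
     \<and> gsource G \<gamma>1 = grange G \<gamma>2 \<and> gmult G \<gamma>1 \<gamma>2 = \<gamma>}"

definition gsource_fibre :: "'g top_groupoid \<Rightarrow> 'g \<Rightarrow> 'g set" where
  "gsource_fibre G x = {\<gamma> \<in> gcarrier G. gsource G \<gamma> = x}"

definition isotropy :: "'g top_groupoid \<Rightarrow> 'g set" where
  "isotropy G = {\<gamma> \<in> gcarrier G. grange G \<gamma> = gsource G \<gamma>}"

text \<open>Functions on the groupoid are represented by functions on the type vanishing off the
  carrier.\<close>

definition gsupport :: "'g top_groupoid \<Rightarrow> ('g \<Rightarrow> complex) \<Rightarrow> 'g set" where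
  "gsupport G f = gtop G closure_of {\<gamma> \<in> gcarrier G. f \<gamma> \<noteq> 0}"

definition Bc_set :: "'g top_groupoid \<Rightarrow> ('g \<Rightarrow> complex) set" where
  "Bc_set G = {f. (\<forall>\<gamma>. \<gamma> \<notin> gcarrier G \<longrightarrow> f \<gamma> = 0) \<and> bounded (range f)
     \<and> compactin (gtop G) (gsupport G f)}"

definition Cc_set :: "'g top_groupoid \<Rightarrow> ('g \<Rightarrow> complex) set" where
  "Cc_set G = {f. (\<forall>\<gamma>. \<gamma> \<notin> gcarrier G \<longrightarrow> f \<gamma> = 0) \<and> continuous_map (gtop G) euclidean f
     \<and> compactin (gtop G) (gsupport G f)}"

text \<open>The sums below have only finitely many non-zero terms when \<open>f\<close> is compactly supported and
  the range map is locally injective.\<close>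

definition gconv :: "'g top_groupoid \<Rightarrow> ('g \<Rightarrow> complex) \<Rightarrow> ('g \<Rightarrow> complex) \<Rightarrow> 'g \<Rightarrow> complex" where
  "gconv G f g \<gamma> = (\<Sum>\<^sub>\<infinity>(\<gamma>1, \<gamma>2)\<in>gfactor G \<gamma>. f \<gamma>1 * g \<gamma>2)"

definition ginvolution :: "'g top_groupoid \<Rightarrow> ('g \<Rightarrow> complex) \<Rightarrow> 'g \<Rightarrow> complex" where
  "ginvolution G f \<gamma> = (if \<gamma> \<in> gcarrier G then cnj (f (ginv G \<gamma>)) else 0)"

definition ell2_set :: "'g set \<Rightarrow> ('g \<Rightarrow> complex) set" where
  "ell2_set S = {\<psi>. (\<forall>\<gamma>. \<gamma> \<notin> S \<longrightarrow> \<psi> \<gamma> = 0) \<and> (\<lambda>\<gamma>. (cmod (\<psi> \<gamma>))\<^sup>2) summable_on S}"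

definition ell2_norm :: "'g set \<Rightarrow> ('g \<Rightarrow> complex) \<Rightarrow> real" where
  "ell2_norm S \<psi> = sqrt (\<Sum>\<^sub>\<infinity>\<gamma>\<in>S. (cmod (\<psi> \<gamma>))\<^sup>2)"

definition gpi :: "'g top_groupoid \<Rightarrow> 'g \<Rightarrow> ('g \<Rightarrow> complex) \<Rightarrow> ('g \<Rightarrow> complex) \<Rightarrow> 'g \<Rightarrow> complex" where
  "gpi G x f \<psi> \<gamma> = (if \<gamma> \<in> gsource_fibre G x
     then \<Sum>\<^sub>\<infinity>(\<gamma>1, \<gamma>2)\<in>gfactor G \<gamma>. f \<gamma>1 * \<psi> \<gamma>2 else 0)"

definition gpi_norm :: "'g top_groupoid \<Rightarrow> 'g \<Rightarrow> ('g \<Rightarrow> complex) \<Rightarrow> real" where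
  "gpi_norm G x f = Sup {ell2_norm (gsource_fibre G x) (gpi G x f \<psi>) | \<psi>.
     \<psi> \<in> ell2_set (gsource_fibre G x) \<and> ell2_norm (gsource_fibre G x) \<psi> \<le> 1}"

text \<open>Inserting 0 only matters for the empty groupoid, as the real supremum of the empty set is
  unspecified.\<close>

definition reduced_norm :: "'g top_groupoid \<Rightarrow> ('g \<Rightarrow> complex) \<Rightarrow> real" where
  "reduced_norm G f = Sup (insert 0 ((\<lambda>x. gpi_norm G x f) ` gunits G))"

definition Bc_alg :: "'g top_groupoid \<Rightarrow> ('g \<Rightarrow> complex) star_alg" where
  "Bc_alg G = \<lparr>
     alg_carrier = Bc_set G,
     alg_zero = (\<lambda>_. 0),
     alg_add = (\<lambda>f g \<gamma>. f \<gamma> + g \<gamma>),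
     alg_scale = (\<lambda>c f \<gamma>. c * f \<gamma>),
     alg_mult = gconv G,
     alg_star = ginvolution G,
     alg_norm = reduced_norm G \<rparr>"

definition Br_alg :: "'g top_groupoid \<Rightarrow> (nat \<Rightarrow> 'g \<Rightarrow> complex) set star_alg" where
  "Br_alg G = completion (Bc_alg G)"

definition Cr_alg :: "'g top_groupoid \<Rightarrow> (nat \<Rightarrow> 'g \<Rightarrow> complex) set star_alg" where
  "Cr_alg G = alg_restrict (Br_alg G)
     (cstar_generated (Br_alg G) (completion_embed (Bc_alg G) ` Cc_set G))"

text \<open>The extension by continuity of the inclusion of \<open>Bc_set G\<close> into the bounded functions:
  the reduced norm dominates the supremum norm, so a Cauchy sequence representing \<open>a\<close> converges
  uniformly, in particular pointwise, to the image of \<open>a\<close>.\<close>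

definition jmap :: "(nat \<Rightarrow> 'g \<Rightarrow> complex) set \<Rightarrow> 'g \<Rightarrow> complex" where
  "jmap a \<gamma> = lim (\<lambda>n. crep a n \<gamma>)"

definition D'_set :: "'g top_groupoid \<Rightarrow> (nat \<Rightarrow> 'g \<Rightarrow> complex) set set" where
  "D'_set G = {a \<in> alg_carrier (Cr_alg G). gsupport G (jmap a) \<subseteq> isotropy G}"


section \<open>The groupoid of a map\<close>

definition locally_injective_map :: "'a topology \<Rightarrow> ('a \<Rightarrow> 'b) \<Rightarrow> bool" where
  "locally_injective_map X f \<longleftrightarrow> (\<forall>x\<in>topspace X. \<exists>U. openin X U \<and> x \<in> U \<and> inj_on f U)"

definition Gam_carrier :: "'a topology \<Rightarrow> ('a \<Rightarrow> 'a) \<Rightarrow> ('a \<times> int \<times> 'a) set" where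
  "Gam_carrier X \<phi> = {(x, k, y). x \<in> topspace X \<and> y \<in> topspace X
     \<and> (\<exists>a b :: nat. k = int a - int b \<and> (\<phi> ^^ a) x = (\<phi> ^^ b) y)}"

text \<open>The pieces are only used when \<open>0 \<le> int n + k\<close>, so that all exponents are natural.\<close>

definition Gam_piece :: "'a topology \<Rightarrow> ('a \<Rightarrow> 'a) \<Rightarrow> int \<Rightarrow> nat \<Rightarrow> ('a \<times> int \<times> 'a) set" where
  "Gam_piece X \<phi> k n = {(x, l, y). x \<in> topspace X \<and> y \<in> topspace X \<and> l = k
     \<and> (\<forall>i\<ge>n. (\<phi> ^^ nat (k + int i)) x = (\<phi> ^^ i) y)}"

definition Gam_piece_top :: "'a topology \<Rightarrow> ('a \<Rightarrow> 'a) \<Rightarrow> int \<Rightarrow> nat \<Rightarrow> ('a \<times> int \<times> 'a) topology" where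
  "Gam_piece_top X \<phi> k n =
     subtopology (prod_topology X (prod_topology (discrete_topology UNIV) X)) (Gam_piece X \<phi> k n)"

definition Gam_level :: "'a topology \<Rightarrow> ('a \<Rightarrow> 'a) \<Rightarrow> int \<Rightarrow> ('a \<times> int \<times> 'a) set" where
  "Gam_level X \<phi> k = (\<Union>n\<in>{n. 0 \<le> int n + k}. Gam_piece X \<phi> k n)"

text \<open>The inductive limit topology: the finest one making all inclusions of the pieces
  continuous.\<close>

definition Gam_level_top :: "'a topology \<Rightarrow> ('a \<Rightarrow> 'a) \<Rightarrow> int \<Rightarrow> ('a \<times> int \<times> 'a) topology" where
  "Gam_level_top X \<phi> k = topology (\<lambda>U. U \<subseteq> Gam_level X \<phi> k \<and>
     (\<forall>n. 0 \<le> int n + k \<longrightarrow> openin (Gam_piece_top X \<phi> k n) (U \<inter> Gam_piece X \<phi> k n)))"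

definition Gam_top :: "'a topology \<Rightarrow> ('a \<Rightarrow> 'a) \<Rightarrow> ('a \<times> int \<times> 'a) topology" where
  "Gam_top X \<phi> = topology (\<lambda>U. U \<subseteq> Gam_carrier X \<phi> \<and>
     (\<forall>k. openin (Gam_level_top X \<phi> k) (U \<inter> Gam_level X \<phi> k)))"

definition Gam :: "'a topology \<Rightarrow> ('a \<Rightarrow> 'a) \<Rightarrow> ('a \<times> int \<times> 'a) top_groupoid" where
  "Gam X \<phi> = \<lparr>
     gtop = Gam_top X \<phi>,
     gmult = (\<lambda>(x, k, y) (y', k', z). (x, k + k', z)),
     ginv = (\<lambda>(x, k, y). (y, - k, x)) \<rparr>"

lemma istopology_glue:
  assumes "\<And>i. i \<in> I \<Longrightarrow> topspace (T i) = S i"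
  shows "istopology (\<lambda>U. U \<subseteq> C \<and> (\<forall>i\<in>I. openin (T i) (U \<inter> S i)))"
proof -
  have "openin (T i) ((U \<inter> V) \<inter> S i)"
    if "openin (T i) (U \<inter> S i)" "openin (T i) (V \<inter> S i)" for U V i
  proof -
    have "(U \<inter> V) \<inter> S i = (U \<inter> S i) \<inter> (V \<inter> S i)" by blast
    with that show ?thesis by (metis openin_Int)
  qed
  moreover have "openin (T i) (\<Union>\<K> \<inter> S i)" if "\<forall>K\<in>\<K>. openin (T i) (K \<inter> S i)" for \<K> i
  proof -
    have "\<Union>\<K> \<inter> S i = \<Union>((\<lambda>K. K \<inter> S i) ` \<K>)" by blast
    moreover have "openin (T i) (\<Union>((\<lambda>K. K \<inter> S i) ` \<K>))" using that by (intro openin_Union) blast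
    ultimately show ?thesis by simp
  qed
  ultimately show ?thesis
    unfolding istopology_def by (simp add: le_infI1) blast
qed

lemma topspace_Gam_piece_top [simp]: "topspace (Gam_piece_top X \<phi> k n) = Gam_piece X \<phi> k n"
  by (auto simp: Gam_piece_top_def Gam_piece_def)

lemma openin_Gam_level_top:
  "openin (Gam_level_top X \<phi> k) U \<longleftrightarrow> U \<subseteq> Gam_level X \<phi> k \<and>
     (\<forall>n. 0 \<le> int n + k \<longrightarrow> openin (Gam_piece_top X \<phi> k n) (U \<inter> Gam_piece X \<phi> k n))"
proof -
  have "istopology (\<lambda>U. U \<subseteq> Gam_level X \<phi> k \<and>
     (\<forall>n\<in>{n. 0 \<le> int n + k}. openin (Gam_piece_top X \<phi> k n) (U \<inter> Gam_piece X \<phi> k n)))"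
    by (rule istopology_glue) simp
  then show ?thesis by (simp add: Gam_level_top_def topology_inverse')
qed

lemma topspace_Gam_level_top [simp]: "topspace (Gam_level_top X \<phi> k) = Gam_level X \<phi> k"
proof -
  have "openin (Gam_level_top X \<phi> k) (Gam_level X \<phi> k)"
    unfolding openin_Gam_level_top
  proof (intro conjI allI impI)
    fix n :: nat assume "0 \<le> int n + k"
    then have "Gam_level X \<phi> k \<inter> Gam_piece X \<phi> k n = topspace (Gam_piece_top X \<phi> k n)"
      by (auto simp: Gam_level_def)
    then show "openin (Gam_piece_top X \<phi> k n) (Gam_level X \<phi> k \<inter> Gam_piece X \<phi> k n)"
      by (metis openin_topspace)
  qed simp
  then show ?thesis
    by (metis openin_Gam_level_top openin_subset openin_topspace subset_antisym)
qed

lemma Gam_carrier_eq: "Gam_carrier X \<phi> = (\<Union>k. Gam_level X \<phi> k)"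
proof (intro subset_antisym subsetI)
  fix g assume "g \<in> Gam_carrier X \<phi>"
  then obtain x y and a b :: nat where g: "g = (x, int a - int b, y)"
    and xy: "x \<in> topspace X" "y \<in> topspace X" and eq: "(\<phi> ^^ a) x = (\<phi> ^^ b) y"
    by (auto simp: Gam_carrier_def)
  have "(\<phi> ^^ nat (int a - int b + int i)) x = (\<phi> ^^ i) y" if "b \<le> i" for i
  proof -
    have n: "nat (int a - int b + int i) = (i - b) + a" and i: "(i - b) + b = i"
      using that by auto
    have "(\<phi> ^^ ((i - b) + a)) x = (\<phi> ^^ ((i - b) + b)) y"
      by (simp only: funpow_add comp_apply eq)
    then show ?thesis by (simp only: n i)
  qed
  then have "g \<in> Gam_piece X \<phi> (int a - int b) b" by (simp add: g xy Gam_piece_def)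
  moreover have "0 \<le> int b + (int a - int b)" by simp
  ultimately have "g \<in> Gam_level X \<phi> (int a - int b)" unfolding Gam_level_def by blast
  then show "g \<in> (\<Union>k. Gam_level X \<phi> k)" by blast
next
  fix g assume "g \<in> (\<Union>k. Gam_level X \<phi> k)"
  then obtain x k y n where g: "g = (x, k, y)" and k: "0 \<le> int n + k"
    and xy: "x \<in> topspace X" "y \<in> topspace X"
    and eq: "(\<phi> ^^ nat (k + int n)) x = (\<phi> ^^ n) y"
    by (auto simp: Gam_level_def Gam_piece_def)
  moreover have "k = int (nat (k + int n)) - int n" using k by simp
  ultimately show "g \<in> Gam_carrier X \<phi>" unfolding Gam_carrier_def by blast
qed

lemma openin_Gam_top:
  "openin (Gam_top X \<phi>) U \<longleftrightarrow> U \<subseteq> Gam_carrier X \<phi> \<and>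
     (\<forall>k. openin (Gam_level_top X \<phi> k) (U \<inter> Gam_level X \<phi> k))"
proof -
  have "istopology (\<lambda>U. U \<subseteq> Gam_carrier X \<phi> \<and>
     (\<forall>k\<in>UNIV. openin (Gam_level_top X \<phi> k) (U \<inter> Gam_level X \<phi> k)))"
    by (rule istopology_glue) simp
  then show ?thesis by (simp add: Gam_top_def topology_inverse')
qed

lemma topspace_Gam_top [simp]: "topspace (Gam_top X \<phi>) = Gam_carrier X \<phi>"
proof -
  have "openin (Gam_top X \<phi>) (Gam_carrier X \<phi>)"
    unfolding openin_Gam_top
  proof (intro conjI allI)
    fix k
    have "Gam_carrier X \<phi> \<inter> Gam_level X \<phi> k = topspace (Gam_level_top X \<phi> k)"
      by (auto simp: Gam_carrier_eq)
    then show "openin (Gam_level_top X \<phi> k) (Gam_carrier X \<phi> \<inter> Gam_level X \<phi> k)"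
      by (metis openin_topspace)
  qed simp
  then show ?thesis
    by (metis openin_Gam_top openin_subset openin_topspace subset_antisym)
qed

end

theory Submission
  imports Defs
begin

text \<open>Matrices model the reduced algebra: the direct sum of the representations \<open>gpi\<close> turns functions on
  the groupoid into bounded matrices indexed by the groupoid, whose entry at \<open>(\<gamma>, \<gamma>')\<close> depends only
  on \<open>\<gamma> \<gamma>'\<^sup>-\<^sup>1\<close>, and the completion becomes a norm closure of matrices. \<open>D'\<close> is the commutant of the
  continuous functions on the unit space, and the isotropy groups are commutative, so \<open>D'\<close> is maximal
  abelian. A partition of unity writes every continuous compactly supported function as a sum of
  functions living on bisections, and these normalize \<open>D'\<close>.

  The conditional expectation restricts a function to the units and to the isotropy groups at those
  points whose point mass lies in the algebra. Discreteness of the periodic points makes the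
  isotropy off the units finite within each compact set; hence this restriction preserves the
  algebra, and an element of \<open>D'\<close> that does not vanish at a non-unit isotropy element forces the
  point mass there into the algebra, so that \<open>D'\<close> is fixed. As a compression to diagonal blocks the
  restriction is contractive, faithful and positive.\<close>

section \<open>Bounded matrices on square summable families\<close>

text \<open>Since \<open>\<phi>\<close> is only locally injective, the range map of the groupoid
  need not be open and a convolution of continuous functions need not be continuous. The algebra is
  therefore approximated by matrices of bounded functions whose homogeneous parts stay in the
  algebra, and a restriction to part of the groupoid has to be produced by multiplying with elements
  already known to lie in it. This decides the range of the expectation. Restriction to the units
  alone may fail to fix D', which can contain functions living at non-unit isotropy elements;
  restriction to all of the isotropy may leave the algebra. The points whose mass belongs to the
  algebra lie in between: in non-zero degree, restriction to their isotropy is, on each ball, a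
  finite sum of two-sided cut-downs by point masses, and no element of D' lives on other non-unit
  isotropy. A further obstacle is positivity: a positive element must be a product
  \<open>c* c\<close> with \<open>c\<close> in the algebra itself, so being a positive matrix is not
  enough and a square root is built inside the algebra by iteration.\<close>

type_synonym 'i cmat = "'i \<Rightarrow> 'i \<Rightarrow> complex"

definition opbound :: "real \<Rightarrow> 'i cmat \<Rightarrow> bool" where
  "opbound C M \<longleftrightarrow> 0 \<le> C \<and> (\<forall>I J \<xi>. finite I \<longrightarrow> finite J \<longrightarrow>
     L2_set (\<lambda>i. cmod (\<Sum>j\<in>J. M i j * \<xi> j)) I \<le> C * L2_set (\<lambda>j. cmod (\<xi> j)) J)"

definition opnorm :: "'i cmat \<Rightarrow> real" where
  "opnorm M = Inf {C. opbound C M}"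

text \<open>For bounded matrices every sum converges absolutely by Cauchy-Schwarz, so the default
  value of \<open>infsum\<close> does not enter there.\<close>

definition mmult :: "'i cmat \<Rightarrow> 'i cmat \<Rightarrow> 'i cmat" where
  "mmult M N i k = (\<Sum>\<^sub>\<infinity>j. M i j * N j k)"

definition madj :: "'i cmat \<Rightarrow> 'i cmat" where
  "madj M i j = cnj (M j i)"

definition Bmat :: "'i cmat star_alg" where
  "Bmat = \<lparr>
     alg_carrier = {M. \<exists>C. opbound C M},
     alg_zero = (\<lambda>_ _. 0),
     alg_add = (\<lambda>M N i j. M i j + N i j),
     alg_scale = (\<lambda>c M i j. c * M i j),
     alg_mult = mmult,
     alg_star = madj,
     alg_norm = opnorm \<rparr>"

text \<open>The closed ball of radius \<open>b\<close> in the Hilbert space of square summable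
  families.\<close>

definition vbound :: "real \<Rightarrow> ('i \<Rightarrow> complex) \<Rightarrow> bool" where
  "vbound b v \<longleftrightarrow> (\<forall>J. finite J \<longrightarrow> L2_set (\<lambda>j. cmod (v j)) J \<le> b)"

definition mvec :: "'i cmat \<Rightarrow> ('i \<Rightarrow> complex) \<Rightarrow> 'i \<Rightarrow> complex" where
  "mvec M v i = (\<Sum>\<^sub>\<infinity>j. M i j * v j)"

lemma L2_set_cmod_sum_le:
  "L2_set (\<lambda>i. cmod (f i + g i)) I \<le> L2_set (\<lambda>i. cmod (f i)) I + L2_set (\<lambda>i. cmod (g i)) I"
proof -
  have "L2_set (\<lambda>i. cmod (f i + g i)) I \<le> L2_set (\<lambda>i. cmod (f i) + cmod (g i)) I"
    by (intro L2_set_mono norm_triangle_ineq) auto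
  also have "\<dots> \<le> L2_set (\<lambda>i. cmod (f i)) I + L2_set (\<lambda>i. cmod (g i)) I"
    by (rule L2_set_triangle_ineq)
  finally show ?thesis .
qed

lemma L2_set_cmod_mult: "L2_set (\<lambda>i. cmod (c * f i)) I = cmod c * L2_set (\<lambda>i. cmod (f i)) I"
  by (simp add: norm_mult L2_set_right_distrib)

lemma L2_set_square: "(L2_set f I)\<^sup>2 = (\<Sum>i\<in>I. (f i)\<^sup>2)"
  by (simp add: L2_set_def sum_nonneg)

lemma L2_set_subset_mono:
  assumes "finite J" "I \<subseteq> J"
  shows "L2_set f I \<le> L2_set f J"
  unfolding L2_set_def by (intro real_sqrt_le_mono sum_mono2) (use assms in auto)

lemma vbound_nonneg: "vbound b v \<Longrightarrow> 0 \<le> b"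
  unfolding vbound_def by (metis L2_set_empty finite.emptyI)

lemma opbound_nonneg: "opbound C M \<Longrightarrow> 0 \<le> C"
  by (simp add: opbound_def)

lemma vbound_mono: "vbound b v \<Longrightarrow> b \<le> c \<Longrightarrow> vbound c v"
  unfolding vbound_def by force

lemma opbound_mono: "opbound b v \<Longrightarrow> b \<le> c \<Longrightarrow> opbound c v"
  unfolding opbound_def by (meson L2_set_nonneg mult_right_mono order_trans)

lemma vbound_entry: "vbound b v \<Longrightarrow> cmod (v j) \<le> b"
  unfolding vbound_def by (drule spec[of _ "{j}"]) simp

lemma vbound_finite_support:
  assumes "finite J"
  shows "vbound (L2_set (\<lambda>j. cmod (v j)) J) (\<lambda>j. if j \<in> J then v j else 0)"
  unfolding vbound_def
proof (intro allI impI)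
  fix I :: "'a set" assume "finite I"
  have "L2_set (\<lambda>j. cmod (if j \<in> J then v j else 0)) I = L2_set (\<lambda>j. cmod (v j)) (I \<inter> J)"
    unfolding L2_set_def using \<open>finite I\<close>
    by (intro arg_cong[where f = sqrt]) (auto simp: sum.inter_restrict if_distrib intro!: sum.cong)
  then show "L2_set (\<lambda>j. cmod (if j \<in> J then v j else 0)) I \<le> L2_set (\<lambda>j. cmod (v j)) J"
    using assms by (simp add: L2_set_subset_mono)
qed

text \<open>Cauchy-Schwarz on every finite set bounds the partial sums of absolute values
  uniformly.\<close>

lemma vbound_mult:
  assumes v: "vbound a v" and w: "vbound b w"
  shows "(\<lambda>i. cmod (v i * w i)) summable_on UNIV"
    and "cmod (\<Sum>\<^sub>\<infinity>i. v i * w i) \<le> a * b"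
proof -
  have le: "(\<Sum>i\<in>F. cmod (v i * w i)) \<le> a * b" if "finite F" for F
  proof -
    have "(\<Sum>i\<in>F. cmod (v i * w i)) = (\<Sum>i\<in>F. \<bar>cmod (v i)\<bar> * \<bar>cmod (w i)\<bar>)"
      by (simp add: norm_mult)
    also have "\<dots> \<le> L2_set (\<lambda>i. cmod (v i)) F * L2_set (\<lambda>i. cmod (w i)) F"
      by (rule L2_set_mult_ineq)
    also have "\<dots> \<le> a * b"
      using v w that vbound_nonneg[OF v] unfolding vbound_def by (intro mult_mono) auto
    finally show ?thesis .
  qed
  show 1: "(\<lambda>i. cmod (v i * w i)) summable_on UNIV"
    by (rule nonneg_bdd_above_summable_on) (use le in \<open>auto intro!: bdd_aboveI[of _ "a * b"]\<close>)
  have "cmod (\<Sum>\<^sub>\<infinity>i. v i * w i) \<le> (\<Sum>\<^sub>\<infinity>i. cmod (v i * w i))"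
    by (rule norm_infsum_bound[OF 1])
  also have "\<dots> \<le> a * b" by (rule infsum_le_finite_sums[OF 1 le])
  finally show "cmod (\<Sum>\<^sub>\<infinity>i. v i * w i) \<le> a * b" .
qed

section \<open>Rows, columns and adjoints of bounded matrices\<close>

lemma opbound_apply:
  assumes "opbound C M" "finite I" "finite J"
  shows "L2_set (\<lambda>i. cmod (\<Sum>j\<in>J. M i j * \<xi> j)) I \<le> C * L2_set (\<lambda>j. cmod (\<xi> j)) J"
  using assms by (simp add: opbound_def)

lemma opbound_column:
  assumes "opbound C M"
  shows "vbound C (\<lambda>i. M i j)"
  unfolding vbound_def using opbound_apply[OF assms, of _ "{j}" "\<lambda>_. 1"] by simp

text \<open>Let \<open>v\<close> be the image of \<xi> under the adjoint, cut to \<open>I\<close>.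
  Its squared norm is the inner product of \<open>M v\<close> with \<xi>, hence at most
  \<open>C\<close> times the product of the norms of \<open>v\<close> and \<xi>; one factor
  cancels.\<close>

lemma opbound_madj:
  assumes M: "opbound C M"
  shows "opbound C (madj M)"
  unfolding opbound_def
proof (intro conjI allI impI)
  show "0 \<le> C" using M by (rule opbound_nonneg)
  fix I J :: "'a set" and \<xi> :: "'a \<Rightarrow> complex"
  assume fin: "finite I" "finite J"
  define v where "v i = (\<Sum>j\<in>J. madj M i j * \<xi> j)" for i
  let ?V = "L2_set (\<lambda>i. cmod (v i)) I" and ?X = "L2_set (\<lambda>j. cmod (\<xi> j)) J"
  have "complex_of_real (?V\<^sup>2) = (\<Sum>i\<in>I. cnj (v i) * v i)"
    by (simp add: L2_set_square complex_norm_square mult.commute del: of_real_power)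
  also have "\<dots> = (\<Sum>i\<in>I. \<Sum>j\<in>J. cnj (v i) * cnj (M j i) * \<xi> j)"
    by (simp add: v_def[of "_"] madj_def sum_distrib_left mult.assoc)
  also have "\<dots> = (\<Sum>j\<in>J. cnj (\<Sum>i\<in>I. M j i * v i) * \<xi> j)"
    by (subst sum.swap) (simp add: sum_distrib_left sum_distrib_right mult_ac)
  finally have "?V\<^sup>2 = cmod (\<Sum>j\<in>J. cnj (\<Sum>i\<in>I. M j i * v i) * \<xi> j)"
    by (metis abs_power2 norm_of_real)
  also have "\<dots> \<le> (\<Sum>j\<in>J. \<bar>cmod (\<Sum>i\<in>I. M j i * v i)\<bar> * \<bar>cmod (\<xi> j)\<bar>)"
    by (rule order_trans[OF norm_sum]) (simp add: norm_mult flip: cnj_sum complex_cnj_mult)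
  also have "\<dots> \<le> L2_set (\<lambda>j. cmod (\<Sum>i\<in>I. M j i * v i)) J * ?X"
    by (rule L2_set_mult_ineq)
  also have "\<dots> \<le> (C * ?V) * ?X"
    by (intro mult_right_mono opbound_apply M fin L2_set_nonneg)
  finally have "?V * ?V \<le> ?V * (C * ?X)" by (simp add: power2_eq_square mult_ac)
  then show "L2_set (\<lambda>i. cmod (\<Sum>j\<in>J. madj M i j * \<xi> j)) I \<le> C * ?X"
    unfolding v_def[symmetric] using \<open>0 \<le> C\<close>
    by (cases "?V = 0") (auto simp: mult_le_cancel_left_pos less_le)
qed

lemma madj_madj [simp]: "madj (madj M) = M"
  by (simp add: madj_def fun_eq_iff)

lemma opbound_madj_iff [simp]: "opbound C (madj M) \<longleftrightarrow> opbound C M"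
  by (metis madj_madj opbound_madj)

lemma opbound_row:
  assumes "opbound C M"
  shows "vbound C (\<lambda>j. M i j)"
  using opbound_column[OF opbound_madj[OF assms], of i] by (simp add: vbound_def madj_def)

lemma opbound_entry: "opbound C M \<Longrightarrow> cmod (M i j) \<le> C"
  using opbound_row vbound_entry by fastforce

lemma mvec_abs_summable:
  assumes "opbound C M" "vbound b v"
  shows "(\<lambda>j. cmod (M i j * v j)) summable_on UNIV"
  by (rule vbound_mult(1)[OF opbound_row[OF assms(1)] assms(2)])

lemma mvec_summable:
  assumes "opbound C M" "vbound b v"
  shows "(\<lambda>j. M i j * v j) summable_on UNIV"
  using mvec_abs_summable[OF assms] by (rule abs_summable_summable)

lemma mvec_entry:
  assumes "opbound C M" "vbound b v"
  shows "cmod (mvec M v i) \<le> C * b"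
  unfolding mvec_def by (rule vbound_mult(2)[OF opbound_row[OF assms(1)] assms(2)])

text \<open>For a fixed finite \<open>I\<close> the partial sums over finite \<open>J\<close>
  satisfy the bound, and a finite number of entries passes to the limit.\<close>

lemma vbound_mvec:
  assumes M: "opbound C M" and v: "vbound b v"
  shows "vbound (C * b) (mvec M v)"
  unfolding vbound_def
proof (intro allI impI)
  fix I :: "'a set" assume I: "finite I"
  have "((\<lambda>J. L2_set (\<lambda>i. cmod (\<Sum>j\<in>J. M i j * v j)) I) \<longlongrightarrow> L2_set (\<lambda>i. cmod (mvec M v i)) I)
      (finite_subsets_at_top UNIV)"
    unfolding L2_set_def mvec_def
    by (intro tendsto_intros infsum_tendsto mvec_summable[OF M v])
  moreover have "\<forall>\<^sub>F J in finite_subsets_at_top UNIV. L2_set (\<lambda>i. cmod (\<Sum>j\<in>J. M i j * v j)) I \<le> C * b"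
  proof (rule eventually_finite_subsets_at_top_weakI)
    fix J :: "'a set" assume "finite J"
    have "L2_set (\<lambda>i. cmod (\<Sum>j\<in>J. M i j * v j)) I \<le> C * L2_set (\<lambda>j. cmod (v j)) J"
      using M I \<open>finite J\<close> by (rule opbound_apply)
    also have "\<dots> \<le> C * b"
      using v \<open>finite J\<close> opbound_nonneg[OF M] by (intro mult_left_mono) (auto simp: vbound_def)
    finally show "L2_set (\<lambda>i. cmod (\<Sum>j\<in>J. M i j * v j)) I \<le> C * b" .
  qed
  ultimately show "L2_set (\<lambda>i. cmod (mvec M v i)) I \<le> C * b"
    by (rule tendsto_upperbound) simp
qed

section \<open>Products of bounded matrices\<close>

lemma mmult_eq_mvec: "mmult M N i k = mvec M (\<lambda>j. N j k) i"
  by (simp add: mmult_def mvec_def)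

lemma mmult_summable:
  assumes "opbound C M" "opbound D N"
  shows "(\<lambda>j. M i j * N j k) summable_on UNIV"
  using assms by (intro mvec_summable opbound_column)

lemma infsum_sum_commute:
  fixes f :: "'b \<Rightarrow> 'i \<Rightarrow> complex"
  assumes "finite K" "\<And>k. k \<in> K \<Longrightarrow> f k summable_on S"
  shows "(\<Sum>\<^sub>\<infinity>j\<in>S. \<Sum>k\<in>K. f k j) = (\<Sum>k\<in>K. \<Sum>\<^sub>\<infinity>j\<in>S. f k j)"
proof -
  have "(\<lambda>j. \<Sum>k\<in>K. f k j) summable_on S \<and> ?thesis"
    using assms by (induction K) (auto simp: infsum_add intro!: summable_on_add)
  then show ?thesis ..
qed

text \<open>With finitely many \<open>k\<close> the two summations can be exchanged; products
  applied to general vectors are reduced to this case.\<close>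

lemma sum_mmult:
  assumes M: "opbound C M" and N: "opbound D N" and "finite K"
  shows "(\<Sum>k\<in>K. mmult M N i k * \<xi> k) = mvec M (\<lambda>j. \<Sum>k\<in>K. N j k * \<xi> k) i"
proof -
  have "(\<Sum>k\<in>K. mmult M N i k * \<xi> k) = (\<Sum>k\<in>K. \<Sum>\<^sub>\<infinity>j. M i j * N j k * \<xi> k)"
    by (simp add: mmult_def mmult_summable[OF M N] infsum_cmult_left)
  also have "\<dots> = (\<Sum>\<^sub>\<infinity>j. \<Sum>k\<in>K. M i j * N j k * \<xi> k)"
    by (rule infsum_sum_commute[symmetric]) (intro \<open>finite K\<close> summable_on_cmult_left mmult_summable[OF M N])+
  also have "\<dots> = mvec M (\<lambda>j. \<Sum>k\<in>K. N j k * \<xi> k) i"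
    by (simp add: mvec_def sum_distrib_left mult.assoc)
  finally show ?thesis .
qed

lemma vbound_sum_apply:
  assumes "opbound C M" "finite J"
  shows "vbound (C * L2_set (\<lambda>j. cmod (\<xi> j)) J) (\<lambda>i. \<Sum>j\<in>J. M i j * \<xi> j)"
  using assms by (simp add: vbound_def opbound_apply)

lemma opbound_mmult:
  assumes M: "opbound C M" and N: "opbound D N"
  shows "opbound (C * D) (mmult M N)"
  unfolding opbound_def
proof (intro conjI allI impI)
  show "0 \<le> C * D" using assms by (simp add: opbound_nonneg)
  fix I K :: "'a set" and \<xi> :: "'a \<Rightarrow> complex"
  assume "finite I" "finite K"
  then have "L2_set (\<lambda>i. cmod (mvec M (\<lambda>j. \<Sum>k\<in>K. N j k * \<xi> k) i)) I
      \<le> C * (D * L2_set (\<lambda>k. cmod (\<xi> k)) K)"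
    using vbound_mvec[OF M vbound_sum_apply[OF N \<open>finite K\<close>, of \<xi>]] by (simp add: vbound_def)
  then show "L2_set (\<lambda>i. cmod (\<Sum>k\<in>K. mmult M N i k * \<xi> k)) I \<le> C * D * L2_set (\<lambda>k. cmod (\<xi> k)) K"
    using \<open>finite K\<close> by (simp add: sum_mmult[OF M N] mult.assoc)
qed

section \<open>Linear operations and the operator norm\<close>

lemma opbound_add:
  assumes "opbound C M" "opbound D N"
  shows "opbound (C + D) (\<lambda>i j. M i j + N i j)"
  unfolding opbound_def
proof (intro conjI allI impI)
  show "0 \<le> C + D" using assms by (simp add: opbound_nonneg)
  fix I J :: "'a set" and \<xi> :: "'a \<Rightarrow> complex"
  assume fin: "finite I" "finite J"
  have "L2_set (\<lambda>i. cmod (\<Sum>j\<in>J. (M i j + N i j) * \<xi> j)) I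
     \<le> L2_set (\<lambda>i. cmod (\<Sum>j\<in>J. M i j * \<xi> j)) I + L2_set (\<lambda>i. cmod (\<Sum>j\<in>J. N i j * \<xi> j)) I"
    by (simp add: distrib_right sum.distrib L2_set_cmod_sum_le)
  also have "\<dots> \<le> (C + D) * L2_set (\<lambda>j. cmod (\<xi> j)) J"
    unfolding distrib_right using fin assms by (intro add_mono opbound_apply)
  finally show "L2_set (\<lambda>i. cmod (\<Sum>j\<in>J. (M i j + N i j) * \<xi> j)) I \<le> \<dots>" .
qed

lemma opbound_scale:
  assumes "opbound C M"
  shows "opbound (cmod c * C) (\<lambda>i j. c * M i j)"
  unfolding opbound_def
proof (intro conjI allI impI)
  show "0 \<le> cmod c * C" using assms by (simp add: opbound_nonneg)
  fix I J :: "'a set" and \<xi> :: "'a \<Rightarrow> complex"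
  assume fin: "finite I" "finite J"
  have "L2_set (\<lambda>i. cmod (\<Sum>j\<in>J. c * M i j * \<xi> j)) I = cmod c * L2_set (\<lambda>i. cmod (\<Sum>j\<in>J. M i j * \<xi> j)) I"
    by (simp add: mult.assoc L2_set_cmod_mult flip: sum_distrib_left)
  also have "\<dots> \<le> cmod c * (C * L2_set (\<lambda>j. cmod (\<xi> j)) J)"
    using fin assms by (intro mult_left_mono opbound_apply) auto
  finally show "L2_set (\<lambda>i. cmod (\<Sum>j\<in>J. c * M i j * \<xi> j)) I \<le> cmod c * C * L2_set (\<lambda>j. cmod (\<xi> j)) J"
    by (simp add: mult.assoc)
qed

lemma opbound_zero: "opbound 0 (\<lambda>_ _. 0)"
  by (simp add: opbound_def L2_set_0')

text \<open>The infimum is attained because each of the finite inequalities is a closed condition on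
  the constant.\<close>

lemma opbound_opnorm:
  assumes "opbound C M"
  shows "opbound (opnorm M) M"
proof -
  let ?S = "{C. opbound C M}"
  have ne: "?S \<noteq> {}" and nn: "\<And>C. C \<in> ?S \<Longrightarrow> 0 \<le> C" using assms by (auto simp: opbound_nonneg)
  show ?thesis
    unfolding opbound_def
  proof (intro conjI allI impI)
    show "0 \<le> opnorm M" unfolding opnorm_def by (rule cInf_greatest[OF ne nn])
    fix I J :: "'a set" and \<xi> :: "'a \<Rightarrow> complex"
    assume fin: "finite I" "finite J"
    let ?L = "L2_set (\<lambda>i. cmod (\<Sum>j\<in>J. M i j * \<xi> j)) I" and ?X = "L2_set (\<lambda>j. cmod (\<xi> j)) J"
    show "?L \<le> opnorm M * ?X"
    proof (cases "?X = 0")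
      case True
      then show ?thesis using opbound_apply[OF assms fin, of \<xi>] by simp
    next
      case False
      then have X: "0 < ?X" by (simp add: less_le)
      have "?L / ?X \<le> Inf ?S"
      proof (rule cInf_greatest[OF ne])
        fix D assume "D \<in> ?S"
        then show "?L / ?X \<le> D" using opbound_apply[OF _ fin, of D M \<xi>] X by (simp add: divide_le_eq)
      qed
      then show ?thesis using X by (simp add: opnorm_def divide_le_eq)
    qed
  qed
qed

lemma opnorm_le: "opbound C M \<Longrightarrow> opnorm M \<le> C"
  unfolding opnorm_def by (rule cInf_lower) (auto intro: bdd_belowI opbound_nonneg)

lemma opnorm_nonneg: "opbound C M \<Longrightarrow> 0 \<le> opnorm M"
  using opbound_nonneg opbound_opnorm by blast

section \<open>Associativity of the product\<close>

lemma vbound_tail: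
  assumes v: "vbound b v" and "0 < e"
  obtains K where "finite K" "vbound e (\<lambda>j. if j \<in> K then 0 else v j)"
proof -
  let ?f = "\<lambda>j. (cmod (v j))\<^sup>2"
  have le: "sum ?f F \<le> b\<^sup>2" if "finite F" for F
    using v that vbound_nonneg[OF v] unfolding L2_set_square[symmetric] vbound_def
    by (intro power_mono) auto
  have sm: "?f summable_on UNIV"
    by (rule nonneg_bdd_above_summable_on) (use le in \<open>auto intro!: bdd_aboveI[of _ "b\<^sup>2"]\<close>)
  obtain K where K: "finite K" "dist (sum ?f K) (infsum ?f UNIV) \<le> e\<^sup>2"
    using infsum_finite_approximation[OF sm, of "e\<^sup>2"] \<open>0 < e\<close> by auto
  have "vbound e (\<lambda>j. if j \<in> K then 0 else v j)"
    unfolding vbound_def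
  proof (intro allI impI)
    fix J :: "'a set" assume J: "finite J"
    have "(\<Sum>j\<in>J. (cmod (if j \<in> K then 0 else v j))\<^sup>2) = sum ?f (J - K)"
      using J by (simp add: sum.If_cases Diff_eq if_distribR if_distrib[of "\<lambda>x. (cmod x)\<^sup>2"])
    also have "\<dots> = sum ?f (J \<union> K) - sum ?f K"
    proof -
      have "(J \<union> K) - K = J - K" by blast
      then show ?thesis using J K(1) sum.subset_diff[of K "J \<union> K" ?f] by simp
    qed
    also have "\<dots> \<le> infsum ?f UNIV - sum ?f K"
      using J K(1) by (simp add: finite_sum_le_infsum sm)
    also have "\<dots> \<le> e\<^sup>2" using K(2) by (simp add: dist_real_def)
    finally show "L2_set (\<lambda>j. cmod (if j \<in> K then 0 else v j)) J \<le> e"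
      unfolding L2_set_def using \<open>0 < e\<close> by (intro real_le_lsqrt) auto
  qed
  with K(1) show ?thesis by (rule that)
qed

lemma mvec_add:
  assumes "opbound C M" "vbound b v" "vbound c w"
  shows "mvec M (\<lambda>j. v j + w j) i = mvec M v i + mvec M w i"
  unfolding mvec_def distrib_left using assms by (intro infsum_add mvec_summable)

lemma mvec_finite_support:
  assumes "finite K"
  shows "mvec M (\<lambda>j. if j \<in> K then v j else 0) i = (\<Sum>j\<in>K. M i j * v j)"
proof -
  have "mvec M (\<lambda>j. if j \<in> K then v j else 0) i = (\<Sum>\<^sub>\<infinity>j\<in>K. M i j * v j)"
    unfolding mvec_def by (rule infsum_cong_neutral) auto
  then show ?thesis using assms by simp
qed

text \<open>The double series need not converge absolutely, so the order of summation is exchanged only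
  for finitely supported vectors, the rest being small in norm.\<close>

lemma mvec_mmult:
  assumes M: "opbound C M" and N: "opbound D N" and v: "vbound b v"
  shows "mvec (mmult M N) v i = mvec M (mvec N v) i"
proof -
  have "cmod (mvec (mmult M N) v i - mvec M (mvec N v) i) \<le> e" if "e > 0" for e
  proof -
    \<comment> \<open>Each of the two error terms will be at most \<open>C * D * d\<close>; the
      added 1 keeps the denominator positive.\<close>
    define d where "d = e / (2 * (C * D + 1))"
    have CD: "0 \<le> C * D" using M N by (simp add: opbound_nonneg)
    have d: "0 < d" "2 * (C * D * d) \<le> e"
    proof -
      show "0 < d" using CD that by (simp add: d_def add_nonneg_pos)
      then have "2 * (C * D * d) \<le> 2 * ((C * D + 1) * d)" by (simp add: distrib_right)
      also have "\<dots> = e" using CD by (simp add: d_def add_nonneg_pos less_imp_neq[symmetric] field_simps)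
      finally show "2 * (C * D * d) \<le> e" .
    qed
    obtain K where K: "finite K" and w: "vbound d (\<lambda>j. if j \<in> K then 0 else v j)" (is "vbound d ?w")
      using vbound_tail[OF v d(1)] by blast
    let ?u = "\<lambda>j. if j \<in> K then v j else 0"
    note u = vbound_finite_support[OF K, of v]
    have v_eq: "v = (\<lambda>j. ?u j + ?w j)" by auto
    have *: "mvec (mmult M N) ?u i = mvec M (mvec N ?u) i"
    proof -
      have "mvec N ?u = (\<lambda>j. \<Sum>k\<in>K. N j k * v k)" by (rule ext) (rule mvec_finite_support[OF K])
      then show ?thesis by (simp add: mvec_finite_support[OF K] sum_mmult[OF M N K])
    qed
    have "mvec (mmult M N) v i = mvec (mmult M N) ?u i + mvec (mmult M N) ?w i"
      by (subst v_eq) (rule mvec_add[OF opbound_mmult[OF M N] u w])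
    moreover have "mvec N v = (\<lambda>j. mvec N ?u j + mvec N ?w j)"
      by (rule ext, subst v_eq) (rule mvec_add[OF N u w])
    then have "mvec M (mvec N v) i = mvec M (mvec N ?u) i + mvec M (mvec N ?w) i"
      using mvec_add[OF M vbound_mvec[OF N u] vbound_mvec[OF N w]] by simp
    ultimately have "mvec (mmult M N) v i - mvec M (mvec N v) i = mvec (mmult M N) ?w i - mvec M (mvec N ?w) i"
      using * by simp
    also have "cmod \<dots> \<le> C * D * d + C * (D * d)"
      by (intro order_trans[OF norm_triangle_ineq4] add_mono mvec_entry[OF opbound_mmult[OF M N] w]
          mvec_entry[OF M vbound_mvec[OF N w]])
    also have "\<dots> \<le> e" using d(2) by simp
    finally show ?thesis .
  qed
  then have "cmod (mvec (mmult M N) v i - mvec M (mvec N v) i) \<le> 0"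
    by (rule field_le_epsilon) simp
  then show ?thesis by simp
qed

lemma mmult_assoc:
  assumes "opbound C M" "opbound D N" "opbound E P"
  shows "mmult (mmult M N) P = mmult M (mmult N P)"
  by (intro ext) (simp add: mmult_eq_mvec mvec_mmult[OF assms(1,2) opbound_column[OF assms(3)]])

lemma madj_mmult: "madj (mmult M N) = mmult (madj N) (madj M)"
  by (intro ext) (simp add: madj_def mmult_def mult.commute flip: infsum_cnj)

text \<open>Both the C*-identity and the estimate for \<open>1 - M* M\<close> rest on this: the
  squared norm of \<open>M \<xi>\<close> is the inner product of \<xi> with
  \<open>M* M \<xi>\<close>.\<close>

lemma infsum_square_apply:
  fixes M :: "'i cmat" and \<xi> :: "'i \<Rightarrow> complex"
  assumes M: "opbound C M" and J: "finite J"
  defines "w \<equiv> \<lambda>i. \<Sum>j\<in>J. M i j * \<xi> j"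
  shows "(\<lambda>i. (cmod (w i))\<^sup>2) summable_on UNIV"
    and "complex_of_real (\<Sum>\<^sub>\<infinity>i. (cmod (w i))\<^sup>2) = (\<Sum>j\<in>J. cnj (\<xi> j) * mvec (madj M) w j)"
proof -
  let ?X = "L2_set (\<lambda>j. cmod (\<xi> j)) J"
  have w: "vbound (C * ?X) w" unfolding w_def by (rule vbound_sum_apply[OF M J])
  then have "vbound (C * ?X) (\<lambda>i. cnj (w i))" by (simp add: vbound_def)
  from vbound_mult(1)[OF this w] show sw: "(\<lambda>i. (cmod (w i))\<^sup>2) summable_on UNIV"
    by (simp add: norm_mult power2_eq_square)
  have "complex_of_real (\<Sum>\<^sub>\<infinity>i. (cmod (w i))\<^sup>2) = (\<Sum>\<^sub>\<infinity>i. complex_of_real ((cmod (w i))\<^sup>2))"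
    by (rule infsumI[symmetric]) (rule has_sum_of_real[OF has_sum_infsum[OF sw]])
  also have "\<dots> = (\<Sum>\<^sub>\<infinity>i. \<Sum>j\<in>J. cnj (\<xi> j) * (madj M j i * w i))"
  proof (rule infsum_cong)
    fix i
    have "cnj (w i) = (\<Sum>j\<in>J. cnj (\<xi> j) * madj M j i)"
      by (simp add: w_def madj_def mult.commute)
    then show "complex_of_real ((cmod (w i))\<^sup>2) = (\<Sum>j\<in>J. cnj (\<xi> j) * (madj M j i * w i))"
      unfolding complex_norm_square mult.commute[of "w i"] by (simp add: sum_distrib_right mult.assoc)
  qed
  also have "\<dots> = (\<Sum>j\<in>J. \<Sum>\<^sub>\<infinity>i. cnj (\<xi> j) * (madj M j i * w i))"
    by (rule infsum_sum_commute)
       (intro J summable_on_cmult_right mvec_summable[OF opbound_madj[OF M] w])+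
  also have "\<dots> = (\<Sum>j\<in>J. cnj (\<xi> j) * mvec (madj M) w j)"
    by (simp add: mvec_def infsum_cmult_right mvec_summable[OF opbound_madj[OF M] w])
  finally show "complex_of_real (\<Sum>\<^sub>\<infinity>i. (cmod (w i))\<^sup>2) = (\<Sum>j\<in>J. cnj (\<xi> j) * mvec (madj M) w j)" .
qed

text \<open>Cauchy-Schwarz bounds the inner product of \<xi> with \<open>M* M \<xi>\<close> by
  \<open>c\<close> times the squared norm of \<xi>. This is the half of the C*-identity that does
  not follow from submultiplicativity.\<close>

lemma opbound_of_madj_mmult:
  assumes M: "opbound C M" and c: "opbound c (mmult (madj M) M)"
  shows "opbound (sqrt c) M"
  unfolding opbound_def
proof (intro conjI allI impI)
  show "0 \<le> sqrt c" using c by (simp add: opbound_nonneg)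
  fix I J :: "'a set" and \<xi> :: "'a \<Rightarrow> complex"
  assume I: "finite I" and J: "finite J"
  define w where "w i = (\<Sum>j\<in>J. M i j * \<xi> j)" for i
  let ?X = "L2_set (\<lambda>j. cmod (\<xi> j)) J"
  note sq = infsum_square_apply[OF M J, of \<xi>, folded w_def]
  have "(L2_set (\<lambda>i. cmod (w i)) I)\<^sup>2 \<le> (\<Sum>\<^sub>\<infinity>i. (cmod (w i))\<^sup>2)"
    unfolding L2_set_square by (rule finite_sum_le_infsum[OF sq(1) I]) auto
  also have "\<dots> \<le> cmod (\<Sum>j\<in>J. cnj (\<xi> j) * (\<Sum>k\<in>J. mmult (madj M) M j k * \<xi> k))"
    unfolding sum_mmult[OF opbound_madj[OF M] M J] w_def[abs_def, symmetric] sq(2)[symmetric] by simp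
  also have "\<dots> \<le> (\<Sum>j\<in>J. \<bar>cmod (\<xi> j)\<bar> * \<bar>cmod (\<Sum>k\<in>J. mmult (madj M) M j k * \<xi> k)\<bar>)"
    by (rule order_trans[OF norm_sum]) (simp add: norm_mult)
  also have "\<dots> \<le> ?X * L2_set (\<lambda>j. cmod (\<Sum>k\<in>J. mmult (madj M) M j k * \<xi> k)) J"
    by (rule L2_set_mult_ineq)
  also have "\<dots> \<le> ?X * (c * ?X)"
    by (intro mult_left_mono opbound_apply[OF c J J]) auto
  also have "\<dots> = (sqrt c * ?X)\<^sup>2"
    unfolding power_mult_distrib real_sqrt_pow2[OF opbound_nonneg[OF c]] by (simp add: power2_eq_square)
  finally have "(L2_set (\<lambda>i. cmod (w i)) I)\<^sup>2 \<le> (sqrt c * ?X)\<^sup>2" .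
  then show "L2_set (\<lambda>i. cmod (\<Sum>j\<in>J. M i j * \<xi> j)) I \<le> sqrt c * ?X"
    unfolding w_def[symmetric] by (rule power2_le_imp_le) (use opbound_nonneg[OF c] in simp)
qed

lemma opnorm_cstar:
  assumes M: "opbound C M"
  shows "opnorm (mmult (madj M) M) = (opnorm M)\<^sup>2"
proof (rule antisym)
  note B = opbound_opnorm[OF M]
  note P = opbound_mmult[OF opbound_madj[OF B] B]
  show "opnorm (mmult (madj M) M) \<le> (opnorm M)\<^sup>2"
    using opnorm_le[OF P] by (simp add: power2_eq_square)
  have "opnorm M \<le> sqrt (opnorm (mmult (madj M) M))"
    by (rule opnorm_le[OF opbound_of_madj_mmult[OF M opbound_opnorm[OF P]]])
  then show "(opnorm M)\<^sup>2 \<le> opnorm (mmult (madj M) M)"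
    using opnorm_nonneg[OF M] opnorm_nonneg[OF P] by (metis power_mono real_sqrt_pow2)
qed

lemma opnorm_triangle:
  assumes "opbound C M" "opbound D N"
  shows "opnorm (\<lambda>i j. M i j + N i j) \<le> opnorm M + opnorm N"
  using assms by (intro opnorm_le opbound_add opbound_opnorm)

lemma opnorm_scale_le:
  assumes "opbound C M"
  shows "opnorm (\<lambda>i j. c * M i j) \<le> cmod c * opnorm M"
  using assms by (intro opnorm_le opbound_scale opbound_opnorm)

lemma opnorm_scale:
  assumes M: "opbound C M"
  shows "opnorm (\<lambda>i j. c * M i j) = cmod c * opnorm M"
proof (cases "c = 0")
  case True
  have "opnorm (\<lambda>i j. 0) = 0"
    using opnorm_le[OF opbound_zero] opnorm_nonneg[OF opbound_zero] by (rule antisym)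
  with True show ?thesis by simp
next
  case False
  then have "opnorm M = opnorm (\<lambda>i j. (1 / c) * (c * M i j))" by simp
  also have "\<dots> \<le> cmod (1 / c) * opnorm (\<lambda>i j. c * M i j)"
    by (rule opnorm_scale_le[OF opbound_scale[OF M]])
  finally have "cmod c * opnorm M \<le> opnorm (\<lambda>i j. c * M i j)"
    using False by (simp add: norm_divide field_simps)
  then show ?thesis using opnorm_scale_le[OF M, of c] by simp
qed

text \<open>Each finite inequality involves only finitely many entries, so entrywise convergence is
  enough.\<close>

lemma opbound_limit:
  assumes u: "\<And>n. opbound C (u n)" and lim: "\<And>i j. (\<lambda>n. u n i j) \<longlonglongrightarrow> M i j"
  shows "opbound C M"
  unfolding opbound_def
proof (intro conjI allI impI)
  show "0 \<le> C" using u by (rule opbound_nonneg)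
  fix I J :: "'a set" and \<xi> :: "'a \<Rightarrow> complex"
  assume fin: "finite I" "finite J"
  have "(\<lambda>n. L2_set (\<lambda>i. cmod (\<Sum>j\<in>J. u n i j * \<xi> j)) I) \<longlonglongrightarrow> L2_set (\<lambda>i. cmod (\<Sum>j\<in>J. M i j * \<xi> j)) I"
    unfolding L2_set_def by (intro tendsto_intros lim)
  then show "L2_set (\<lambda>i. cmod (\<Sum>j\<in>J. M i j * \<xi> j)) I \<le> C * L2_set (\<lambda>j. cmod (\<xi> j)) J"
    by (rule LIMSEQ_le_const2) (use opbound_apply[OF u fin] in blast)
qed

lemma Bmat_simps [simp]:
  "M \<in> alg_carrier Bmat \<longleftrightarrow> (\<exists>C. opbound C M)"
  "alg_zero Bmat = (\<lambda>_ _. 0)"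
  "alg_add Bmat M N = (\<lambda>i j. M i j + N i j)"
  "alg_scale Bmat c M = (\<lambda>i j. c * M i j)"
  "alg_mult Bmat M N = mmult M N"
  "alg_star Bmat M = madj M"
  "alg_norm Bmat M = opnorm M"
  "alg_dist Bmat M N = opnorm (\<lambda>i j. M i j - N i j)"
  by (simp_all add: Bmat_def alg_dist_def)

lemma opbound_diff:
  assumes "opbound C M" "opbound D N"
  shows "opbound (C + D) (\<lambda>i j. M i j - N i j)"
  using opbound_add[OF assms(1) opbound_scale[OF assms(2), of "-1"]] by simp

lemma opnorm_entry: "opbound C M \<Longrightarrow> cmod (M i j) \<le> opnorm M"
  by (rule opbound_entry[OF opbound_opnorm])

text \<open>The norm dominates the entries, so a limit exists entrywise; sending one index of the
  Cauchy estimate to infinity by \<open>opbound_limit\<close> upgrades it to a limit in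
  norm.\<close>

lemma Bmat_complete:
  assumes u: "alg_Cauchy Bmat u"
  shows "\<exists>M\<in>alg_carrier Bmat. (\<lambda>n. alg_dist Bmat (u n) M) \<longlonglongrightarrow> 0"
proof -
  have "\<exists>C. opbound C (u n)" for n using u by (simp add: alg_Cauchy_def)
  then obtain B where B: "\<And>n. opbound (B n) (u n)" by metis
  have Cau: "\<exists>N. \<forall>m\<ge>N. \<forall>n\<ge>N. opnorm (\<lambda>i j. u m i j - u n i j) < e" if "e > 0" for e
    using u that by (simp add: alg_Cauchy_def)
  note D = opbound_diff[OF B B]
  have "Cauchy (\<lambda>n. u n i j)" for i j
  proof (rule CauchyI)
    fix e :: real assume "e > 0"
    then obtain N where "\<forall>m\<ge>N. \<forall>n\<ge>N. opnorm (\<lambda>i j. u m i j - u n i j) < e" using Cau by blast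
    then show "\<exists>N. \<forall>m\<ge>N. \<forall>n\<ge>N. cmod (u m i j - u n i j) < e"
      using opnorm_entry[OF D] by (meson le_less_trans)
  qed
  then have "\<exists>l. (\<lambda>n. u n i j) \<longlonglongrightarrow> l" for i j by (simp add: Cauchy_convergent_iff convergent_def)
  then obtain M where M: "\<And>i j. (\<lambda>n. u n i j) \<longlonglongrightarrow> M i j" by metis
  have close: "\<exists>N. \<forall>n\<ge>N. opbound e (\<lambda>i j. u n i j - M i j)" if "e > 0" for e
  proof -
    obtain N where N: "\<forall>m\<ge>N. \<forall>n\<ge>N. opnorm (\<lambda>i j. u m i j - u n i j) < e" using Cau \<open>e > 0\<close> by blast
    have "opbound e (\<lambda>i j. u n i j - M i j)" if "n \<ge> N" for n
    proof (rule opbound_limit)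
      show "opbound e (\<lambda>i j. u n i j - u (m + N) i j)" for m
        by (rule opbound_mono[OF opbound_opnorm[OF D]]) (use N that in \<open>simp add: less_imp_le\<close>)
      show "(\<lambda>m. u n i j - u (m + N) i j) \<longlonglongrightarrow> u n i j - M i j" for i j
        by (intro tendsto_intros LIMSEQ_ignore_initial_segment M)
    qed
    then show ?thesis by blast
  qed
  obtain N where "opbound 1 (\<lambda>i j. u N i j - M i j)" using close[of 1] by auto
  from opbound_diff[OF B[of N] this] have "M \<in> alg_carrier Bmat" by auto
  moreover have "(\<lambda>n. opnorm (\<lambda>i j. u n i j - M i j)) \<longlonglongrightarrow> 0"
  proof (rule LIMSEQ_I)
    fix e :: real assume "e > 0"
    then obtain N where N: "\<And>n. n \<ge> N \<Longrightarrow> opbound (e/2) (\<lambda>i j. u n i j - M i j)" using close[of "e/2"] by auto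
    have "norm (opnorm (\<lambda>i j. u n i j - M i j) - 0) < e" if "n \<ge> N" for n
      using opnorm_le[OF N[OF that]] opnorm_nonneg[OF N[OF that]] \<open>e > 0\<close> by simp
    then show "\<exists>N. \<forall>n\<ge>N. norm (opnorm (\<lambda>i j. u n i j - M i j) - 0) < e" by blast
  qed
  ultimately show ?thesis by (intro bexI[of _ M]) simp_all
qed

lemma mmult_add_left:
  assumes "opbound C M" "opbound D N" "opbound E P"
  shows "mmult (\<lambda>i j. M i j + N i j) P = (\<lambda>i j. mmult M P i j + mmult N P i j)"
  unfolding mmult_def distrib_right using assms by (intro ext infsum_add mmult_summable)

lemma mmult_add_right:
  assumes "opbound C M" "opbound D N" "opbound E P"
  shows "mmult M (\<lambda>i j. N i j + P i j) = (\<lambda>i j. mmult M N i j + mmult M P i j)"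
  unfolding mmult_def distrib_left using assms by (intro ext infsum_add mmult_summable)

lemma mmult_scale_left:
  assumes "opbound C M" "opbound D N"
  shows "mmult (\<lambda>i j. c * M i j) N = (\<lambda>i j. c * mmult M N i j)"
  unfolding mmult_def mult.assoc using assms by (intro ext infsum_cmult_right mmult_summable)

lemma mmult_scale_right:
  assumes "opbound C M" "opbound D N"
  shows "mmult M (\<lambda>i j. c * N i j) = (\<lambda>i j. c * mmult M N i j)"
  unfolding mmult_def mult.left_commute[of _ c] using assms by (intro ext infsum_cmult_right mmult_summable)

lemma opnorm_eq_0:
  assumes M: "opbound C M"
  shows "opnorm M = 0 \<longleftrightarrow> M = (\<lambda>_ _. 0)"
proof
  assume "opnorm M = 0"
  then show "M = (\<lambda>_ _. 0)" using opnorm_entry[OF M] by (intro ext) simp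
next
  assume "M = (\<lambda>_ _. 0)"
  then show "opnorm M = 0" using opnorm_scale[OF M, of 0] by simp
qed

text \<open>The case numbers follow the order of the axioms in the locale; those not listed are
  pointwise identities.\<close>

theorem cstar_algebra_Bmat: "cstar_algebra (Bmat :: 'i cmat star_alg)"
proof (rule cstar_algebra.intro, goal_cases)
  case 1 show ?case using opbound_zero by auto
next
  case 2 then show ?case by (simp, blast intro: opbound_add)
next
  case 3 then show ?case by (simp, blast intro: opbound_scale)
next
  case 4 then show ?case by (simp, blast intro: opbound_mmult)
next
  case 5 then show ?case by simp
next
  case 6 then show ?case by (simp add: add.assoc)
next
  case 7 then show ?case by (simp add: add.commute)
next
  case 14 then show ?case by (simp, blast intro: mmult_assoc)
next
  case 15 then show ?case by (simp, blast intro: mmult_add_left)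
next
  case 16 then show ?case by (simp, blast intro: mmult_add_right)
next
  case 17 then show ?case by (simp, blast intro: mmult_scale_left)
next
  case 18 then show ?case by (simp, blast intro: mmult_scale_right)
next
  case 19 then show ?case by (simp add: madj_def fun_eq_iff)
next
  case 20 then show ?case by (simp add: madj_def fun_eq_iff)
next
  case 21 then show ?case by (simp add: madj_mmult)
next
  case 23 then show ?case by (simp, blast intro: opnorm_nonneg)
next
  case 24 then show ?case using opnorm_eq_0 by (simp, blast)
next
  case 25 then show ?case by (simp, blast intro: opnorm_triangle)
next
  case 26 then show ?case by (simp, blast intro: opnorm_scale)
next
  case 27 then show ?case by (simp, blast intro: opnorm_le opbound_mmult opbound_opnorm)
next
  case 28 then show ?case by (simp, blast intro: opnorm_cstar)
next
  case (29 u) then show ?case by (rule Bmat_complete)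
qed (simp_all add: distrib_left distrib_right mult.assoc)


section \<open>Limits, restrictions and closures in a C*-algebra\<close>

lemma alg_restrict_simps [simp]:
  "alg_carrier (alg_restrict A D) = D" "alg_zero (alg_restrict A D) = alg_zero A"
  "alg_add (alg_restrict A D) = alg_add A" "alg_scale (alg_restrict A D) = alg_scale A"
  "alg_mult (alg_restrict A D) = alg_mult A" "alg_star (alg_restrict A D) = alg_star A"
  "alg_norm (alg_restrict A D) = alg_norm A" "alg_dist (alg_restrict A D) = alg_dist A"
  by (simp_all add: alg_restrict_def alg_dist_def fun_eq_iff)

definition alg_closure :: "'e star_alg \<Rightarrow> 'e set \<Rightarrow> 'e set" where
  "alg_closure A S = {a \<in> alg_carrier A. \<forall>e>0. \<exists>s\<in>S. alg_dist A s a < e}"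

definition star_subalgebra :: "'e star_alg \<Rightarrow> 'e set \<Rightarrow> bool" where
  "star_subalgebra A S \<longleftrightarrow> S \<subseteq> alg_carrier A \<and> alg_zero A \<in> S
     \<and> (\<forall>a\<in>S. \<forall>b\<in>S. alg_add A a b \<in> S \<and> alg_mult A a b \<in> S)
     \<and> (\<forall>a\<in>S. \<forall>c. alg_scale A c a \<in> S) \<and> (\<forall>a\<in>S. alg_star A a \<in> S)"

lemma cstar_subalgebra_alt:
  "cstar_subalgebra A D \<longleftrightarrow> star_subalgebra A D
     \<and> (\<forall>u. \<forall>a\<in>alg_carrier A. (\<forall>n. u n \<in> D) \<and> (\<lambda>n. alg_dist A (u n) a) \<longlonglongrightarrow> 0 \<longrightarrow> a \<in> D)"
  by (auto simp: cstar_subalgebra_def star_subalgebra_def)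

lemma cstar_subalgebra_limit:
  assumes D: "cstar_subalgebra A D" and "\<And>n. u n \<in> D" "a \<in> alg_carrier A"
    and "(\<lambda>n. alg_dist A (u n) a) \<longlonglongrightarrow> 0"
  shows "a \<in> D"
proof -
  have "\<forall>u. \<forall>a\<in>alg_carrier A. (\<forall>n. u n \<in> D) \<and> (\<lambda>n. alg_dist A (u n) a) \<longlonglongrightarrow> 0 \<longrightarrow> a \<in> D"
    using D by (simp add: cstar_subalgebra_def)
  then show ?thesis using assms(2-4) by (elim allE[of _ u]) auto
qed

context cstar_algebra
begin

lemmas closed = zero_closed add_closed scale_closed mult_closed star_closed

section \<open>The metric and the continuity of the operations\<close>

lemma add_left_commute:
  "\<lbrakk>a \<in> alg_carrier A; b \<in> alg_carrier A; d \<in> alg_carrier A\<rbrakk>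
    \<Longrightarrow> alg_add A a (alg_add A b d) = alg_add A b (alg_add A a d)"
  by (metis add_assoc add_commute)

lemma add_zero_right: "a \<in> alg_carrier A \<Longrightarrow> alg_add A a (alg_zero A) = a"
  by (metis add_commute add_zero zero_closed)

lemma add_minus_cancel:
  "\<lbrakk>a \<in> alg_carrier A; b \<in> alg_carrier A\<rbrakk> \<Longrightarrow> alg_add A a (alg_add A (alg_scale A (-1) a) b) = b"
  by (simp add: add_assoc[symmetric] closed add_minus add_zero)

lemma dist_nonneg: "a \<in> alg_carrier A \<Longrightarrow> b \<in> alg_carrier A \<Longrightarrow> 0 \<le> alg_dist A a b"
  by (simp add: alg_dist_def closed norm_nonneg)

lemma dist_zero_iff:
  assumes "a \<in> alg_carrier A" "b \<in> alg_carrier A"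
  shows "alg_dist A a b = 0 \<longleftrightarrow> a = b"
proof
  assume "alg_dist A a b = 0"
  then have "alg_add A a (alg_scale A (-1) b) = alg_zero A"
    using assms by (simp add: alg_dist_def norm_eq_zero closed)
  then have "alg_add A b (alg_add A (alg_scale A (-1) b) a) = b"
    using assms by (simp add: add_commute[of _ a] add_zero_right closed)
  then show "a = b" using assms by (simp add: add_minus_cancel)
next
  assume "a = b"
  then show "alg_dist A a b = 0" using assms by (simp add: alg_dist_def add_minus norm_eq_zero closed)
qed

lemma dist_commute:
  assumes "a \<in> alg_carrier A" "b \<in> alg_carrier A"
  shows "alg_dist A a b = alg_dist A b a"
proof -
  have "alg_scale A (-1) (alg_add A a (alg_scale A (-1) b)) = alg_add A b (alg_scale A (-1) a)"
    using assms by (simp add: scale_add_right scale_scale scale_one closed add_commute)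
  then have "alg_dist A b a = alg_norm A (alg_scale A (-1) (alg_add A a (alg_scale A (-1) b)))"
    by (simp add: alg_dist_def)
  then show ?thesis using assms by (simp add: norm_scale closed alg_dist_def)
qed

lemma dist_triangle:
  assumes "a \<in> alg_carrier A" "b \<in> alg_carrier A" "d \<in> alg_carrier A"
  shows "alg_dist A a d \<le> alg_dist A a b + alg_dist A b d"
proof -
  let ?m = "alg_scale A (-1)"
  have "alg_add A (?m b) (alg_add A b (?m d)) = ?m d"
    using assms by (subst add_left_commute) (simp_all add: closed add_minus_cancel)
  then have "alg_add A (alg_add A a (?m b)) (alg_add A b (?m d)) = alg_add A a (?m d)"
    using assms by (simp add: add_assoc closed)
  then show ?thesis
    unfolding alg_dist_def using assms norm_triangle[of "alg_add A a (?m b)" "alg_add A b (?m d)"]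
    by (simp add: closed)
qed

lemma dist_add:
  assumes "a \<in> alg_carrier A" "b \<in> alg_carrier A" "a' \<in> alg_carrier A" "b' \<in> alg_carrier A"
  shows "alg_dist A (alg_add A a b) (alg_add A a' b') \<le> alg_dist A a a' + alg_dist A b b'"
proof -
  let ?m = "alg_scale A (-1)"
  have "alg_add A (alg_add A a b) (?m (alg_add A a' b'))
      = alg_add A (alg_add A a (?m a')) (alg_add A b (?m b'))"
    using assms by (simp add: scale_add_right closed add_assoc add_left_commute[of b])
  then show ?thesis
    unfolding alg_dist_def using assms norm_triangle[of "alg_add A a (?m a')" "alg_add A b (?m b')"]
    by (simp add: closed)
qed

lemma dist_scale:
  assumes "a \<in> alg_carrier A" "b \<in> alg_carrier A"
  shows "alg_dist A (alg_scale A c a) (alg_scale A c b) = cmod c * alg_dist A a b"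
proof -
  have "alg_add A (alg_scale A c a) (alg_scale A (-1) (alg_scale A c b))
      = alg_scale A c (alg_add A a (alg_scale A (-1) b))"
    using assms by (simp add: scale_add_right scale_scale closed mult.commute)
  then show ?thesis using assms by (simp add: alg_dist_def norm_scale closed)
qed

text \<open>The C*-identity and submultiplicativity give
  \<open>|a|^2 = |a* a| \<le> |a*| |a|\<close>, and a non-zero \<open>|a|\<close> cancels.\<close>

lemma norm_star_le:
  assumes "a \<in> alg_carrier A"
  shows "alg_norm A a \<le> alg_norm A (alg_star A a)"
proof (cases "alg_norm A a = 0")
  case False
  have "alg_norm A a * alg_norm A a \<le> alg_norm A (alg_star A a) * alg_norm A a"
    using assms norm_mult[of "alg_star A a" a] by (simp add: cstar_identity closed power2_eq_square)
  then show ?thesis using False assms norm_nonneg[of a] by simp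
qed (simp add: assms closed norm_nonneg)

lemma norm_star: "a \<in> alg_carrier A \<Longrightarrow> alg_norm A (alg_star A a) = alg_norm A a"
  using norm_star_le[of a] norm_star_le[of "alg_star A a"] by (simp add: star_star closed)

lemma dist_star:
  assumes "a \<in> alg_carrier A" "b \<in> alg_carrier A"
  shows "alg_dist A (alg_star A a) (alg_star A b) = alg_dist A a b"
proof -
  have "alg_add A (alg_star A a) (alg_scale A (-1) (alg_star A b))
      = alg_star A (alg_add A a (alg_scale A (-1) b))"
    using assms by (simp add: star_add star_scale closed)
  then show ?thesis using assms by (simp add: alg_dist_def norm_star closed)
qed

lemma dist_mult_left:
  assumes "a \<in> alg_carrier A" "b \<in> alg_carrier A" "b' \<in> alg_carrier A"
  shows "alg_dist A (alg_mult A a b) (alg_mult A a b') \<le> alg_norm A a * alg_dist A b b'"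
proof -
  have "alg_add A (alg_mult A a b) (alg_scale A (-1) (alg_mult A a b'))
      = alg_mult A a (alg_add A b (alg_scale A (-1) b'))"
    using assms by (simp add: mult_add_right mult_scale_right closed)
  then show ?thesis using assms by (simp add: alg_dist_def norm_mult closed)
qed

lemma dist_mult_right:
  assumes "a \<in> alg_carrier A" "a' \<in> alg_carrier A" "b \<in> alg_carrier A"
  shows "alg_dist A (alg_mult A a b) (alg_mult A a' b) \<le> alg_dist A a a' * alg_norm A b"
proof -
  have "alg_add A (alg_mult A a b) (alg_scale A (-1) (alg_mult A a' b))
      = alg_mult A (alg_add A a (alg_scale A (-1) a')) b"
    using assms by (simp add: mult_add_left mult_scale_left closed)
  then show ?thesis using assms by (simp add: alg_dist_def norm_mult closed)
qed

lemma norm_eq_dist: "a \<in> alg_carrier A \<Longrightarrow> alg_norm A a = alg_dist A a (alg_zero A)"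
proof -
  assume a: "a \<in> alg_carrier A"
  have "alg_scale A (-1) (alg_zero A) = alg_zero A"
    by (metis add_minus add_zero scale_closed zero_closed)
  then show ?thesis using a by (simp add: alg_dist_def add_zero_right)
qed

lemma norm_le_dist:
  assumes "a \<in> alg_carrier A" "b \<in> alg_carrier A"
  shows "\<bar>alg_norm A a - alg_norm A b\<bar> \<le> alg_dist A a b"
  using assms dist_triangle[of a b "alg_zero A"] dist_triangle[of b a "alg_zero A"]
  by (simp add: norm_eq_dist closed dist_commute)

text \<open>The norm of \<open>a\<close> is estimated through \<open>a'\<close>, so that the
  right-hand side tends to 0 when \<open>a'\<close> and \<open>b'\<close> are fixed limits and
  \<open>a\<close> and \<open>b\<close> run through sequences.\<close>

lemma dist_mult:
  assumes "a \<in> alg_carrier A" "b \<in> alg_carrier A" "a' \<in> alg_carrier A" "b' \<in> alg_carrier A"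
  shows "alg_dist A (alg_mult A a b) (alg_mult A a' b')
    \<le> (alg_norm A a' + alg_dist A a a') * alg_dist A b b' + alg_dist A a a' * alg_norm A b'"
proof -
  have "alg_dist A (alg_mult A a b) (alg_mult A a' b')
    \<le> alg_dist A (alg_mult A a b) (alg_mult A a b') + alg_dist A (alg_mult A a b') (alg_mult A a' b')"
    using assms by (intro dist_triangle closed)
  also have "\<dots> \<le> alg_norm A a * alg_dist A b b' + alg_dist A a a' * alg_norm A b'"
    using assms by (intro add_mono dist_mult_left dist_mult_right)
  also have "alg_norm A a \<le> alg_norm A a' + alg_dist A a a'"
    using norm_le_dist[of a a'] assms by simp
  finally show ?thesis using assms by (simp add: dist_nonneg mult_right_mono)
qed

lemma tendsto_unique:
  assumes "\<And>n. u n \<in> alg_carrier A" "a \<in> alg_carrier A" "b \<in> alg_carrier A"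
    and "(\<lambda>n. alg_dist A (u n) a) \<longlonglongrightarrow> 0" "(\<lambda>n. alg_dist A (u n) b) \<longlonglongrightarrow> 0"
  shows "a = b"
proof -
  have "(\<lambda>n. alg_dist A (u n) a + alg_dist A (u n) b) \<longlonglongrightarrow> 0"
    using tendsto_add[OF assms(4,5)] by simp
  moreover have "alg_dist A a b \<le> alg_dist A (u n) a + alg_dist A (u n) b" for n
    using dist_triangle[of a "u n" b] assms(1-3) by (simp add: dist_commute)
  ultimately have "alg_dist A a b \<le> 0" by (intro LIMSEQ_le_const) auto
  then show ?thesis using assms(2,3) dist_nonneg[of a b] dist_zero_iff[of a b] by simp
qed

lemma tendsto_alg_add:
  assumes "\<And>n. u n \<in> alg_carrier A" "a \<in> alg_carrier A" "\<And>n. v n \<in> alg_carrier A" "b \<in> alg_carrier A"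
    and "(\<lambda>n. alg_dist A (u n) a) \<longlonglongrightarrow> 0" "(\<lambda>n. alg_dist A (v n) b) \<longlonglongrightarrow> 0"
  shows "(\<lambda>n. alg_dist A (alg_add A (u n) (v n)) (alg_add A a b)) \<longlonglongrightarrow> 0"
proof (rule tendsto_sandwich[OF _ _ tendsto_const])
  show "(\<lambda>n. alg_dist A (u n) a + alg_dist A (v n) b) \<longlonglongrightarrow> 0"
    using tendsto_add[OF assms(5,6)] by simp
qed (use assms dist_add in \<open>auto simp: dist_nonneg closed\<close>)

lemma tendsto_alg_mult:
  assumes "\<And>n. u n \<in> alg_carrier A" "a \<in> alg_carrier A" "\<And>n. v n \<in> alg_carrier A" "b \<in> alg_carrier A"
    and "(\<lambda>n. alg_dist A (u n) a) \<longlonglongrightarrow> 0" "(\<lambda>n. alg_dist A (v n) b) \<longlonglongrightarrow> 0"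
  shows "(\<lambda>n. alg_dist A (alg_mult A (u n) (v n)) (alg_mult A a b)) \<longlonglongrightarrow> 0"
proof (rule tendsto_sandwich[OF _ _ tendsto_const])
  have "(\<lambda>n. (alg_norm A a + alg_dist A (u n) a) * alg_dist A (v n) b + alg_dist A (u n) a * alg_norm A b)
      \<longlonglongrightarrow> (alg_norm A a + 0) * 0 + 0 * alg_norm A b"
    by (intro tendsto_intros assms)
  then show "(\<lambda>n. (alg_norm A a + alg_dist A (u n) a) * alg_dist A (v n) b + alg_dist A (u n) a * alg_norm A b)
      \<longlonglongrightarrow> 0" by simp
qed (use assms dist_mult in \<open>auto simp: dist_nonneg closed\<close>)

lemma tendsto_alg_norm:
  assumes "\<And>n. u n \<in> alg_carrier A" "a \<in> alg_carrier A" "(\<lambda>n. alg_dist A (u n) a) \<longlonglongrightarrow> 0"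
  shows "(\<lambda>n. alg_norm A (u n)) \<longlonglongrightarrow> alg_norm A a"
proof -
  have "(\<lambda>n. alg_norm A (u n) - alg_norm A a) \<longlonglongrightarrow> 0"
    by (rule Lim_null_comparison[OF _ assms(3)]) (use assms(1,2) norm_le_dist in auto)
  then show ?thesis by (rule LIM_zero_cancel)
qed

lemma Cauchy_of_tendsto:
  assumes "\<And>n. u n \<in> alg_carrier A" "a \<in> alg_carrier A" "(\<lambda>n. alg_dist A (u n) a) \<longlonglongrightarrow> 0"
  shows "alg_Cauchy A u"
  unfolding alg_Cauchy_def
proof (intro conjI allI impI assms(1))
  fix e :: real assume "e > 0"
  then obtain N where N: "\<And>n. n \<ge> N \<Longrightarrow> alg_dist A (u n) a < e / 2"
    using LIMSEQ_D[OF assms(3), of "e/2"] assms dist_nonneg by auto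
  have "alg_dist A (u m) (u n) < e" if "m \<ge> N" "n \<ge> N" for m n
    using dist_triangle[of "u m" a "u n"] N[OF that(1)] N[OF that(2)] assms(1,2)
    by (simp add: dist_commute[of a])
  then show "\<exists>N. \<forall>m\<ge>N. \<forall>n\<ge>N. alg_dist A (u m) (u n) < e" by blast
qed

section \<open>Closures and generated subalgebras\<close>

lemma closure_seq:
  assumes "a \<in> alg_closure A S" "S \<subseteq> alg_carrier A"
  obtains u where "\<And>n. u n \<in> S" "(\<lambda>n. alg_dist A (u n) a) \<longlonglongrightarrow> 0"
proof -
  have "\<exists>s\<in>S. alg_dist A s a < inverse (real (Suc n))" for n
    using assms by (simp add: alg_closure_def)
  then obtain u where u: "\<And>n. u n \<in> S" "\<And>n. alg_dist A (u n) a < inverse (real (Suc n))" by metis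
  have "(\<lambda>n. alg_dist A (u n) a) \<longlonglongrightarrow> 0"
  proof (rule tendsto_sandwich[OF _ _ tendsto_const LIMSEQ_inverse_real_of_nat])
    show "\<forall>\<^sub>F n in sequentially. 0 \<le> alg_dist A (u n) a"
      using u(1) assms by (intro always_eventually allI dist_nonneg) (auto simp: alg_closure_def)
    show "\<forall>\<^sub>F n in sequentially. alg_dist A (u n) a \<le> inverse (real (Suc n))"
      using u(2) by (intro always_eventually allI less_imp_le)
  qed
  with u(1) show ?thesis by (rule that)
qed

lemma closureI:
  assumes "a \<in> alg_carrier A" "\<And>n. u n \<in> S" "(\<lambda>n. alg_dist A (u n) a) \<longlonglongrightarrow> 0" "S \<subseteq> alg_carrier A"
  shows "a \<in> alg_closure A S"
  unfolding alg_closure_def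
proof (intro CollectI conjI allI impI assms(1))
  fix e :: real assume "e > 0"
  then obtain n where "norm (alg_dist A (u n) a - 0) < e"
    using LIMSEQ_D[OF assms(3)] by blast
  then show "\<exists>s\<in>S. alg_dist A s a < e" using assms(2) by (intro bexI[of _ "u n"]) auto
qed

lemma closure_superset: "S \<subseteq> alg_carrier A \<Longrightarrow> S \<subseteq> alg_closure A S"
proof
  fix a assume "S \<subseteq> alg_carrier A" "a \<in> S"
  moreover from this have "alg_dist A a a = 0" using dist_zero_iff[of a a] by auto
  ultimately show "a \<in> alg_closure A S" unfolding alg_closure_def by force
qed

text \<open>The operations are continuous, so closure under them is inherited from approximating
  sequences; being closed is the usual \<open>e / 2\<close> argument.\<close>

lemma cstar_subalgebra_closure:
  assumes S: "star_subalgebra A S"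
  shows "cstar_subalgebra A (alg_closure A S)"
  unfolding cstar_subalgebra_def
proof (intro conjI ballI allI impI)
  have SA: "S \<subseteq> alg_carrier A" and ops: "alg_zero A \<in> S"
    "\<And>a b. a \<in> S \<Longrightarrow> b \<in> S \<Longrightarrow> alg_add A a b \<in> S" "\<And>a b. a \<in> S \<Longrightarrow> b \<in> S \<Longrightarrow> alg_mult A a b \<in> S"
    "\<And>a c. a \<in> S \<Longrightarrow> alg_scale A c a \<in> S" "\<And>a. a \<in> S \<Longrightarrow> alg_star A a \<in> S"
    using S by (auto simp: star_subalgebra_def)
  show cA: "alg_closure A S \<subseteq> alg_carrier A" by (auto simp: alg_closure_def)
  show "alg_zero A \<in> alg_closure A S" using closure_superset[OF SA] ops(1) by blast
  fix a assume a: "a \<in> alg_closure A S"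
  then have aA: "a \<in> alg_carrier A" using cA by blast
  obtain u where u: "\<And>n. u n \<in> S" "(\<lambda>n. alg_dist A (u n) a) \<longlonglongrightarrow> 0" using closure_seq[OF a SA] by blast
  have uA: "u n \<in> alg_carrier A" for n using u(1) SA by blast
  {
    fix b assume b: "b \<in> alg_closure A S"
    then have bA: "b \<in> alg_carrier A" using cA by blast
    obtain v where v: "\<And>n. v n \<in> S" "(\<lambda>n. alg_dist A (v n) b) \<longlonglongrightarrow> 0" using closure_seq[OF b SA] by blast
    have vA: "v n \<in> alg_carrier A" for n using v(1) SA by blast
    show "alg_add A a b \<in> alg_closure A S"
      by (rule closureI[where u = "\<lambda>n. alg_add A (u n) (v n)"])
         (use u v uA vA aA bA SA ops in \<open>auto intro!: tendsto_alg_add closed\<close>)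
    show "alg_mult A a b \<in> alg_closure A S"
      by (rule closureI[where u = "\<lambda>n. alg_mult A (u n) (v n)"])
         (use u v uA vA aA bA SA ops in \<open>auto intro!: tendsto_alg_mult closed\<close>)
  }
  show "alg_scale A c a \<in> alg_closure A S" for c
  proof (rule closureI[where u = "\<lambda>n. alg_scale A c (u n)"])
    show "(\<lambda>n. alg_dist A (alg_scale A c (u n)) (alg_scale A c a)) \<longlonglongrightarrow> 0"
      using tendsto_mult[OF tendsto_const[of "cmod c"] u(2)] by (simp add: dist_scale uA aA)
  qed (use u aA SA ops in \<open>auto intro: closed\<close>)
  show "alg_star A a \<in> alg_closure A S"
    by (rule closureI[where u = "\<lambda>n. alg_star A (u n)"])
       (use u uA aA SA ops in \<open>auto intro: closed simp: dist_star\<close>)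
next
  have SA: "S \<subseteq> alg_carrier A" using S by (auto simp: star_subalgebra_def)
  fix u a assume a: "a \<in> alg_carrier A" and u: "(\<forall>n. u n \<in> alg_closure A S) \<and> (\<lambda>n. alg_dist A (u n) a) \<longlonglongrightarrow> 0"
  have "\<exists>s\<in>S. alg_dist A s a < e" if "e > 0" for e
  proof -
    obtain n where n: "norm (alg_dist A (u n) a - 0) < e / 2"
      using LIMSEQ_D[of "\<lambda>n. alg_dist A (u n) a" 0 "e / 2"] u \<open>e > 0\<close> by auto
    obtain s where s: "s \<in> S" "alg_dist A s (u n) < e / 2"
      using u \<open>e > 0\<close> by (auto simp: alg_closure_def dest!: spec[of _ n] spec[of _ "e/2"])
    have "u n \<in> alg_carrier A" "s \<in> alg_carrier A" using u s SA by (auto simp: alg_closure_def)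
    then have "alg_dist A s a < e" using dist_triangle[of s "u n" a] a n s(2) by simp
    with s(1) show ?thesis by blast
  qed
  with a show "a \<in> alg_closure A S" by (simp add: alg_closure_def)
qed

lemma closure_subset:
  assumes "cstar_subalgebra A D" "S \<subseteq> D"
  shows "alg_closure A S \<subseteq> D"
proof
  fix a assume a: "a \<in> alg_closure A S"
  have SA: "S \<subseteq> alg_carrier A" using assms by (auto simp: cstar_subalgebra_def)
  obtain u where u: "\<And>n. u n \<in> S" "(\<lambda>n. alg_dist A (u n) a) \<longlonglongrightarrow> 0" using closure_seq[OF a SA] by blast
  have "a \<in> alg_carrier A" using a by (simp add: alg_closure_def)
  from cstar_subalgebra_limit[OF assms(1) _ this u(2)] show "a \<in> D" using u(1) assms(2) by blast
qed

lemma cstar_subalgebra_carrier: "cstar_subalgebra A (alg_carrier A)"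
  by (simp add: cstar_subalgebra_def closed)

lemma cstar_generated_subset: "S \<subseteq> alg_carrier A \<Longrightarrow> cstar_generated A S \<subseteq> alg_carrier A"
  unfolding cstar_generated_def using cstar_subalgebra_carrier by blast

lemma cstar_subalgebra_generated:
  assumes "S \<subseteq> alg_carrier A"
  shows "cstar_subalgebra A (cstar_generated A S)"
  unfolding cstar_subalgebra_def
proof (intro conjI ballI allI impI)
  show "cstar_generated A S \<subseteq> alg_carrier A" by (rule cstar_generated_subset[OF assms])
  fix u a assume a: "a \<in> alg_carrier A"
    and u: "(\<forall>n. u n \<in> cstar_generated A S) \<and> (\<lambda>n. alg_dist A (u n) a) \<longlonglongrightarrow> 0"
  show "a \<in> cstar_generated A S"
    unfolding cstar_generated_def
  proof (rule InterI)
    fix D assume D: "D \<in> {D. cstar_subalgebra A D \<and> S \<subseteq> D}"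
    then have "u n \<in> D" for n using u by (auto simp: cstar_generated_def)
    from cstar_subalgebra_limit[of A D u a, OF _ this a] D u show "a \<in> D" by simp
  qed
qed (auto simp: cstar_generated_def cstar_subalgebra_def)

lemma cstar_generated_superset: "S \<subseteq> cstar_generated A S"
  by (auto simp: cstar_generated_def)

lemma cstar_algebra_restrict:
  assumes "cstar_subalgebra A D"
  shows "cstar_algebra (alg_restrict A D)"
proof -
  have DA: "\<And>a. a \<in> D \<Longrightarrow> a \<in> alg_carrier A" using assms by (auto simp: cstar_subalgebra_def)
  show ?thesis
  proof (rule cstar_algebra.intro, goal_cases)
    case (29 u)
    then have u: "\<And>n. u n \<in> D" and "alg_Cauchy A u" using DA by (auto simp: alg_Cauchy_def)
    then obtain a where a: "a \<in> alg_carrier A" "(\<lambda>n. alg_dist A (u n) a) \<longlonglongrightarrow> 0" using complete by blast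
    from cstar_subalgebra_limit[OF assms u this] have "a \<in> D" .
    with a show ?case by auto
  next
    case 7 then show ?case by (simp add: add_commute DA)
  qed (use assms in \<open>simp_all add: DA cstar_subalgebra_def add_zero add_minus scale_one scale_scale
      scale_add_left scale_add_right mult_add_left mult_add_right mult_scale_left mult_scale_right
      star_add star_scale star_mult star_star norm_nonneg norm_eq_zero norm_triangle norm_scale norm_mult
      cstar_identity add_assoc mult_assoc\<close>)
qed

text \<open>The two notions test limits in different carriers, but a limit of elements of
  \<open>E\<close> lies in \<open>D\<close> anyway because \<open>D\<close> is closed.\<close>

lemma cstar_subalgebra_restrict_iff:
  assumes "cstar_subalgebra A D"
  shows "cstar_subalgebra (alg_restrict A D) E \<longleftrightarrow> E \<subseteq> D \<and> cstar_subalgebra A E"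
proof -
  have DA: "D \<subseteq> alg_carrier A" using assms by (auto simp: cstar_subalgebra_def)
  show ?thesis
  proof
    assume E: "cstar_subalgebra (alg_restrict A D) E"
    then have ED: "E \<subseteq> D" by (simp add: cstar_subalgebra_def)
    have "a \<in> E" if "a \<in> alg_carrier A" "\<And>n. u n \<in> E" "(\<lambda>n. alg_dist A (u n) a) \<longlonglongrightarrow> 0" for u a
    proof -
      have "u n \<in> D" for n using that(2) ED by blast
      from cstar_subalgebra_limit[OF assms this that(1,3)]
      show ?thesis using cstar_subalgebra_limit[OF E that(2), of a] that(3) by simp
    qed
    moreover have "star_subalgebra A E"
      using E ED DA by (auto simp: cstar_subalgebra_alt star_subalgebra_def)
    ultimately show "E \<subseteq> D \<and> cstar_subalgebra A E"
      using ED unfolding cstar_subalgebra_alt by blast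
  next
    assume E: "E \<subseteq> D \<and> cstar_subalgebra A E"
    then have "star_subalgebra (alg_restrict A D) E"
      by (simp add: cstar_subalgebra_alt star_subalgebra_def)
    moreover have "a \<in> E" if "a \<in> D" "\<And>n. u n \<in> E" "(\<lambda>n. alg_dist A (u n) a) \<longlonglongrightarrow> 0" for u a
      using that E DA by (intro cstar_subalgebra_limit[of A E u a]) auto
    ultimately show "cstar_subalgebra (alg_restrict A D) E" unfolding cstar_subalgebra_alt alg_restrict_simps by blast
  qed
qed

end


section \<open>Isomorphisms of C*-algebras\<close>

text \<open>Only \<open>B\<close> is assumed to be a C*-algebra; the axioms for \<open>A\<close> are
  pulled back along \<open>J\<close>. This suits completions, whose operations go through chosen
  representatives and whose laws would be tedious to check directly.\<close>

locale star_iso = B: cstar_algebra B for B :: "'f star_alg" +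
  fixes A :: "'e star_alg" and J :: "'e \<Rightarrow> 'f"
  assumes bij: "bij_betw J (alg_carrier A) (alg_carrier B)"
    and zero_in: "alg_zero A \<in> alg_carrier A"
    and add_in: "\<lbrakk>a \<in> alg_carrier A; b \<in> alg_carrier A\<rbrakk> \<Longrightarrow> alg_add A a b \<in> alg_carrier A"
    and scale_in: "a \<in> alg_carrier A \<Longrightarrow> alg_scale A c a \<in> alg_carrier A"
    and mult_in: "\<lbrakk>a \<in> alg_carrier A; b \<in> alg_carrier A\<rbrakk> \<Longrightarrow> alg_mult A a b \<in> alg_carrier A"
    and star_in: "a \<in> alg_carrier A \<Longrightarrow> alg_star A a \<in> alg_carrier A"
    and J_zero: "J (alg_zero A) = alg_zero B"
    and J_add: "\<lbrakk>a \<in> alg_carrier A; b \<in> alg_carrier A\<rbrakk> \<Longrightarrow> J (alg_add A a b) = alg_add B (J a) (J b)"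
    and J_scale: "a \<in> alg_carrier A \<Longrightarrow> J (alg_scale A c a) = alg_scale B c (J a)"
    and J_mult: "\<lbrakk>a \<in> alg_carrier A; b \<in> alg_carrier A\<rbrakk> \<Longrightarrow> J (alg_mult A a b) = alg_mult B (J a) (J b)"
    and J_star: "a \<in> alg_carrier A \<Longrightarrow> J (alg_star A a) = alg_star B (J a)"
    and J_norm: "a \<in> alg_carrier A \<Longrightarrow> alg_norm B (J a) = alg_norm A a"
begin

lemmas ops_in = zero_in add_in scale_in mult_in star_in
lemmas J_ops = J_zero J_add J_scale J_mult J_star

lemma J_in: "a \<in> alg_carrier A \<Longrightarrow> J a \<in> alg_carrier B"
  using bij by (auto simp: bij_betw_def)

lemma J_inject: "a \<in> alg_carrier A \<Longrightarrow> b \<in> alg_carrier A \<Longrightarrow> J a = J b \<longleftrightarrow> a = b"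
  using bij by (auto simp: bij_betw_def inj_on_def)

lemma J_dist: "a \<in> alg_carrier A \<Longrightarrow> b \<in> alg_carrier A \<Longrightarrow> alg_dist B (J a) (J b) = alg_dist A a b"
  by (simp add: alg_dist_def J_norm[symmetric] J_ops ops_in)

lemma J_surj: "b \<in> alg_carrier B \<Longrightarrow> \<exists>a\<in>alg_carrier A. J a = b"
  using bij by (metis bij_betw_imp_surj_on imageE)

lemma cstar_algebra_A: "cstar_algebra A"
proof (rule cstar_algebra.intro, goal_cases)
  case (29 u)
  then have "alg_Cauchy B (\<lambda>n. J (u n))" by (simp add: alg_Cauchy_def J_in J_dist)
  from B.complete[OF this] obtain a where "a \<in> alg_carrier A" "(\<lambda>n. alg_dist B (J (u n)) (J a)) \<longlonglongrightarrow> 0"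
    using J_surj by blast
  with 29 show ?case by (auto simp: alg_Cauchy_def J_dist)
next
  case 7 then show ?case by (subst J_inject[symmetric]) (simp_all add: J_ops J_in ops_in B.add_commute)
next
  case 27 then show ?case by (simp add: J_norm[symmetric] ops_in J_ops J_in B.norm_mult)
next
  case 24 then show ?case
    by (simp add: J_norm[symmetric] J_inject[symmetric] ops_in J_ops J_in B.norm_eq_zero)
qed (simp_all add: ops_in J_in J_inject[symmetric] J_ops J_norm[symmetric] B.add_assoc B.mult_assoc B.add_zero B.add_minus
   B.scale_one B.scale_scale B.scale_add_left B.scale_add_right B.mult_add_left B.mult_add_right
   B.mult_scale_left B.mult_scale_right B.star_add B.star_scale B.star_mult B.star_star B.norm_nonneg
   B.norm_eq_zero B.norm_triangle B.norm_scale B.norm_mult B.cstar_identity)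

text \<open>With the inverse available, each transfer along \<open>J\<close> has to be proved in one
  direction only.\<close>

lemma inv_iso: "star_iso A B (inv_into (alg_carrier A) J)"
proof -
  interpret A: cstar_algebra A by (rule cstar_algebra_A)
  let ?K = "inv_into (alg_carrier A) J"
  have K: "?K b \<in> alg_carrier A" "J (?K b) = b" if "b \<in> alg_carrier B" for b
    using that bij by (auto simp: bij_betw_def inv_into_into f_inv_into_f)
  have KI: "?K b = a" if "a \<in> alg_carrier A" "J a = b" for a b
    using that bij by (auto simp: bij_betw_def)
  show ?thesis
    by (unfold_locales; (rule bij_betw_inv_into[OF bij] | rule KI)?)
       (simp_all add: K J_ops ops_in B.closed J_norm[symmetric])
qed

lemma image_cstar_subalgebra:
  assumes E: "cstar_subalgebra A E"
  shows "cstar_subalgebra B (J ` E)"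
proof -
  have EA: "\<And>a. a \<in> E \<Longrightarrow> a \<in> alg_carrier A" using E by (auto simp: cstar_subalgebra_def)
  have ops: "alg_zero A \<in> E" "\<And>a b. a \<in> E \<Longrightarrow> b \<in> E \<Longrightarrow> alg_add A a b \<in> E"
    "\<And>a b. a \<in> E \<Longrightarrow> b \<in> E \<Longrightarrow> alg_mult A a b \<in> E" "\<And>a c. a \<in> E \<Longrightarrow> alg_scale A c a \<in> E"
    "\<And>a. a \<in> E \<Longrightarrow> alg_star A a \<in> E"
    using E by (auto simp: cstar_subalgebra_def)
  have "b \<in> J ` E" if b: "b \<in> alg_carrier B" and u: "\<And>n. u n \<in> J ` E" "(\<lambda>n. alg_dist B (u n) b) \<longlonglongrightarrow> 0" for u b
  proof -
    have "\<forall>n. \<exists>e. e \<in> E \<and> u n = J e" using u(1) by auto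
    then obtain v where v: "\<And>n. v n \<in> E" "\<And>n. u n = J (v n)" by metis
    obtain a where a: "a \<in> alg_carrier A" "J a = b" using J_surj[OF b] by blast
    have "(\<lambda>n. alg_dist A (v n) a) \<longlonglongrightarrow> 0" using u(2) by (simp add: v a(1) EA J_dist flip: a(2))
    from cstar_subalgebra_limit[OF E v(1) a(1) this] have "a \<in> E" .
    then show ?thesis using a(2) by blast
  qed
  moreover have "star_subalgebra B (J ` E)"
    unfolding star_subalgebra_def
    by (auto simp: J_in EA J_zero[symmetric] J_add[symmetric] J_mult[symmetric] J_scale[symmetric]
        J_star[symmetric] ops)
  ultimately show ?thesis unfolding cstar_subalgebra_alt by blast
qed

lemma inv_image_image: "D \<subseteq> alg_carrier A \<Longrightarrow> inv_into (alg_carrier A) J ` J ` D = D"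
  using bij by (simp add: bij_betw_def inv_into_image_cancel)

lemma cstar_subalgebra_image_iff:
  assumes "D \<subseteq> alg_carrier A"
  shows "cstar_subalgebra B (J ` D) \<longleftrightarrow> cstar_subalgebra A D"
  using image_cstar_subalgebra star_iso.image_cstar_subalgebra[OF inv_iso, of "J ` D"]
  by (auto simp: inv_image_image[OF assms])

lemma image_inject: "D \<subseteq> alg_carrier A \<Longrightarrow> E \<subseteq> alg_carrier A \<Longrightarrow> J ` D = J ` E \<longleftrightarrow> D = E"
  by (metis inv_image_image)

lemma image_vimage:
  assumes "E \<subseteq> alg_carrier B"
  obtains D where "D \<subseteq> alg_carrier A" "J ` D = E"
  using assms bij by (metis bij_betw_imp_surj_on subset_imageE)

text \<open>The bijection matches the C*-subalgebras of \<open>A\<close> with those of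
  \<open>B\<close>, and so the intersections of those containing the generators.\<close>

lemma image_generated:
  assumes S: "S \<subseteq> alg_carrier A"
  shows "J ` cstar_generated A S = cstar_generated B (J ` S)"
proof
  interpret A: cstar_algebra A by (rule cstar_algebra_A)
  have "cstar_subalgebra B (J ` cstar_generated A S)"
    by (intro image_cstar_subalgebra A.cstar_subalgebra_generated S)
  then show "cstar_generated B (J ` S) \<subseteq> J ` cstar_generated A S"
    unfolding cstar_generated_def[of B] using A.cstar_generated_superset[of S] by blast
  show "J ` cstar_generated A S \<subseteq> cstar_generated B (J ` S)"
    unfolding cstar_generated_def[of B]
  proof (rule Inter_greatest)
    fix E assume "E \<in> {D. cstar_subalgebra B D \<and> J ` S \<subseteq> D}"
    then have E: "cstar_subalgebra B E" "J ` S \<subseteq> E" by auto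
    then have "E \<subseteq> alg_carrier B" by (simp add: cstar_subalgebra_def)
    then obtain D where D: "D \<subseteq> alg_carrier A" "J ` D = E" by (rule image_vimage)
    have "S \<subseteq> D" using E(2) D S by (force simp: J_inject image_iff subset_iff)
    moreover have "cstar_subalgebra A D" using E(1) D cstar_subalgebra_image_iff by blast
    ultimately show "J ` cstar_generated A S \<subseteq> E"
      unfolding D(2)[symmetric] cstar_generated_def by (intro image_mono) blast
  qed
qed

lemma restrict_iso:
  assumes E: "cstar_subalgebra A E"
  shows "star_iso (alg_restrict B (J ` E)) (alg_restrict A E) J"
proof -
  have EA: "\<And>a. a \<in> E \<Longrightarrow> a \<in> alg_carrier A" using E by (auto simp: cstar_subalgebra_def)
  interpret R: cstar_algebra "alg_restrict B (J ` E)"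
    by (intro B.cstar_algebra_restrict image_cstar_subalgebra E)
  show ?thesis
    by unfold_locales
       (use E bij in \<open>auto simp: EA J_ops J_norm cstar_subalgebra_def bij_betw_def
         intro: inj_on_subset\<close>)
qed

lemma positive_iff:
  assumes "a \<in> alg_carrier A"
  shows "alg_positive B (J a) \<longleftrightarrow> alg_positive A a"
proof
  assume "alg_positive B (J a)"
  then obtain b where "b \<in> alg_carrier A" "J a = alg_mult B (alg_star B (J b)) (J b)"
    unfolding alg_positive_def using J_surj by blast
  then have "a = alg_mult A (alg_star A b) b" using assms by (simp add: J_inject[symmetric] J_ops ops_in)
  then show "alg_positive A a" using \<open>b \<in> _\<close> by (auto simp: alg_positive_def)
next
  assume "alg_positive A a"
  then show "alg_positive B (J a)" by (auto simp: alg_positive_def J_ops ops_in J_in)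
qed

lemma image_normalizers:
  assumes D: "D \<subseteq> alg_carrier A"
  shows "J ` normalizers A D = normalizers B (J ` D)"
proof -
  have DA: "\<And>a. a \<in> D \<Longrightarrow> a \<in> alg_carrier A" using D by blast
  have mem: "J x \<in> J ` D \<longleftrightarrow> x \<in> D" if "x \<in> alg_carrier A" for x
    using that DA by (auto simp: J_inject)
  have "J a \<in> normalizers B (J ` D) \<longleftrightarrow> a \<in> normalizers A D" if "a \<in> alg_carrier A" for a
    using that by (simp add: normalizers_def J_in DA J_mult[symmetric] J_star[symmetric] ops_in mem)
  moreover have "normalizers A D \<subseteq> alg_carrier A" "normalizers B (J ` D) \<subseteq> alg_carrier B"
    by (auto simp: normalizers_def)
  ultimately show ?thesis using J_surj by (auto simp: subset_iff image_iff) metis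
qed

text \<open>Every clause of the notion is expressed by the operations, the norm and subsets of the
  carrier, all of which \<open>J\<close> preserves in both directions.\<close>

lemma cartan_transfer:
  assumes D: "D \<subseteq> alg_carrier A" and cartan: "cartan_subalgebra B (J ` D)"
  shows "cartan_subalgebra A D"
proof -
  interpret A: cstar_algebra A by (rule cstar_algebra_A)
  let ?K = "inv_into (alg_carrier A) J"
  have K: "?K b \<in> alg_carrier A" "J (?K b) = b" if "b \<in> alg_carrier B" for b
    using that bij by (auto simp: bij_betw_def inv_into_into f_inv_into_f)
  have DA: "\<And>a. a \<in> D \<Longrightarrow> a \<in> alg_carrier A" using D by blast
  have mem: "J x \<in> J ` D \<longleftrightarrow> x \<in> D" if "x \<in> alg_carrier A" for x
    using that DA by (auto simp: J_inject)
  have abel: "alg_abelian B (J ` E) \<longleftrightarrow> alg_abelian A E" if "E \<subseteq> alg_carrier A" for E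
  proof -
    have EA: "\<And>a. a \<in> E \<Longrightarrow> a \<in> alg_carrier A" using that by blast
    show ?thesis by (simp add: alg_abelian_def EA J_mult[symmetric] J_inject ops_in)
  qed
  have sub: "cstar_subalgebra A D" using cartan D cstar_subalgebra_image_iff by (simp add: cartan_subalgebra_def)
  have ab: "alg_abelian A D" using cartan D abel by (simp add: cartan_subalgebra_def)
  have unit: "contains_approximate_unit A D"
  proof -
    obtain F where F: "F \<noteq> bot"
      "eventually (\<lambda>e. e \<in> J ` D \<and> alg_positive B e \<and> alg_norm B e \<le> 1) F"
      "\<And>a. a \<in> alg_carrier B \<Longrightarrow> ((\<lambda>e. alg_dist B (alg_mult B e a) a) \<longlongrightarrow> 0) F"
      "\<And>a. a \<in> alg_carrier B \<Longrightarrow> ((\<lambda>e. alg_dist B (alg_mult B a e) a) \<longlongrightarrow> 0) F"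
      using cartan unfolding cartan_subalgebra_def contains_approximate_unit_def by blast
    have KJ: "?K (J a) = a" if "a \<in> alg_carrier A" for a using that bij by (simp add: bij_betw_def)
    have ev: "eventually (\<lambda>e. e \<in> J ` D) F" using F(2) by (rule eventually_mono) simp
    show ?thesis
      unfolding contains_approximate_unit_def
    \<comment> \<open>A filter on \<open>B\<close> that is eventually in the image of
      \<open>D\<close> is pushed to \<open>A\<close> by the inverse of \<open>J\<close>; the values
      of the inverse off the carrier are irrelevant eventually.\<close>
    proof (intro exI[of _ "filtermap ?K F"] conjI ballI)
      show "filtermap ?K F \<noteq> bot" using F(1) by (simp add: filtermap_bot_iff)
      show "\<forall>\<^sub>F e in filtermap ?K F. e \<in> D \<and> alg_positive A e \<and> alg_norm A e \<le> 1"
        unfolding eventually_filtermap using F(2)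
        by (rule eventually_mono) (auto simp: DA KJ positive_iff J_norm)
      fix a assume a: "a \<in> alg_carrier A"
      have 1: "\<forall>\<^sub>F e in F. alg_dist A (alg_mult A (?K e) a) a = alg_dist B (alg_mult B e (J a)) (J a)"
        using ev by (rule eventually_mono) (use a in \<open>auto simp: DA KJ J_mult[symmetric] J_dist ops_in\<close>)
      have 2: "\<forall>\<^sub>F e in F. alg_dist A (alg_mult A a (?K e)) a = alg_dist B (alg_mult B (J a) e) (J a)"
        using ev by (rule eventually_mono) (use a in \<open>auto simp: DA KJ J_mult[symmetric] J_dist ops_in\<close>)
      show "((\<lambda>e. alg_dist A (alg_mult A e a) a) \<longlongrightarrow> 0) (filtermap ?K F)"
        unfolding filterlim_def filtermap_filtermap
        using F(3)[OF J_in[OF a]] tendsto_cong[OF 1] by (simp add: filterlim_def)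
      show "((\<lambda>e. alg_dist A (alg_mult A a e) a) \<longlongrightarrow> 0) (filtermap ?K F)"
        unfolding filterlim_def filtermap_filtermap
        using F(4)[OF J_in[OF a]] tendsto_cong[OF 2] by (simp add: filterlim_def)
    qed
  qed
  have max: "maximal_abelian A D"
    unfolding maximal_abelian_def
  proof (intro conjI allI impI sub ab)
    fix E assume E: "cstar_subalgebra A E \<and> alg_abelian A E \<and> D \<subseteq> E"
    then have EA: "E \<subseteq> alg_carrier A" by (auto simp: cstar_subalgebra_def)
    have "cstar_subalgebra B (J ` E)" "alg_abelian B (J ` E)" "J ` D \<subseteq> J ` E"
      using E EA by (auto simp: image_cstar_subalgebra abel)
    then have "J ` E = J ` D" using cartan unfolding cartan_subalgebra_def maximal_abelian_def by blast
    then show "E = D" using image_inject EA D by blast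
  qed
  have gen: "cstar_generated A (normalizers A D) = alg_carrier A"
  proof -
    have N: "normalizers A D \<subseteq> alg_carrier A" by (auto simp: normalizers_def)
    have "J ` cstar_generated A (normalizers A D) = J ` alg_carrier A"
      using cartan bij by (simp add: image_generated[OF N] image_normalizers[OF D] cartan_subalgebra_def bij_betw_def)
    then show ?thesis using image_inject[OF A.cstar_generated_subset[OF N] order_refl] by blast
  qed
  obtain P where P: "conditional_expectation B (J ` D) P" "faithful_map B P"
    using cartan unfolding cartan_subalgebra_def by blast
  have PD: "P b \<in> J ` D" if "b \<in> alg_carrier B" for b
    using P(1) that by (simp add: conditional_expectation_def)
  have PB: "P b \<in> alg_carrier B" if "b \<in> alg_carrier B" for b
    using PD[OF that] DA J_in by auto
  \<comment> \<open>The expectation is conjugated by \<open>J\<close>.\<close>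
  define Q where "Q a = ?K (P (J a))" for a
  have Q: "Q a \<in> alg_carrier A" "J (Q a) = P (J a)" if "a \<in> alg_carrier A" for a
    using K[OF PB[OF J_in[OF that]]] by (simp_all add: Q_def)
  have "conditional_expectation A D Q"
    unfolding conditional_expectation_def
  proof (intro conjI ballI allI impI)
    fix a assume a: "a \<in> alg_carrier A"
    show "Q a \<in> D" using PD[OF J_in[OF a]] mem[OF Q(1)[OF a]] Q(2)[OF a] by simp
    show "Q (alg_add A a b) = alg_add A (Q a) (Q b)" if "b \<in> alg_carrier A" for b
      using a that P(1) by (simp add: J_inject[symmetric] Q ops_in J_ops J_in conditional_expectation_def)
    show "Q (alg_scale A c a) = alg_scale A c (Q a)" for c
      using a P(1) by (simp add: J_inject[symmetric] Q ops_in J_ops J_in conditional_expectation_def)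
    show "alg_norm A (Q a) \<le> alg_norm A a"
      using a P(1) by (simp add: J_norm[symmetric] Q J_in conditional_expectation_def)
    show "alg_positive A (Q a)" if "alg_positive A a"
      using a P(1) that by (simp add: positive_iff[symmetric] Q J_in conditional_expectation_def)
    fix d d' assume "d \<in> D" "d' \<in> D"
    then show "Q (alg_mult A (alg_mult A d a) d') = alg_mult A (alg_mult A d (Q a)) d'"
      using a P(1) by (simp add: J_inject[symmetric] Q ops_in J_ops J_in conditional_expectation_def DA)
  next
    fix d assume "d \<in> D"
    then show "Q d = d" using P(1) by (simp add: J_inject[symmetric] Q DA conditional_expectation_def)
  qed
  moreover have "faithful_map A Q"
    unfolding faithful_map_def
  proof (intro ballI impI)
    fix a assume a: "a \<in> alg_carrier A" "Q (alg_mult A (alg_star A a) a) = alg_zero A"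
    then have "P (alg_mult B (alg_star B (J a)) (J a)) = alg_zero B"
      by (metis Q(2) J_mult J_star J_zero mult_in star_in)
    then have "J a = alg_zero B" using P(2) J_in[OF a(1)] by (simp add: faithful_map_def)
    then show "a = alg_zero A" using a(1) J_inject zero_in J_zero by metis
  qed
  ultimately show ?thesis
    unfolding cartan_subalgebra_def using cstar_algebra_A sub ab unit max gen by blast
qed

end


section \<open>Completions embedded into a C*-algebra\<close>

text \<open>A normed *-algebra is studied through an isometric copy inside a C*-algebra, so that its
  completion becomes the closure of the copy.\<close>

locale isometric_hom = B: cstar_algebra B for B :: "'f star_alg" +
  fixes A :: "'e star_alg" and h :: "'e \<Rightarrow> 'f"
  assumes h_in: "a \<in> alg_carrier A \<Longrightarrow> h a \<in> alg_carrier B"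
    and zero_in: "alg_zero A \<in> alg_carrier A"
    and add_in: "\<lbrakk>a \<in> alg_carrier A; b \<in> alg_carrier A\<rbrakk> \<Longrightarrow> alg_add A a b \<in> alg_carrier A"
    and scale_in: "a \<in> alg_carrier A \<Longrightarrow> alg_scale A c a \<in> alg_carrier A"
    and mult_in: "\<lbrakk>a \<in> alg_carrier A; b \<in> alg_carrier A\<rbrakk> \<Longrightarrow> alg_mult A a b \<in> alg_carrier A"
    and star_in: "a \<in> alg_carrier A \<Longrightarrow> alg_star A a \<in> alg_carrier A"
    and h_zero: "h (alg_zero A) = alg_zero B"
    and h_add: "\<lbrakk>a \<in> alg_carrier A; b \<in> alg_carrier A\<rbrakk> \<Longrightarrow> h (alg_add A a b) = alg_add B (h a) (h b)"
    and h_scale: "a \<in> alg_carrier A \<Longrightarrow> h (alg_scale A c a) = alg_scale B c (h a)"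
    and h_mult: "\<lbrakk>a \<in> alg_carrier A; b \<in> alg_carrier A\<rbrakk> \<Longrightarrow> h (alg_mult A a b) = alg_mult B (h a) (h b)"
    and h_star: "a \<in> alg_carrier A \<Longrightarrow> h (alg_star A a) = alg_star B (h a)"
    and h_norm: "a \<in> alg_carrier A \<Longrightarrow> alg_norm B (h a) = alg_norm A a"
begin

lemmas ops_in = zero_in add_in scale_in mult_in star_in
lemmas h_ops = h_zero h_add h_scale h_mult h_star

lemma h_dist: "a \<in> alg_carrier A \<Longrightarrow> b \<in> alg_carrier A \<Longrightarrow> alg_dist B (h a) (h b) = alg_dist A a b"
  by (simp add: alg_dist_def h_norm[symmetric] h_ops ops_in)

definition extension_lim :: "(nat \<Rightarrow> 'e) \<Rightarrow> 'f" where
  "extension_lim u = (THE b. b \<in> alg_carrier B \<and> (\<lambda>n. alg_dist B (h (u n)) b) \<longlonglongrightarrow> 0)"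

definition extension :: "(nat \<Rightarrow> 'e) set \<Rightarrow> 'f" where
  "extension a = extension_lim (crep a)"

lemma Cauchy_in: "alg_Cauchy A u \<Longrightarrow> u n \<in> alg_carrier A"
  by (simp add: alg_Cauchy_def)

lemma Cauchy_h: "alg_Cauchy A u \<Longrightarrow> alg_Cauchy B (\<lambda>n. h (u n))"
  by (simp add: alg_Cauchy_def h_dist h_in)

lemma extension_lim_eqI:
  assumes "alg_Cauchy A u" "b \<in> alg_carrier B" "(\<lambda>n. alg_dist B (h (u n)) b) \<longlonglongrightarrow> 0"
  shows "extension_lim u = b"
  unfolding extension_lim_def
proof (rule the_equality)
  fix c assume "c \<in> alg_carrier B \<and> (\<lambda>n. alg_dist B (h (u n)) c) \<longlonglongrightarrow> 0"
  then show "c = b"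
    using assms by (intro B.tendsto_unique[of "\<lambda>n. h (u n)"]) (auto simp: h_in Cauchy_in)
qed (use assms in simp)

lemma
  assumes "alg_Cauchy A u"
  shows extension_lim_in: "extension_lim u \<in> alg_carrier B"
    and extension_lim: "(\<lambda>n. alg_dist B (h (u n)) (extension_lim u)) \<longlonglongrightarrow> 0"
proof -
  obtain b where b: "b \<in> alg_carrier B" "(\<lambda>n. alg_dist B (h (u n)) b) \<longlonglongrightarrow> 0"
    using B.complete[OF Cauchy_h[OF assms]] by blast
  then have "extension_lim u = b" by (rule extension_lim_eqI[OF assms])
  with b show "extension_lim u \<in> alg_carrier B"
    "(\<lambda>n. alg_dist B (h (u n)) (extension_lim u)) \<longlonglongrightarrow> 0" by simp_all
qed

lemma Cauchy_if_tendsto: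
  assumes "\<And>n. u n \<in> alg_carrier A" "b \<in> alg_carrier B" "(\<lambda>n. alg_dist B (h (u n)) b) \<longlonglongrightarrow> 0"
  shows "alg_Cauchy A u"
  using B.Cauchy_of_tendsto[of "\<lambda>n. h (u n)" b] assms by (simp add: alg_Cauchy_def h_dist h_in)

text \<open>In \<open>B\<close> every Cauchy sequence has a limit, and two sequences approach each
  other exactly when their limits agree. In this form the relation is visibly an equivalence, namely
  the kernel of a map.\<close>

lemma completion_rel_iff:
  "(u, v) \<in> completion_rel A \<longleftrightarrow> alg_Cauchy A u \<and> alg_Cauchy A v \<and> extension_lim u = extension_lim v"
proof -
  have "(\<lambda>n. alg_dist A (u n) (v n)) \<longlonglongrightarrow> 0 \<longleftrightarrow> extension_lim u = extension_lim v"
    if u: "alg_Cauchy A u" and v: "alg_Cauchy A v"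
  proof -
    note U = extension_lim[OF u] extension_lim_in[OF u]
    note V = extension_lim[OF v] extension_lim_in[OF v]
    have uB: "h (u n) \<in> alg_carrier B" and vB: "h (v n) \<in> alg_carrier B" for n
      using u v by (simp_all add: h_in Cauchy_in)
    show ?thesis
    proof
      assume lim: "(\<lambda>n. alg_dist A (u n) (v n)) \<longlonglongrightarrow> 0"
      have "(\<lambda>n. alg_dist B (h (u n)) (extension_lim v)) \<longlonglongrightarrow> 0"
      proof (rule tendsto_sandwich[OF _ _ tendsto_const])
        show "(\<lambda>n. alg_dist A (u n) (v n) + alg_dist B (h (v n)) (extension_lim v)) \<longlonglongrightarrow> 0"
          using tendsto_add[OF lim V(1)] by simp
        show "\<forall>\<^sub>F n in sequentially. 0 \<le> alg_dist B (h (u n)) (extension_lim v)"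
          using uB V by (intro always_eventually allI B.dist_nonneg)
        show "\<forall>\<^sub>F n in sequentially. alg_dist B (h (u n)) (extension_lim v)
            \<le> alg_dist A (u n) (v n) + alg_dist B (h (v n)) (extension_lim v)"
        proof (intro always_eventually allI)
          show "alg_dist B (h (u n)) (extension_lim v)
            \<le> alg_dist A (u n) (v n) + alg_dist B (h (v n)) (extension_lim v)" for n
            using B.dist_triangle[OF uB vB V(2)] u v by (simp add: h_dist Cauchy_in)
        qed
      qed
      then show "extension_lim u = extension_lim v" by (rule extension_lim_eqI[OF u V(2)])
    next
      assume eq: "extension_lim u = extension_lim v"
      show "(\<lambda>n. alg_dist A (u n) (v n)) \<longlonglongrightarrow> 0"
      proof (rule tendsto_sandwich[OF _ _ tendsto_const])
        show "(\<lambda>n. alg_dist B (h (u n)) (extension_lim u) + alg_dist B (h (v n)) (extension_lim v)) \<longlonglongrightarrow> 0"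
          using tendsto_add[OF U(1) V(1)] by simp
        show "\<forall>\<^sub>F n in sequentially. 0 \<le> alg_dist A (u n) (v n)"
          using u v uB vB by (intro always_eventually allI) (simp add: h_dist[symmetric] Cauchy_in B.dist_nonneg)
        show "\<forall>\<^sub>F n in sequentially. alg_dist A (u n) (v n)
            \<le> alg_dist B (h (u n)) (extension_lim u) + alg_dist B (h (v n)) (extension_lim v)"
        proof (intro always_eventually allI)
          show "alg_dist A (u n) (v n)
            \<le> alg_dist B (h (u n)) (extension_lim u) + alg_dist B (h (v n)) (extension_lim v)" for n
            using B.dist_triangle[OF uB V(2) vB, of n n] u v vB V(2)
            by (simp add: h_dist Cauchy_in eq B.dist_commute)
        qed
      qed
    qed
  qed
  then show ?thesis by (auto simp: completion_rel_def)
qed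

lemma cclass_eq:
  "alg_Cauchy A u \<Longrightarrow> cclass A u = {v. alg_Cauchy A v \<and> extension_lim v = extension_lim u}"
  by (auto simp: cclass_def completion_rel_iff)

lemma completion_carrier: "alg_carrier (completion A) = cclass A ` {u. alg_Cauchy A u}"
  by (auto simp: completion_def quotient_def cclass_def)

text \<open>The representative is an arbitrary choice; all that is known of it, and all that is
  used, is its limit.\<close>

lemma crep_cclass:
  assumes "alg_Cauchy A u"
  shows "alg_Cauchy A (crep (cclass A u))" "extension_lim (crep (cclass A u)) = extension_lim u"
proof -
  have "u \<in> cclass A u" using assms by (simp add: cclass_eq)
  then have "crep (cclass A u) \<in> cclass A u" unfolding crep_def by (rule someI[where P = "\<lambda>v. v \<in> cclass A u"])
  then show "alg_Cauchy A (crep (cclass A u))" "extension_lim (crep (cclass A u)) = extension_lim u"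
    using assms by (simp_all add: cclass_eq)
qed

lemma extension_cclass: "alg_Cauchy A u \<Longrightarrow> extension (cclass A u) = extension_lim u"
  by (simp add: extension_def crep_cclass)

lemma crep_Cauchy: "a \<in> alg_carrier (completion A) \<Longrightarrow> alg_Cauchy A (crep a)"
  by (auto simp: completion_carrier crep_cclass)

lemma extension_in: "a \<in> alg_carrier (completion A) \<Longrightarrow> extension a \<in> alg_carrier B"
  by (simp add: extension_def extension_lim_in crep_Cauchy)

lemma extension_tendsto:
  "a \<in> alg_carrier (completion A) \<Longrightarrow> (\<lambda>n. alg_dist B (h (crep a n)) (extension a)) \<longlonglongrightarrow> 0"
  by (simp add: extension_def extension_lim crep_Cauchy)

text \<open>Operations of the completion are classes of termwise sequences, so identifying the limit
  of such a sequence in \<open>B\<close> shows at once that the result is in the carrier and what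
  its image is.\<close>

lemma cclass_extensionI:
  assumes "\<And>n. u n \<in> alg_carrier A" "b \<in> alg_carrier B" "(\<lambda>n. alg_dist B (h (u n)) b) \<longlonglongrightarrow> 0"
  shows "cclass A u \<in> alg_carrier (completion A) \<and> extension (cclass A u) = b"
proof -
  have u: "alg_Cauchy A u" by (rule Cauchy_if_tendsto[OF assms])
  then show ?thesis
    using extension_lim_eqI[OF u assms(2,3)] by (auto simp: completion_carrier extension_cclass)
qed

lemma const_tendsto: "a \<in> alg_carrier A \<Longrightarrow> (\<lambda>n::nat. alg_dist B (h a) (h a)) \<longlonglongrightarrow> 0"
  using B.dist_zero_iff[of "h a" "h a"] by (simp add: h_in)

lemma extension_embed:
  assumes "a \<in> alg_carrier A"
  shows "completion_embed A a \<in> alg_carrier (completion A)" "extension (completion_embed A a) = h a"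
  using cclass_extensionI[of "\<lambda>_. a" "h a"] const_tendsto assms by (simp_all add: completion_embed_def h_in)

lemma extension_bij:
  "bij_betw extension (alg_carrier (completion A)) (alg_closure B (h ` alg_carrier A))"
  unfolding bij_betw_def
proof
  show "inj_on extension (alg_carrier (completion A))"
  proof (rule inj_onI)
    fix a b assume "a \<in> alg_carrier (completion A)" "b \<in> alg_carrier (completion A)"
      and eq: "extension a = extension b"
    then obtain u v where "alg_Cauchy A u" "a = cclass A u" "alg_Cauchy A v" "b = cclass A v"
      by (auto simp: completion_carrier)
    moreover from this eq have "extension_lim u = extension_lim v" by (simp add: extension_cclass)
    ultimately show "a = b" by (simp add: cclass_eq)
  qed
  have sub: "h ` alg_carrier A \<subseteq> alg_carrier B" by (auto simp: h_in)
  show "extension ` alg_carrier (completion A) = alg_closure B (h ` alg_carrier A)"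
  proof (intro subset_antisym subsetI)
    fix b assume "b \<in> extension ` alg_carrier (completion A)"
    then obtain a where a: "a \<in> alg_carrier (completion A)" "b = extension a" by blast
    show "b \<in> alg_closure B (h ` alg_carrier A)"
      by (rule B.closureI[where u = "\<lambda>n. h (crep a n)"])
         (use a sub in \<open>auto simp: extension_in Cauchy_in crep_Cauchy extension_tendsto\<close>)
  next
    fix b assume b: "b \<in> alg_closure B (h ` alg_carrier A)"
    obtain v where v: "\<And>n. v n \<in> h ` alg_carrier A" "(\<lambda>n. alg_dist B (v n) b) \<longlonglongrightarrow> 0"
      using B.closure_seq[OF b sub] by blast
    have "\<forall>n. \<exists>a. a \<in> alg_carrier A \<and> v n = h a" using v(1) by auto
    then obtain u where u: "\<And>n. u n \<in> alg_carrier A" "\<And>n. v n = h (u n)" by metis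
    have "b \<in> alg_carrier B" using b by (simp add: alg_closure_def)
    from cclass_extensionI[OF u(1) this] v(2) u(2)
    show "b \<in> extension ` alg_carrier (completion A)" by force
  qed
qed

lemma image_star_subalgebra: "star_subalgebra B (h ` alg_carrier A)"
  by (auto simp: star_subalgebra_def h_in h_ops[symmetric] ops_in)

text \<open>Shrinking \<open>B\<close> to the closure of the image makes the extension onto; the
  operations agree because they are continuous in \<open>B\<close>.\<close>

lemma extension_star_iso:
  "star_iso (alg_restrict B (alg_closure B (h ` alg_carrier A))) (completion A) extension"
proof -
  let ?C = "completion A"
  note cl = B.cstar_subalgebra_closure[OF image_star_subalgebra]
  interpret R: cstar_algebra "alg_restrict B (alg_closure B (h ` alg_carrier A))"
    by (rule B.cstar_algebra_restrict[OF cl])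
  have rep: "crep a n \<in> alg_carrier A" "h (crep a n) \<in> alg_carrier B" if "a \<in> alg_carrier ?C" for a n
    using that by (simp_all add: Cauchy_in crep_Cauchy h_in)
  have zero: "alg_zero ?C \<in> alg_carrier ?C \<and> extension (alg_zero ?C) = alg_zero B"
    using extension_embed[OF zero_in] by (simp add: completion_def completion_embed_def h_zero)
  have add: "alg_add ?C a b \<in> alg_carrier ?C \<and> extension (alg_add ?C a b) = alg_add B (extension a) (extension b)"
    if "a \<in> alg_carrier ?C" "b \<in> alg_carrier ?C" for a b
  proof -
    have "alg_add ?C a b = cclass A (\<lambda>n. alg_add A (crep a n) (crep b n))" by (simp add: completion_def)
    moreover have "(\<lambda>n. alg_dist B (h (alg_add A (crep a n) (crep b n))) (alg_add B (extension a) (extension b))) \<longlonglongrightarrow> 0"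
      using that by (simp add: h_add rep B.tendsto_alg_add extension_in extension_tendsto)
    ultimately show ?thesis
      using that by (simp only:) (rule cclass_extensionI, simp_all add: rep ops_in B.closed extension_in)
  qed
  have mult: "alg_mult ?C a b \<in> alg_carrier ?C \<and> extension (alg_mult ?C a b) = alg_mult B (extension a) (extension b)"
    if "a \<in> alg_carrier ?C" "b \<in> alg_carrier ?C" for a b
  proof -
    have "alg_mult ?C a b = cclass A (\<lambda>n. alg_mult A (crep a n) (crep b n))" by (simp add: completion_def)
    moreover have "(\<lambda>n. alg_dist B (h (alg_mult A (crep a n) (crep b n))) (alg_mult B (extension a) (extension b))) \<longlonglongrightarrow> 0"
      using that by (simp add: h_mult rep B.tendsto_alg_mult extension_in extension_tendsto)
    ultimately show ?thesis
      using that by (simp only:) (rule cclass_extensionI, simp_all add: rep ops_in B.closed extension_in)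
  qed
  have scale: "alg_scale ?C c a \<in> alg_carrier ?C \<and> extension (alg_scale ?C c a) = alg_scale B c (extension a)"
    if "a \<in> alg_carrier ?C" for a c
  proof -
    have "alg_scale ?C c a = cclass A (\<lambda>n. alg_scale A c (crep a n))" by (simp add: completion_def)
    moreover have "(\<lambda>n. alg_dist B (h (alg_scale A c (crep a n))) (alg_scale B c (extension a))) \<longlonglongrightarrow> 0"
      using that tendsto_mult[OF tendsto_const[of "cmod c"] extension_tendsto[OF that]]
      by (simp add: h_scale rep B.dist_scale extension_in)
    ultimately show ?thesis
      using that by (simp only:) (rule cclass_extensionI, simp_all add: rep ops_in B.closed extension_in)
  qed
  have star: "alg_star ?C a \<in> alg_carrier ?C \<and> extension (alg_star ?C a) = alg_star B (extension a)"
    if "a \<in> alg_carrier ?C" for a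
  proof -
    have "alg_star ?C a = cclass A (\<lambda>n. alg_star A (crep a n))" by (simp add: completion_def)
    moreover have "(\<lambda>n. alg_dist B (h (alg_star A (crep a n))) (alg_star B (extension a))) \<longlonglongrightarrow> 0"
      using that extension_tendsto[OF that] by (simp add: h_star rep B.dist_star extension_in)
    ultimately show ?thesis
      using that by (simp only:) (rule cclass_extensionI, simp_all add: rep ops_in B.closed extension_in)
  qed
  have norm: "alg_norm B (extension a) = alg_norm ?C a" if "a \<in> alg_carrier ?C" for a
  proof -
    have "(\<lambda>n. alg_norm B (h (crep a n))) \<longlonglongrightarrow> alg_norm B (extension a)"
      using that by (intro B.tendsto_alg_norm rep extension_in extension_tendsto)
    then have "(\<lambda>n. alg_norm A (crep a n)) \<longlonglongrightarrow> alg_norm B (extension a)" using that by (simp add: h_norm rep)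
    then show ?thesis by (simp add: completion_def limI)
  qed
  show ?thesis
    by unfold_locales (simp_all add: extension_bij zero add mult scale star norm)
qed

lemma cstar_algebra_completion: "cstar_algebra (completion A)"
  by (rule star_iso.cstar_algebra_A[OF extension_star_iso])

text \<open>Since the closure of the image is itself a C*-subalgebra containing the generators, it
  makes no difference whether they generate inside it or inside \<open>B\<close>.\<close>

lemma extension_generated:
  assumes S: "S \<subseteq> alg_carrier A"
  defines "C \<equiv> cstar_generated (completion A) (completion_embed A ` S)"
  shows "extension ` C = cstar_generated B (h ` S)"
    and "star_iso (alg_restrict B (cstar_generated B (h ` S))) (alg_restrict (completion A) C) extension"
proof -
  let ?R = "alg_closure B (h ` alg_carrier A)"
  interpret I: star_iso "alg_restrict B ?R" "completion A" extension by (rule extension_star_iso)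
  interpret C: cstar_algebra "completion A" by (rule cstar_algebra_completion)
  have emb: "completion_embed A ` S \<subseteq> alg_carrier (completion A)"
    using S extension_embed(1) by blast
  have img: "extension ` completion_embed A ` S = h ` S"
    using S extension_embed(2) by (force simp: image_iff)
  have R: "cstar_subalgebra B ?R" by (rule B.cstar_subalgebra_closure[OF image_star_subalgebra])
  have hS: "h ` S \<subseteq> ?R"
    using S B.closure_superset[of "h ` alg_carrier A"] h_in by (auto simp: image_subset_iff)
  have hSB: "h ` S \<subseteq> alg_carrier B" using S h_in by blast
  have "cstar_generated (alg_restrict B ?R) (h ` S) = cstar_generated B (h ` S)"
  proof
    have "cstar_generated B (h ` S) \<subseteq> ?R"
      unfolding cstar_generated_def using R hS by blast
    then have "cstar_subalgebra (alg_restrict B ?R) (cstar_generated B (h ` S))"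
      using B.cstar_subalgebra_restrict_iff[OF R] B.cstar_subalgebra_generated[OF hSB] by blast
    then show "cstar_generated (alg_restrict B ?R) (h ` S) \<subseteq> cstar_generated B (h ` S)"
      unfolding cstar_generated_def[of "alg_restrict B ?R"] using B.cstar_generated_superset[of "h ` S"] by blast
    show "cstar_generated B (h ` S) \<subseteq> cstar_generated (alg_restrict B ?R) (h ` S)"
      unfolding cstar_generated_def B.cstar_subalgebra_restrict_iff[OF R] by blast
  qed
  then show eq: "extension ` C = cstar_generated B (h ` S)"
    unfolding C_def I.image_generated[OF emb] img .
  have "cstar_subalgebra (completion A) C"
    unfolding C_def by (rule C.cstar_subalgebra_generated[OF emb])
  from I.restrict_iso[OF this]
  show "star_iso (alg_restrict B (cstar_generated B (h ` S))) (alg_restrict (completion A) C) extension"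
    unfolding eq by (simp add: alg_restrict_def)
qed

end


section \<open>The topology of the groupoid of a locally injective map\<close>

lemma continuous_map_complex_mult:
  fixes f g :: "'a \<Rightarrow> complex"
  assumes "continuous_map X euclidean f" "continuous_map X euclidean g"
  shows "continuous_map X euclidean (\<lambda>x. f x * g x)"
  using assms by (simp add: continuous_map_atin tendsto_mult)

lemma continuous_map_clopen_cases:
  assumes U: "openin X U" "closedin X U" and f: "continuous_map X Y f" and g: "continuous_map X Y g"
  shows "continuous_map X Y (\<lambda>x. if x \<in> U then f x else g x)"
  unfolding continuous_map_def
proof (intro conjI allI impI)
  show "(\<lambda>x. if x \<in> U then f x else g x) \<in> topspace X \<rightarrow> topspace Y"
    using f g by (auto simp: continuous_map_def)
  fix V assume V: "openin Y V"
  have "{x \<in> topspace X. (if x \<in> U then f x else g x) \<in> V}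
      = (U \<inter> {x \<in> topspace X. f x \<in> V}) \<union> ((topspace X - U) \<inter> {x \<in> topspace X. g x \<in> V})"
    using openin_subset[OF U(1)] by auto
  also have "openin X \<dots>"
    using U f g V by (intro openin_Un openin_Int openin_diff) (auto simp: continuous_map_def)
  finally show "openin X {x \<in> topspace X. (if x \<in> U then f x else g x) \<in> V}" .
qed

locale locally_injective_system =
  fixes X :: "'a topology" and \<phi> :: "'a \<Rightarrow> 'a"
  assumes compact: "compact_space X" and metrizable: "metrizable_space X" and Hausdorff: "Hausdorff_space X"
    and cont: "continuous_map X X \<phi>" and loc_inj: "locally_injective_map X \<phi>"
begin

lemma continuous_funpow: "continuous_map X X (\<phi> ^^ m)"
proof (induction m)
  case (Suc m)
  from continuous_map_compose[OF Suc cont] show ?case by (simp add: o_def)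
qed (simp add: id_def)

lemma funpow_in: "x \<in> topspace X \<Longrightarrow> (\<phi> ^^ m) x \<in> topspace X"
  using continuous_funpow by (metis PiE continuous_map_funspace)

lemma loc_inj_funpow: "locally_injective_map X (\<phi> ^^ m)"
proof (induction m)
  case 0
  then show ?case by (auto simp: locally_injective_map_def)
next
  case (Suc m)
  show ?case
    unfolding locally_injective_map_def
  proof
    fix x assume x: "x \<in> topspace X"
    obtain U where U: "openin X U" "x \<in> U" "inj_on (\<phi> ^^ m) U"
      using Suc x by (auto simp: locally_injective_map_def)
    obtain V where V: "openin X V" "(\<phi> ^^ m) x \<in> V" "inj_on \<phi> V"
      using loc_inj funpow_in[OF x] by (auto simp: locally_injective_map_def)
    let ?W = "U \<inter> {x \<in> topspace X. (\<phi> ^^ m) x \<in> V}"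
    have "openin X ?W" using U(1) V(1) continuous_funpow by (intro openin_Int) (auto simp: continuous_map_def)
    moreover have "inj_on (\<phi> ^^ Suc m) ?W"
      using U(3) V(3) by (auto simp: inj_on_def)
    ultimately show "\<exists>U. openin X U \<and> x \<in> U \<and> inj_on (\<phi> ^^ Suc m) U" using x U(2) V(2) by blast
  qed
qed

subsection \<open>Functions on the base space\<close>

lemma ex_metric:
  "\<exists>d. Metric_space (topspace X) d \<and> X = Metric_space.mtopology (topspace X) d
    \<and> (\<forall>a\<in>topspace X. continuous_map X euclideanreal (d a))"
proof -
  obtain M d where M: "Metric_space M d" and X: "X = Metric_space.mtopology M d"
    using metrizable by (auto simp: metrizable_space_def)
  interpret Metric_space M d by (rule M)
  have XM: "topspace X = M" by (simp add: X)
  have "continuous_map X euclideanreal (d a)" if "a \<in> topspace X" for a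
    using continuous_map_mdist[of X "metric (M, d)" "\<lambda>_. a" id] that
    by (simp add: XM mtopology_of_def X)
  then show ?thesis using M X XM by auto
qed

text \<open>A tent function of the metric, centred at \<open>x0\<close>, whose radius does not
  exceed the distance to any point of \<open>F\<close>.\<close>

lemma peak_function:
  assumes x0: "x0 \<in> topspace X" and F: "finite F" "F \<subseteq> topspace X" "x0 \<notin> F"
  obtains h where "continuous_map X euclideanreal h" "h x0 = 1" "\<And>x. x \<in> F \<Longrightarrow> h x = 0"
    "\<And>x. 0 \<le> h x" "\<And>x. x \<in> topspace X \<Longrightarrow> h x \<le> 1"
proof -
  obtain d where d: "Metric_space (topspace X) d"
    and c: "\<And>a. a \<in> topspace X \<Longrightarrow> continuous_map X euclideanreal (d a)"
    using ex_metric by blast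
  interpret Metric_space "topspace X" d by (rule d)
  \<comment> \<open>The inserted 1 gives the minimum a meaning when \<open>F\<close> is
    empty.\<close>
  define \<delta> where "\<delta> = Min (insert 1 (d x0 ` F))"
  have pos: "0 < d x0 x" if "x \<in> F" for x
    using that x0 F by (metis mdist_pos_less subset_iff)
  then have \<delta>: "0 < \<delta>" "\<And>x. x \<in> F \<Longrightarrow> \<delta> \<le> d x0 x"
    using F by (auto simp: \<delta>_def)
  let ?h = "\<lambda>x. max 0 (1 - d x0 x / \<delta>)"
  have "continuous_map X euclideanreal ?h"
    using \<delta>(1) by (intro continuous_intros c x0) auto
  then show ?thesis
    by (rule that) (use \<delta> x0 in \<open>auto simp: divide_le_eq le_divide_eq\<close>)
qed

lemma separating_function:
  assumes "x \<in> topspace X" "y \<in> topspace X" "x \<noteq> y"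
  obtains h where "continuous_map X euclideanreal h" "h x \<noteq> h y"
  using peak_function[of x "{y}"] assms by (metis empty_iff empty_subsetI finite.emptyI finite.insertI insert_iff
      insert_subset zero_neq_one)

text \<open>By compactness finitely many balls on which the iterate is injective cover the space;
  their tent functions are divided by the sum. The squares are what sums to 1, because a function
  will be multiplied to a matrix from both sides.\<close>

lemma partition_of_unity:
  "\<exists>T (h :: 'a \<Rightarrow> 'a \<Rightarrow> real). finite T \<and> (\<forall>t\<in>T. continuous_map X euclideanreal (h t))
    \<and> (\<forall>x\<in>topspace X. (\<Sum>t\<in>T. (h t x)\<^sup>2) = 1)
    \<and> (\<forall>t\<in>T. \<forall>x\<in>topspace X. \<forall>y\<in>topspace X.
         h t x \<noteq> 0 \<longrightarrow> h t y \<noteq> 0 \<longrightarrow> (\<phi> ^^ m) x = (\<phi> ^^ m) y \<longrightarrow> x = y)"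
proof -
  obtain d where d: "Metric_space (topspace X) d" and X: "X = Metric_space.mtopology (topspace X) d"
    and c: "\<And>a. a \<in> topspace X \<Longrightarrow> continuous_map X euclideanreal (d a)"
    using ex_metric by blast
  interpret Metric_space "topspace X" d by (rule d)
  have "\<exists>e>0. inj_on (\<phi> ^^ m) (mball t e)" if "t \<in> topspace X" for t
  proof -
    obtain U where U: "openin X U" "t \<in> U" "inj_on (\<phi> ^^ m) U"
      using loc_inj_funpow[of m] \<open>t \<in> topspace X\<close> by (auto simp: locally_injective_map_def)
    then obtain e where "e > 0" "mball t e \<subseteq> U" by (metis X openin_mtopology)
    with U(3) show ?thesis by (meson inj_on_subset)
  qed
  then obtain e where e: "\<And>t. t \<in> topspace X \<Longrightarrow> e t > 0 \<and> inj_on (\<phi> ^^ m) (mball t (e t))" by metis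
  have "\<exists>\<F>. finite \<F> \<and> \<F> \<subseteq> (\<lambda>t. mball t (e t)) ` topspace X \<and> topspace X \<subseteq> \<Union>\<F>"
  proof (rule compactinD)
    show "compactin X (topspace X)" using compact by (simp add: compact_space_def)
    show "openin X U" if "U \<in> (\<lambda>t. mball t (e t)) ` topspace X" for U
      using that X by (metis imageE openin_mball)
    show "topspace X \<subseteq> \<Union>((\<lambda>t. mball t (e t)) ` topspace X)" using e by (force simp: in_mball)
  qed
  then obtain \<F> where \<F>: "finite \<F>" "\<F> \<subseteq> (\<lambda>t. mball t (e t)) ` topspace X" "topspace X \<subseteq> \<Union>\<F>"
    by blast
  from finite_subset_image[OF \<F>(1,2)] \<F>(3)
  obtain T where T: "finite T" "T \<subseteq> topspace X" "topspace X \<subseteq> (\<Union>t\<in>T. mball t (e t))"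
    by blast
  define g where "g t x = max 0 (e t - d t x)" for t x
  have g: "continuous_map X euclideanreal (g t)" if "t \<in> T" for t
    unfolding g_def using T(2) that by (intro continuous_intros c) auto
  have g0: "0 \<le> g t x" for t x by (simp add: g_def)
  have g_ball: "g t x \<noteq> 0 \<Longrightarrow> x \<in> mball t (e t)" if "t \<in> T" "x \<in> topspace X" for t x
    using that T(2) by (auto simp: g_def in_mball max_def split: if_splits)
  define s where "s x = (\<Sum>t\<in>T. g t x)" for x
  have s: "0 < s x" if x: "x \<in> topspace X" for x
  proof -
    obtain t where "t \<in> T" "x \<in> mball t (e t)" using T(3) x by blast
    then have "0 < g t x" by (auto simp: g_def in_mball)
    then show ?thesis unfolding s_def using T(1) \<open>t \<in> T\<close> g0 by (intro sum_pos2[of T t]) auto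
  qed
  have cs: "continuous_map X euclideanreal s"
    unfolding s_def using T(1) g by (intro continuous_intros) auto
  define h where "h t x = sqrt (g t x / s x)" for t x
  have "continuous_map X euclideanreal (h t)" if "t \<in> T" for t
  proof -
    have q: "continuous_map X euclideanreal (\<lambda>x. g t x / s x)"
      using s by (intro continuous_intros g that cs) (auto simp: less_imp_neq[symmetric])
    have r: "continuous_map euclideanreal euclideanreal sqrt"
      by (simp add: continuous_on_real_sqrt continuous_on_id)
    show ?thesis using continuous_map_compose[OF q r] by (simp add: h_def[abs_def] o_def)
  qed
  moreover have "(\<Sum>t\<in>T. (h t x)\<^sup>2) = 1" if "x \<in> topspace X" for x
  proof -
    have "(\<Sum>t\<in>T. (h t x)\<^sup>2) = (\<Sum>t\<in>T. g t x / s x)"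
      using s[OF that] g0 by (simp add: h_def)
    also have "\<dots> = 1" using s[OF that] by (simp add: s_def flip: sum_divide_distrib)
    finally show ?thesis .
  qed
  moreover have "x = y" if "t \<in> T" "x \<in> topspace X" "y \<in> topspace X" "h t x \<noteq> 0" "h t y \<noteq> 0"
    "(\<phi> ^^ m) x = (\<phi> ^^ m) y" for t x y
  proof -
    have "x \<in> mball t (e t)" "y \<in> mball t (e t)"
      using that g_ball by (auto simp: h_def)
    then show ?thesis using e[of t] T(2) that(1,6) by (auto simp: inj_on_def)
  qed
  ultimately show ?thesis using T(1) by (intro exI[of _ T] exI[of _ h]) simp
qed

text \<open>Assign to each point an index of the partition of unity whose function does not vanish
  there. Two distinct points of one fibre cannot get the same index, so the number of indices bounds
  all fibres at once.\<close>

lemma finite_preimages: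
  "\<exists>N. \<forall>y. finite {x \<in> topspace X. (\<phi> ^^ m) x = y} \<and> card {x \<in> topspace X. (\<phi> ^^ m) x = y} \<le> N"
proof -
  from partition_of_unity[of m] obtain T and h :: "'a \<Rightarrow> 'a \<Rightarrow> real" where T: "finite T"
    and one: "\<forall>x\<in>topspace X. (\<Sum>t\<in>T. (h t x)\<^sup>2) = 1"
    and inj: "\<forall>t\<in>T. \<forall>x\<in>topspace X. \<forall>y\<in>topspace X.
         h t x \<noteq> 0 \<longrightarrow> h t y \<noteq> 0 \<longrightarrow> (\<phi> ^^ m) x = (\<phi> ^^ m) y \<longrightarrow> x = y"
    by blast
  have "\<exists>t\<in>T. h t x \<noteq> 0" if "x \<in> topspace X" for x
  proof (rule ccontr)
    assume "\<not> (\<exists>t\<in>T. h t x \<noteq> 0)"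
    then have "(\<Sum>t\<in>T. (h t x)\<^sup>2) = 0" by simp
    with one that show False by simp
  qed
  then obtain c where c: "\<And>x. x \<in> topspace X \<Longrightarrow> c x \<in> T \<and> h (c x) x \<noteq> 0" by metis
  show ?thesis
  proof (intro exI[of _ "card T"] allI)
    fix y
    let ?S = "{x \<in> topspace X. (\<phi> ^^ m) x = y}"
    have "inj_on c ?S" using c inj by (auto simp: inj_on_def) metis
    moreover have "c ` ?S \<subseteq> T" using c by auto
    ultimately show "finite ?S \<and> card ?S \<le> card T"
      using T by (meson card_inj_on_le finite_imageD finite_subset)
  qed
qed


subsection \<open>The pieces of the groupoid\<close>

text \<open>Equality of the iterates at exponent \<open>n\<close> persists at larger exponents by
  applying \<open>\<phi>\<close> further. The hypothesis keeps \<open>nat\<close> from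
  truncating.\<close>

lemma piece_iff:
  assumes "0 \<le> int n + k"
  shows "(x, l, y) \<in> Gam_piece X \<phi> k n \<longleftrightarrow>
    x \<in> topspace X \<and> y \<in> topspace X \<and> l = k \<and> (\<phi> ^^ nat (k + int n)) x = (\<phi> ^^ n) y"
proof -
  have "(\<phi> ^^ nat (k + int i)) x = (\<phi> ^^ i) y" if "(\<phi> ^^ nat (k + int n)) x = (\<phi> ^^ n) y" "n \<le> i" for i
  proof -
    have "nat (k + int i) = (i - n) + nat (k + int n)" "i = (i - n) + n" using that assms by auto
    with that(1) show ?thesis by (metis comp_apply funpow_add)
  qed
  then show ?thesis by (auto simp: Gam_piece_def)
qed

lemma piece_mono: "n \<le> m \<Longrightarrow> Gam_piece X \<phi> k n \<subseteq> Gam_piece X \<phi> k m"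
  by (auto simp: Gam_piece_def)

lemma piece_level: "0 \<le> int n + k \<Longrightarrow> Gam_piece X \<phi> k n \<subseteq> Gam_level X \<phi> k"
  by (auto simp: Gam_level_def)

lemma piece_carrier: "0 \<le> int n + k \<Longrightarrow> Gam_piece X \<phi> k n \<subseteq> Gam_carrier X \<phi>"
  using piece_level by (auto simp: Gam_carrier_eq)

lemma in_piece: "\<gamma> \<in> Gam_carrier X \<phi> \<Longrightarrow> \<exists>k n. 0 \<le> int n + k \<and> \<gamma> \<in> Gam_piece X \<phi> k n"
  by (auto simp: Gam_carrier_eq Gam_level_def)

abbreviation "ambient \<equiv> prod_topology X (prod_topology (discrete_topology (UNIV :: int set)) X)"

lemma continuous_range: "continuous_map (Gam_piece_top X \<phi> k n) X fst"
  unfolding Gam_piece_top_def by (intro continuous_map_from_subtopology continuous_map_fst)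

lemma continuous_source: "continuous_map (Gam_piece_top X \<phi> k n) X (\<lambda>\<gamma>. snd (snd \<gamma>))"
  unfolding Gam_piece_top_def
  using continuous_map_compose[OF continuous_map_snd continuous_map_snd, of X "discrete_topology (UNIV :: int set)" X]
  by (intro continuous_map_from_subtopology) (simp add: o_def)

lemma continuous_range_funpow: "continuous_map (Gam_piece_top X \<phi> k n) X (\<lambda>\<gamma>. (\<phi> ^^ m) (fst \<gamma>))"
  using continuous_map_compose[OF continuous_range continuous_funpow] by (simp add: o_def)

lemma continuous_source_funpow: "continuous_map (Gam_piece_top X \<phi> k n) X (\<lambda>\<gamma>. (\<phi> ^^ m) (snd (snd \<gamma>)))"
  using continuous_map_compose[OF continuous_source continuous_funpow] by (simp add: o_def)

text \<open>The smaller piece is the coincidence set of two continuous maps into a Hausdorff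
  space.\<close>

lemma piece_closed_in_piece:
  assumes "0 \<le> int n + k" "0 \<le> int m + k"
  shows "closedin (Gam_piece_top X \<phi> k m) (Gam_piece X \<phi> k n \<inter> Gam_piece X \<phi> k m)"
proof -
  have "Gam_piece X \<phi> k n \<inter> Gam_piece X \<phi> k m
      = {\<gamma> \<in> topspace (Gam_piece_top X \<phi> k m). (\<phi> ^^ nat (k + int n)) (fst \<gamma>) = (\<phi> ^^ n) (snd (snd \<gamma>))}"
    using assms by (auto simp: piece_iff)
  then show ?thesis
    by (simp only:) (rule closedin_continuous_maps_eq[OF Hausdorff continuous_range_funpow continuous_source_funpow])
qed

text \<open>Here local injectivity enters the topology: if the iterates of the two ends at exponent
  \<open>n\<close> lie in a common set on which the next \<open>m - n\<close> steps are injective,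
  and agree after these steps, then they agree already.\<close>

lemma piece_open_in_piece:
  assumes "0 \<le> int n + k" "n \<le> m"
  shows "openin (Gam_piece_top X \<phi> k m) (Gam_piece X \<phi> k n)"
  unfolding openin_subopen[of _ "Gam_piece X \<phi> k n"]
proof
  let ?T = "Gam_piece_top X \<phi> k m"
  let ?a = "\<lambda>\<gamma>. (\<phi> ^^ nat (k + int n)) (fst \<gamma>)" and ?b = "\<lambda>\<gamma>. (\<phi> ^^ n) (snd (snd \<gamma>))"
  fix \<gamma> assume \<gamma>: "\<gamma> \<in> Gam_piece X \<phi> k n"
  then have ab: "?a \<gamma> = ?b \<gamma>" "?b \<gamma> \<in> topspace X"
    using assms(1) by (cases \<gamma>; simp add: piece_iff funpow_in)+
  obtain U where U: "openin X U" "?b \<gamma> \<in> U" "inj_on (\<phi> ^^ (m - n)) U"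
    using loc_inj_funpow[of "m - n"] ab(2) by (auto simp: locally_injective_map_def)
  let ?W = "{\<gamma> \<in> topspace ?T. ?a \<gamma> \<in> U} \<inter> {\<gamma> \<in> topspace ?T. ?b \<gamma> \<in> U}"
  have "openin ?T ?W"
    by (intro openin_Int openin_continuous_map_preimage[OF continuous_range_funpow U(1)]
        openin_continuous_map_preimage[OF continuous_source_funpow U(1)])
  moreover have "\<gamma> \<in> ?W" using \<gamma> ab U(2) piece_mono[OF assms(2)] by auto
  moreover have "?W \<subseteq> Gam_piece X \<phi> k n"
  proof
    fix g assume g: "g \<in> ?W"
    obtain x l y where xy: "g = (x, l, y)" by (cases g)
    have m: "0 \<le> int m + k" using assms by simp
    have "nat (k + int m) = (m - n) + nat (k + int n)" "m = (m - n) + n" using assms by auto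
    then have "(\<phi> ^^ (m - n)) (?a g) = (\<phi> ^^ nat (k + int m)) x" "(\<phi> ^^ (m - n)) (?b g) = (\<phi> ^^ m) y"
      by (metis xy fst_conv snd_conv comp_apply funpow_add)+
    then have "(\<phi> ^^ (m - n)) (?a g) = (\<phi> ^^ (m - n)) (?b g)" using g xy m by (simp add: piece_iff)
    then have "?a g = ?b g" using g U(3) by (auto simp: inj_on_def)
    then show "g \<in> Gam_piece X \<phi> k n" using g xy assms(1) m by (simp add: piece_iff)
  qed
  ultimately show "\<exists>W. openin ?T W \<and> \<gamma> \<in> W \<and> W \<subseteq> Gam_piece X \<phi> k n" by blast
qed

lemma subtopology_piece_top:
  "n \<le> m \<Longrightarrow> subtopology (Gam_piece_top X \<phi> k m) (Gam_piece X \<phi> k n) = Gam_piece_top X \<phi> k n"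
  by (simp add: Gam_piece_top_def subtopology_subtopology Int_absorb1 piece_mono)

lemma openin_Gam_top_piece:
  "openin (Gam_top X \<phi>) U \<longleftrightarrow> U \<subseteq> Gam_carrier X \<phi> \<and>
     (\<forall>k n. 0 \<le> int n + k \<longrightarrow> openin (Gam_piece_top X \<phi> k n) (U \<inter> Gam_piece X \<phi> k n))"
proof -
  have "U \<inter> Gam_level X \<phi> k \<inter> Gam_piece X \<phi> k n = U \<inter> Gam_piece X \<phi> k n" if "0 \<le> int n + k" for k n
    using piece_level[OF that] by blast
  then show ?thesis by (auto simp: openin_Gam_top openin_Gam_level_top)
qed

text \<open>Openness passes to larger pieces by \<open>piece_open_in_piece\<close> and to smaller
  ones by restriction. Thus the inductive limit topology has the pieces as open subspaces and can be
  handled piece by piece.\<close>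

lemma openin_Gam_topI:
  assumes k: "0 \<le> int n + k" and U: "openin (Gam_piece_top X \<phi> k n) U"
  shows "openin (Gam_top X \<phi>) U"
  unfolding openin_Gam_top_piece
proof (intro conjI allI impI)
  have sub: "U \<subseteq> Gam_piece X \<phi> k n" using openin_subset[OF U] by simp
  then show "U \<subseteq> Gam_carrier X \<phi>" using piece_carrier[OF k] by blast
  fix l m assume l: "0 \<le> int m + l"
  show "openin (Gam_piece_top X \<phi> l m) (U \<inter> Gam_piece X \<phi> l m)"
  proof (cases "l = k")
    case False
    then have "U \<inter> Gam_piece X \<phi> l m = {}" using sub by (auto simp: Gam_piece_def)
    then show ?thesis by simp
  next
    case True
    show ?thesis
    proof (cases "n \<le> m")
      case True
      then have "openin (Gam_piece_top X \<phi> k m) U"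
        using U piece_open_in_piece[OF k True] subtopology_piece_top[OF True, of k]
        by (metis openin_trans_full)
      moreover have "U \<inter> Gam_piece X \<phi> l m = U" using sub piece_mono[OF True] \<open>l = k\<close> by blast
      ultimately show ?thesis using \<open>l = k\<close> by simp
    next
      case False
      then have "subtopology (Gam_piece_top X \<phi> k n) (Gam_piece X \<phi> k m) = Gam_piece_top X \<phi> k m"
        by (intro subtopology_piece_top) simp
      then show ?thesis using U \<open>l = k\<close> by (metis openin_subtopology)
    qed
  qed
qed

lemma openin_piece: "0 \<le> int n + k \<Longrightarrow> openin (Gam_top X \<phi>) (Gam_piece X \<phi> k n)"
  using openin_topspace[of "Gam_piece_top X \<phi> k n"] by (intro openin_Gam_topI[of n k]) simp_all

lemma closedin_piece:
  assumes "0 \<le> int n + k"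
  shows "closedin (Gam_top X \<phi>) (Gam_piece X \<phi> k n)"
  unfolding closedin_def openin_Gam_top_piece
proof (intro conjI allI impI)
  fix l m assume l: "0 \<le> int m + l"
  show "openin (Gam_piece_top X \<phi> l m) ((topspace (Gam_top X \<phi>) - Gam_piece X \<phi> k n) \<inter> Gam_piece X \<phi> l m)"
  proof (cases "l = k")
    case True
    have "(topspace (Gam_top X \<phi>) - Gam_piece X \<phi> k n) \<inter> Gam_piece X \<phi> l m
        = topspace (Gam_piece_top X \<phi> k m) - (Gam_piece X \<phi> k n \<inter> Gam_piece X \<phi> k m)"
      using piece_carrier[OF l] True by auto
    moreover have "openin (Gam_piece_top X \<phi> k m) \<dots>"
      using piece_closed_in_piece[OF assms, of m] l True by (intro openin_diff openin_topspace) simp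
    ultimately show ?thesis using True by simp
  next
    case False
    then have "(topspace (Gam_top X \<phi>) - Gam_piece X \<phi> k n) \<inter> Gam_piece X \<phi> l m
        = topspace (Gam_piece_top X \<phi> l m)"
      using piece_carrier[OF l] by (auto simp: Gam_piece_def)
    then show ?thesis by (metis openin_topspace)
  qed
qed (use piece_carrier[OF assms] in auto)

lemma subtopology_Gam_top:
  assumes "0 \<le> int n + k"
  shows "subtopology (Gam_top X \<phi>) (Gam_piece X \<phi> k n) = Gam_piece_top X \<phi> k n"
proof (rule topology_eq[THEN iffD2], rule allI)
  fix U
  show "openin (subtopology (Gam_top X \<phi>) (Gam_piece X \<phi> k n)) U \<longleftrightarrow> openin (Gam_piece_top X \<phi> k n) U"
  proof
    assume "openin (subtopology (Gam_top X \<phi>) (Gam_piece X \<phi> k n)) U"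
    then show "openin (Gam_piece_top X \<phi> k n) U"
      using assms by (auto simp: openin_subtopology openin_Gam_top_piece)
  next
    assume U: "openin (Gam_piece_top X \<phi> k n) U"
    then have "U \<subseteq> Gam_piece X \<phi> k n" using openin_subset by fastforce
    then show "openin (subtopology (Gam_top X \<phi>) (Gam_piece X \<phi> k n)) U"
      using openin_Gam_topI[OF assms U] by (auto simp: openin_subtopology)
  qed
qed

text \<open>In the compact product of \<open>X\<close>, the single degree \<open>k\<close> and
  \<open>X\<close>, the piece is cut out by a closed condition.\<close>

lemma compactin_piece:
  assumes "0 \<le> int n + k"
  shows "compactin (Gam_top X \<phi>) (Gam_piece X \<phi> k n)"
proof -
  let ?K = "topspace X \<times> ({k} \<times> topspace X)"
  let ?S = "subtopology ambient ?K"
  have "compactin ambient ?K"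
    using compact by (intro compactin_Times[THEN iffD2]) (auto simp: compactin_Times compact_space_def)
  then have K: "compact_space ?S" by (rule compact_space_subtopology)
  have 1: "continuous_map ?S X (\<lambda>\<gamma>. (\<phi> ^^ nat (k + int n)) (fst \<gamma>))"
    using continuous_map_compose[OF continuous_map_fst continuous_funpow]
    by (intro continuous_map_from_subtopology) (simp add: o_def)
  have "continuous_map ambient X (\<lambda>\<gamma>. snd (snd \<gamma>))"
    using continuous_map_compose[OF continuous_map_snd continuous_map_snd, of X "discrete_topology (UNIV :: int set)" X]
    by (simp add: o_def)
  from continuous_map_compose[OF this continuous_funpow]
  have 2: "continuous_map ?S X (\<lambda>\<gamma>. (\<phi> ^^ n) (snd (snd \<gamma>)))"
    by (intro continuous_map_from_subtopology) (simp add: o_def)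
  have "Gam_piece X \<phi> k n = {\<gamma> \<in> topspace ?S. (\<phi> ^^ nat (k + int n)) (fst \<gamma>) = (\<phi> ^^ n) (snd (snd \<gamma>))}"
    using assms by (auto simp: piece_iff)
  then have "closedin ?S (Gam_piece X \<phi> k n)"
    by (simp only:) (rule closedin_continuous_maps_eq[OF Hausdorff 1 2])
  then have "compactin ?S (Gam_piece X \<phi> k n)" by (rule closedin_compact_space[OF K])
  then have "compactin (Gam_piece_top X \<phi> k n) (Gam_piece X \<phi> k n)"
    by (auto simp: compactin_subtopology Gam_piece_top_def)
  then show ?thesis
    unfolding subtopology_Gam_top[OF assms, symmetric] by (simp add: compactin_subtopology)
qed

lemma continuous_map_Gam_iff:
  "continuous_map (Gam_top X \<phi>) Y f \<longleftrightarrow>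
     (\<forall>k n. 0 \<le> int n + k \<longrightarrow> continuous_map (Gam_piece_top X \<phi> k n) Y f)"
proof
  assume "continuous_map (Gam_top X \<phi>) Y f"
  then show "\<forall>k n. 0 \<le> int n + k \<longrightarrow> continuous_map (Gam_piece_top X \<phi> k n) Y f"
    by (metis continuous_map_from_subtopology subtopology_Gam_top)
next
  assume f: "\<forall>k n. 0 \<le> int n + k \<longrightarrow> continuous_map (Gam_piece_top X \<phi> k n) Y f"
  show "continuous_map (Gam_top X \<phi>) Y f"
    unfolding continuous_map_def
  proof (intro conjI allI impI)
    show "f \<in> topspace (Gam_top X \<phi>) \<rightarrow> topspace Y"
      using f in_piece by (fastforce simp: continuous_map_def)
    fix V assume V: "openin Y V"
    show "openin (Gam_top X \<phi>) {\<gamma> \<in> topspace (Gam_top X \<phi>). f \<gamma> \<in> V}"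
      unfolding openin_Gam_top_piece
    proof (intro conjI allI impI)
      fix k n assume k: "0 \<le> int n + k"
      have "{\<gamma> \<in> topspace (Gam_top X \<phi>). f \<gamma> \<in> V} \<inter> Gam_piece X \<phi> k n
          = {\<gamma> \<in> topspace (Gam_piece_top X \<phi> k n). f \<gamma> \<in> V}"
        using piece_carrier[OF k] by auto
      then show "openin (Gam_piece_top X \<phi> k n) ({\<gamma> \<in> topspace (Gam_top X \<phi>). f \<gamma> \<in> V} \<inter> Gam_piece X \<phi> k n)"
        using f k V by (simp add: continuous_map_def)
    qed auto
  qed
qed

text \<open>Bounding the degree by \<open>n\<close> makes \<open>n + k\<close> non-negative, so one
  exponent serves all degrees. These sets are an increasing exhaustion by compact clopen sets, and
  compact support comes to mean support in one of them.\<close>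

definition Gam_ball :: "nat \<Rightarrow> ('a \<times> int \<times> 'a) set" where
  "Gam_ball n = (\<Union>k\<in>{- int n..int n}. Gam_piece X \<phi> k n)"

lemma openin_ball: "openin (Gam_top X \<phi>) (Gam_ball n)"
  unfolding Gam_ball_def by (intro openin_Union) (auto intro: openin_piece)

lemma closedin_ball: "closedin (Gam_top X \<phi>) (Gam_ball n)"
  unfolding Gam_ball_def by (intro closedin_Union) (auto intro: closedin_piece)

lemma compactin_ball: "compactin (Gam_top X \<phi>) (Gam_ball n)"
  unfolding Gam_ball_def by (intro compactin_Union) (auto intro: compactin_piece)

lemma ball_iff:
  "(x, k, y) \<in> Gam_ball n \<longleftrightarrow> \<bar>k\<bar> \<le> int n \<and> x \<in> topspace X \<and> y \<in> topspace X
     \<and> (\<phi> ^^ nat (k + int n)) x = (\<phi> ^^ n) y"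
  by (auto simp: Gam_ball_def piece_iff)

lemma ball_carrier: "Gam_ball n \<subseteq> Gam_carrier X \<phi>"
  using openin_subset[OF openin_ball] by simp

lemma ball_mono: "n \<le> m \<Longrightarrow> Gam_ball n \<subseteq> Gam_ball m"
  unfolding Gam_ball_def using piece_mono by fastforce

lemma in_ball:
  assumes "\<gamma> \<in> Gam_carrier X \<phi>"
  shows "\<exists>n. \<gamma> \<in> Gam_ball n"
proof -
  obtain k n where "\<gamma> \<in> Gam_piece X \<phi> k n" using in_piece[OF assms] by blast
  then have "\<gamma> \<in> Gam_piece X \<phi> k (n + nat \<bar>k\<bar>)" using piece_mono[of n "n + nat \<bar>k\<bar>"] by auto
  then show ?thesis unfolding Gam_ball_def by (intro exI[of _ "n + nat \<bar>k\<bar>"] UN_I[of k]) auto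
qed

lemma compactin_subset_ball:
  assumes "compactin (Gam_top X \<phi>) K"
  shows "\<exists>n. K \<subseteq> Gam_ball n"
proof -
  have "\<exists>\<F>. finite \<F> \<and> \<F> \<subseteq> range Gam_ball \<and> K \<subseteq> \<Union>\<F>"
    by (rule compactinD[OF assms])
       (use openin_ball in_ball compactin_subset_topspace[OF assms] in \<open>auto simp: subset_iff\<close>)
  then obtain S where S: "finite S" "K \<subseteq> (\<Union>n\<in>S. Gam_ball n)" by (metis finite_subset_image)
  then have "K \<subseteq> Gam_ball (Max (insert 0 S))"
    using ball_mono by (fastforce dest!: subsetD intro: subsetD[OF ball_mono, rotated])
  then show ?thesis ..
qed

text \<open>Inversion exchanges the exponents \<open>k + n\<close> and \<open>n\<close>, and
  \<open>k + n\<close> can be as large as \<open>2 * n\<close>.\<close>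

lemma ball_inverse: "(x, k, y) \<in> Gam_ball n \<Longrightarrow> (y, - k, x) \<in> Gam_ball (2 * n)"
proof -
  assume "(x, k, y) \<in> Gam_ball n"
  then have a: "\<bar>k\<bar> \<le> int n" "x \<in> topspace X" "y \<in> topspace X" "(\<phi> ^^ nat (k + int n)) x = (\<phi> ^^ n) y"
    by (auto simp: ball_iff)
  have e: "nat (- k + int (2 * n)) = nat (int n - k) + n" "2 * n = nat (int n - k) + nat (k + int n)"
    using a(1) by auto
  have "(\<phi> ^^ nat (- k + int (2 * n))) y = (\<phi> ^^ nat (int n - k)) ((\<phi> ^^ n) y)"
    by (simp only: e(1) funpow_add comp_apply)
  also have "\<dots> = (\<phi> ^^ (nat (int n - k) + nat (k + int n))) x"
    by (simp only: a(4)[symmetric] funpow_add comp_apply)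
  finally have "(\<phi> ^^ nat (- k + int (2 * n))) y = (\<phi> ^^ (2 * n)) x" using e(2) by metis
  then show ?thesis using a by (simp add: ball_iff)
qed

lemma ball_mult: "(x, k, y) \<in> Gam_ball n \<Longrightarrow> (y, l, z) \<in> Gam_ball m \<Longrightarrow> (x, k + l, z) \<in> Gam_ball (n + m)"
proof -
  assume "(x, k, y) \<in> Gam_ball n" "(y, l, z) \<in> Gam_ball m"
  then have a: "\<bar>k\<bar> \<le> int n" "x \<in> topspace X" "z \<in> topspace X" "(\<phi> ^^ nat (k + int n)) x = (\<phi> ^^ n) y"
    and b: "\<bar>l\<bar> \<le> int m" "(\<phi> ^^ nat (l + int m)) y = (\<phi> ^^ m) z"
    unfolding ball_iff by blast+
  have e: "nat (k + l + int (n + m)) = nat (l + int m) + nat (k + int n)" using a(1) b(1) by simp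
  have "(\<phi> ^^ nat (k + l + int (n + m))) x = (\<phi> ^^ (nat (l + int m) + n)) y"
    by (simp only: e funpow_add comp_apply a(4))
  also have "\<dots> = (\<phi> ^^ (n + nat (l + int m))) y" by (simp only: add.commute)
  also have "\<dots> = (\<phi> ^^ (n + m)) z" by (simp only: funpow_add comp_apply b(2))
  finally show ?thesis using a b by (simp add: ball_iff)
qed

lemma unit_in_ball: "x \<in> topspace X \<Longrightarrow> (x, 0, x) \<in> Gam_ball n"
  by (simp add: ball_iff)

lemma carrier_inverse: "(x, k, y) \<in> Gam_carrier X \<phi> \<Longrightarrow> (y, - k, x) \<in> Gam_carrier X \<phi>"
  using in_ball ball_inverse ball_carrier by blast

lemma carrier_mult:
  "(x, k, y) \<in> Gam_carrier X \<phi> \<Longrightarrow> (y, l, z) \<in> Gam_carrier X \<phi> \<Longrightarrow> (x, k + l, z) \<in> Gam_carrier X \<phi>"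
  using in_ball ball_mult ball_carrier by (meson subsetD)

lemma carrier_unit: "x \<in> topspace X \<Longrightarrow> (x, 0, x) \<in> Gam_carrier X \<phi>"
  using unit_in_ball ball_carrier by blast

lemma carrier_topspace:
  "(x, k, y) \<in> Gam_carrier X \<phi> \<Longrightarrow> x \<in> topspace X" "(x, k, y) \<in> Gam_carrier X \<phi> \<Longrightarrow> y \<in> topspace X"
  by (auto simp: Gam_carrier_def)

lemma carrier_divide:
  "(x, a, z) \<in> Gam_carrier X \<phi> \<Longrightarrow> (y, b, z) \<in> Gam_carrier X \<phi> \<Longrightarrow> (x, a - b, y) \<in> Gam_carrier X \<phi>"
  using carrier_mult[of x a z "- b" y] carrier_inverse by simp

text \<open>A ball has finitely many degrees, and in each the admissible \<open>x\<close> form a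
  fibre of an iterate. The bound is uniform in \<open>y\<close>, which later makes the matrices of
  bounded functions sparse.\<close>

lemma ball_fibre:
  "\<exists>N. \<forall>y. finite {(x, k). (x, k, y) \<in> Gam_ball n} \<and> card {(x, k). (x, k, y) \<in> Gam_ball n} \<le> N"
proof -
  have "\<exists>M. \<forall>k. \<forall>y. finite {x \<in> topspace X. (\<phi> ^^ k) x = y} \<and> card {x \<in> topspace X. (\<phi> ^^ k) x = y} \<le> M k"
    using finite_preimages by metis
  then obtain M where M: "\<And>k y. finite {x \<in> topspace X. (\<phi> ^^ k) x = y} \<and> card {x \<in> topspace X. (\<phi> ^^ k) x = y} \<le> M k"
    by blast
  let ?P = "\<lambda>y k. {x \<in> topspace X. (\<phi> ^^ nat (k + int n)) x = (\<phi> ^^ n) y}"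
  have "finite {(x, k). (x, k, y) \<in> Gam_ball n} \<and> card {(x, k). (x, k, y) \<in> Gam_ball n}
      \<le> (\<Sum>k\<in>{- int n..int n}. M (nat (k + int n)))" for y
  proof -
    have sub: "{(x, k). (x, k, y) \<in> Gam_ball n} \<subseteq> (\<Union>k\<in>{- int n..int n}. (\<lambda>x. (x, k)) ` ?P y k)" (is "_ \<subseteq> ?U")
    proof clarify
      fix x k assume "(x, k, y) \<in> Gam_ball n"
      then show "(x, k) \<in> ?U" by (intro UN_I[of k]) (auto simp: ball_iff)
    qed
    have fin: "finite ?U" using M by auto
    have "card ?U \<le> (\<Sum>k\<in>{- int n..int n}. card ((\<lambda>x. (x, k)) ` ?P y k))"
      by (rule card_UN_le) simp
    also have "\<dots> \<le> (\<Sum>k\<in>{- int n..int n}. M (nat (k + int n)))"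
      using M by (intro sum_mono) (meson card_image_le order_trans)
    finally show ?thesis using sub fin by (meson card_mono finite_subset order_trans)
  qed
  then show ?thesis by blast
qed

end

locale discrete_periodic_system = locally_injective_system +
  assumes discrete: "\<And>k::nat. k \<ge> 1 \<Longrightarrow>
      subtopology X {x \<in> topspace X. (\<phi> ^^ k) x = x} = discrete_topology {x \<in> topspace X. (\<phi> ^^ k) x = x}"
begin

text \<open>The fixed points of an iterate form a closed, hence compact set; a compact discrete
  space is finite.\<close>

lemma finite_periodic:
  assumes "k \<ge> 1"
  shows "finite {x \<in> topspace X. (\<phi> ^^ k) x = x}" (is "finite ?P")
proof -
  have "closedin X ?P"
    using closedin_continuous_maps_eq[OF Hausdorff continuous_funpow continuous_map_id] by simp
  then have "compact_space (subtopology X ?P)"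
    using compact by (intro compact_space_subtopology closedin_compact_space)
  then show ?thesis using discrete[OF assms] compact_space_discrete_topology by metis
qed

text \<open>An isotropy element of non-zero degree at \<open>x\<close> means that two different
  iterates of \<open>x\<close> coincide. The earlier one is then periodic, with finitely many
  possibilities for each period, and each has finitely many preimages.\<close>

lemma finite_isotropy_ball: "finite {(x, k). k \<noteq> 0 \<and> (x, k, x) \<in> Gam_ball n}"
proof -
  have fin: "finite {x \<in> topspace X. (\<phi> ^^ i) x = (\<phi> ^^ j) x}" if "i < j" for i j
  proof -
    let ?P = "{x \<in> topspace X. (\<phi> ^^ (j - i)) x = x}"
    have "finite ?P" using that by (intro finite_periodic) simp
    moreover have "finite {x \<in> topspace X. (\<phi> ^^ i) x = z}" for z
      using finite_preimages[of i] by blast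
    ultimately have "finite (\<Union>z\<in>?P. {x \<in> topspace X. (\<phi> ^^ i) x = z})" by blast
    moreover have "{x \<in> topspace X. (\<phi> ^^ i) x = (\<phi> ^^ j) x} \<subseteq> (\<Union>z\<in>?P. {x \<in> topspace X. (\<phi> ^^ i) x = z})"
    proof
      fix x assume x: "x \<in> {x \<in> topspace X. (\<phi> ^^ i) x = (\<phi> ^^ j) x}"
      have "(\<phi> ^^ (j - i)) ((\<phi> ^^ i) x) = (\<phi> ^^ ((j - i) + i)) x" by (simp only: funpow_add comp_apply)
      also have "\<dots> = (\<phi> ^^ i) x" using x that by simp
      finally show "x \<in> (\<Union>z\<in>?P. {x \<in> topspace X. (\<phi> ^^ i) x = z})" using x funpow_in by auto
    qed
    ultimately show ?thesis by (rule finite_subset[rotated])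
  qed
  have fin': "finite {x \<in> topspace X. (\<phi> ^^ i) x = (\<phi> ^^ j) x}" if "i \<noteq> j" for i j
    using fin[of i j] fin[of j i] that by (cases "i < j") (auto simp: eq_commute)
  have "finite (\<Union>k\<in>{- int n..int n} - {0}. (\<lambda>x. (x, k)) ` {x \<in> topspace X. (\<phi> ^^ nat (k + int n)) x = (\<phi> ^^ n) x})"
    by (intro finite_UN_I finite_imageI fin') auto
  moreover have "{(x, k). k \<noteq> 0 \<and> (x, k, x) \<in> Gam_ball n} \<subseteq>
      (\<Union>k\<in>{- int n..int n} - {0}. (\<lambda>x. (x, k)) ` {x \<in> topspace X. (\<phi> ^^ nat (k + int n)) x = (\<phi> ^^ n) x})"
  proof clarify
    fix x k assume "k \<noteq> 0" "(x, k, x) \<in> Gam_ball n"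
    then show "(x, k) \<in> (\<Union>k\<in>{- int n..int n} - {0}. (\<lambda>x. (x, k)) ` {x \<in> topspace X. (\<phi> ^^ nat (k + int n)) x = (\<phi> ^^ n) x})"
      by (intro UN_I[of k]) (auto simp: ball_iff)
  qed
  ultimately show ?thesis by (rule finite_subset[rotated])
qed

end


section \<open>Block diagonal and sparse matrices\<close>

text \<open>An equivalence relation on the index set is represented by a map \<open>p\<close> with the classes as
  its fibres.\<close>

definition block_part :: "('i \<Rightarrow> 'b) \<Rightarrow> 'i cmat \<Rightarrow> 'i cmat" where
  "block_part p M i j = (if p i = p j then M i j else 0)"

text \<open>Index sets split along the fibres of \<open>p\<close>, blocks do not interact, and
  squared norms add up over the fibres.\<close>

lemma opbound_blocks:
  assumes "0 \<le> C" and diag: "\<And>i j. M i j \<noteq> 0 \<Longrightarrow> p i = p j"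
    and block: "\<And>c I J \<xi>. \<lbrakk>finite I; finite J; \<And>i. i \<in> I \<Longrightarrow> p i = c; \<And>j. j \<in> J \<Longrightarrow> p j = c\<rbrakk>
      \<Longrightarrow> L2_set (\<lambda>i. cmod (\<Sum>j\<in>J. M i j * \<xi> j)) I \<le> C * L2_set (\<lambda>j. cmod (\<xi> j)) J"
  shows "opbound C M"
  unfolding opbound_def
proof (intro conjI allI impI \<open>0 \<le> C\<close>)
  fix I J :: "'a set" and \<xi> :: "'a \<Rightarrow> complex"
  assume fin: "finite I" "finite J"
  let ?T = "p ` (I \<union> J)"
  let ?I = "\<lambda>c. {i \<in> I. p i = c}" and ?J = "\<lambda>c. {j \<in> J. p j = c}"
  have T: "finite ?T" "p ` I \<subseteq> ?T" "p ` J \<subseteq> ?T" using fin by auto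
  have "(L2_set (\<lambda>i. cmod (\<Sum>j\<in>J. M i j * \<xi> j)) I)\<^sup>2
      = (\<Sum>c\<in>?T. \<Sum>i\<in>?I c. (cmod (\<Sum>j\<in>J. M i j * \<xi> j))\<^sup>2)"
    unfolding L2_set_square by (rule sum.group[OF fin(1) T(1,2), symmetric])
  also have "\<dots> = (\<Sum>c\<in>?T. (L2_set (\<lambda>i. cmod (\<Sum>j\<in>?J c. M i j * \<xi> j)) (?I c))\<^sup>2)"
  proof (intro sum.cong refl, unfold L2_set_square, intro sum.cong refl)
    fix c i assume "i \<in> ?I c"
    then have "(\<Sum>j\<in>J. M i j * \<xi> j) = (\<Sum>j\<in>?J c. M i j * \<xi> j)"
      using fin diag by (intro sum.mono_neutral_right) auto
    then show "(cmod (\<Sum>j\<in>J. M i j * \<xi> j))\<^sup>2 = (cmod (\<Sum>j\<in>?J c. M i j * \<xi> j))\<^sup>2" by simp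
  qed
  also have "\<dots> \<le> (\<Sum>c\<in>?T. (C * L2_set (\<lambda>j. cmod (\<xi> j)) (?J c))\<^sup>2)"
    using fin by (intro sum_mono power_mono block) auto
  also have "\<dots> = C\<^sup>2 * (\<Sum>c\<in>?T. \<Sum>j\<in>?J c. (cmod (\<xi> j))\<^sup>2)"
    by (simp add: power_mult_distrib L2_set_square sum_distrib_left)
  also have "(\<Sum>c\<in>?T. \<Sum>j\<in>?J c. (cmod (\<xi> j))\<^sup>2) = (L2_set (\<lambda>j. cmod (\<xi> j)) J)\<^sup>2"
    unfolding L2_set_square by (rule sum.group[OF fin(2) T(1,3)])
  also have "C\<^sup>2 * (L2_set (\<lambda>j. cmod (\<xi> j)) J)\<^sup>2 = (C * L2_set (\<lambda>j. cmod (\<xi> j)) J)\<^sup>2"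
    by (simp only: power_mult_distrib)
  finally show "L2_set (\<lambda>i. cmod (\<Sum>j\<in>J. M i j * \<xi> j)) I \<le> C * L2_set (\<lambda>j. cmod (\<xi> j)) J"
    by (rule power2_le_imp_le) (simp add: \<open>0 \<le> C\<close>)
qed

text \<open>Each diagonal block is a submatrix of \<open>M\<close>, so it inherits the
  bound.\<close>

lemma opbound_block_part:
  assumes "opbound C M"
  shows "opbound C (block_part p M)"
proof (rule opbound_blocks[where p = p])
  show "0 \<le> C" using assms by (rule opbound_nonneg)
  show "p i = p j" if "block_part p M i j \<noteq> 0" for i j using that by (auto simp: block_part_def split: if_splits)
  fix c I J \<xi> assume fin: "finite I" "finite J" and "\<And>i. i \<in> I \<Longrightarrow> p i = c" "\<And>j. j \<in> J \<Longrightarrow> p j = c"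
  then have "L2_set (\<lambda>i. cmod (\<Sum>j\<in>J. block_part p M i j * \<xi> j)) I = L2_set (\<lambda>i. cmod (\<Sum>j\<in>J. M i j * \<xi> j)) I"
    by (intro L2_set_cong refl arg_cong[where f = cmod] sum.cong) (auto simp: block_part_def)
  then show "L2_set (\<lambda>i. cmod (\<Sum>j\<in>J. block_part p M i j * \<xi> j)) I \<le> C * L2_set (\<lambda>j. cmod (\<xi> j)) J"
    using opbound_apply[OF assms fin] by simp
qed

text \<open>A non-zero \<open>D i j\<close> puts \<open>i\<close> and \<open>j\<close> into one
  class, so it does not matter which of them is compared with \<open>k\<close>. This becomes the
  bimodule property of the expectation.\<close>

lemma block_part_mmult_left:
  assumes "\<And>i j. D i j \<noteq> 0 \<Longrightarrow> p i = p j"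
  shows "block_part p (mmult D M) = mmult D (block_part p M)"
proof (intro ext)
  fix i k
  have "D i j * block_part p M j k = (if p i = p k then D i j * M j k else 0)" for j
    using assms[of i j] by (cases "D i j = 0") (auto simp: block_part_def)
  then show "block_part p (mmult D M) i k = mmult D (block_part p M) i k"
    by (simp add: mmult_def block_part_def)
qed

lemma block_part_mmult_right:
  assumes "\<And>i j. D i j \<noteq> 0 \<Longrightarrow> p i = p j"
  shows "block_part p (mmult M D) = mmult (block_part p M) D"
proof (intro ext)
  fix i k
  have "block_part p M i j * D j k = (if p i = p k then M i j * D j k else 0)" for j
    using assms[of j k] by (cases "D j k = 0") (auto simp: block_part_def)
  then show "block_part p (mmult M D) i k = mmult (block_part p M) D i k"
    by (simp add: mmult_def block_part_def)
qed

lemma mmult_nonzeroE: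
  assumes "mmult M N i k \<noteq> 0"
  obtains j where "M i j \<noteq> 0" "N j k \<noteq> 0"
proof -
  have "\<exists>j. M i j * N j k \<noteq> 0"
  proof (rule ccontr)
    assume "\<not> (\<exists>j. M i j * N j k \<noteq> 0)"
    then have "M i j * N j k = 0" for j by auto
    then have "mmult M N i k = 0" unfolding mmult_def by (intro infsum_0)
    with assms show False by simp
  qed
  then show ?thesis using that by auto
qed

lemma cmod_sum_square_le:
  assumes "finite J"
  shows "(cmod (\<Sum>j\<in>J. z j))\<^sup>2 \<le> real (card J) * (\<Sum>j\<in>J. (cmod (z j))\<^sup>2)"
proof -
  have "cmod (\<Sum>j\<in>J. z j) \<le> (\<Sum>j\<in>J. \<bar>1\<bar> * \<bar>cmod (z j)\<bar>)" using norm_sum[of z J] by simp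
  also have "\<dots> \<le> L2_set (\<lambda>_. 1) J * L2_set (\<lambda>j. cmod (z j)) J" by (rule L2_set_mult_ineq)
  finally have "(cmod (\<Sum>j\<in>J. z j))\<^sup>2 \<le> (L2_set (\<lambda>_. 1) J * L2_set (\<lambda>j. cmod (z j)) J)\<^sup>2"
    by (intro power_mono) auto
  then show ?thesis by (simp only: power_mult_distrib L2_set_square) simp
qed

text \<open>A form of Schur's test: Cauchy-Schwarz along a row costs a factor \<open>N\<close>, and
  each \<open>\<xi> j\<close> is then counted in at most \<open>N\<close> rows, so the squared norm
  grows by at most \<open>(N c)^2\<close>.\<close>

lemma opbound_sparse:
  assumes c: "0 \<le> c" "\<And>i j. cmod (M i j) \<le> c"
    and row: "\<And>i. finite {j. M i j \<noteq> 0} \<and> card {j. M i j \<noteq> 0} \<le> N"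
    and col: "\<And>j. finite {i. M i j \<noteq> 0} \<and> card {i. M i j \<noteq> 0} \<le> N"
  shows "opbound (real N * c) M"
  unfolding opbound_def
proof (intro conjI allI impI)
  show "0 \<le> real N * c" using c by simp
  fix I J :: "'a set" and \<xi> :: "'a \<Rightarrow> complex"
  assume fin: "finite I" "finite J"
  have 1: "(cmod (\<Sum>j\<in>J. M i j * \<xi> j))\<^sup>2 \<le> real N * c\<^sup>2 * (\<Sum>j\<in>J. if M i j \<noteq> 0 then (cmod (\<xi> j))\<^sup>2 else 0)" for i
  proof -
    let ?K = "J \<inter> {j. M i j \<noteq> 0}"
    have "(\<Sum>j\<in>J. M i j * \<xi> j) = (\<Sum>j\<in>?K. M i j * \<xi> j)"
      using fin by (intro sum.mono_neutral_right) auto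
    then have "(cmod (\<Sum>j\<in>J. M i j * \<xi> j))\<^sup>2 \<le> real (card ?K) * (\<Sum>j\<in>?K. (cmod (M i j * \<xi> j))\<^sup>2)"
      using cmod_sum_square_le[of ?K "\<lambda>j. M i j * \<xi> j"] fin by simp
    also have "\<dots> \<le> real N * (\<Sum>j\<in>?K. c\<^sup>2 * (cmod (\<xi> j))\<^sup>2)"
    proof (intro mult_mono sum_mono sum_nonneg)
      show "real (card ?K) \<le> real N" using row[of i] by (meson card_mono inf_le2 of_nat_mono order_trans)
      show "(cmod (M i j * \<xi> j))\<^sup>2 \<le> c\<^sup>2 * (cmod (\<xi> j))\<^sup>2" for j
        using c by (simp add: norm_mult power_mult_distrib mult_right_mono power_mono)
    qed auto
    also have "\<dots> = real N * c\<^sup>2 * (\<Sum>j\<in>J. if M i j \<noteq> 0 then (cmod (\<xi> j))\<^sup>2 else 0)"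
      using fin by (simp add: sum_distrib_left[symmetric] sum.inter_restrict mult.assoc)
    finally show ?thesis .
  qed
  have "(L2_set (\<lambda>i. cmod (\<Sum>j\<in>J. M i j * \<xi> j)) I)\<^sup>2
      \<le> (\<Sum>i\<in>I. real N * c\<^sup>2 * (\<Sum>j\<in>J. if M i j \<noteq> 0 then (cmod (\<xi> j))\<^sup>2 else 0))"
    unfolding L2_set_square by (intro sum_mono 1)
  also have "\<dots> = real N * c\<^sup>2 * (\<Sum>j\<in>J. \<Sum>i\<in>I. if M i j \<noteq> 0 then (cmod (\<xi> j))\<^sup>2 else 0)"
    unfolding sum_distrib_left[symmetric] by (subst sum.swap) (rule refl)
  also have "\<dots> \<le> real N * c\<^sup>2 * (\<Sum>j\<in>J. real N * (cmod (\<xi> j))\<^sup>2)"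
  proof (intro mult_left_mono sum_mono)
    fix j
    have "card (I \<inter> {i. M i j \<noteq> 0}) \<le> N" using col[of j] by (meson card_mono inf_le2 order_trans)
    then show "(\<Sum>i\<in>I. if M i j \<noteq> 0 then (cmod (\<xi> j))\<^sup>2 else 0) \<le> real N * (cmod (\<xi> j))\<^sup>2"
      using fin by (simp add: sum.If_cases mult_right_mono)
  qed (use c in auto)
  also have "\<dots> = (real N * c)\<^sup>2 * (L2_set (\<lambda>j. cmod (\<xi> j)) J)\<^sup>2"
    unfolding L2_set_square by (simp add: power_mult_distrib sum_distrib_left[symmetric] power2_eq_square[of "real N"] mult_ac)
  also have "\<dots> = (real N * c * L2_set (\<lambda>j. cmod (\<xi> j)) J)\<^sup>2"
    by (simp only: power_mult_distrib)
  finally show "L2_set (\<lambda>i. cmod (\<Sum>j\<in>J. M i j * \<xi> j)) I \<le> real N * c * L2_set (\<lambda>j. cmod (\<xi> j)) J"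
    by (rule power2_le_imp_le) (simp add: c)
qed


section \<open>The regular representation\<close>

lemma Gam_simps [simp]:
  "gcarrier (Gam X \<phi>) = Gam_carrier X \<phi>" "gtop (Gam X \<phi>) = Gam_top X \<phi>"
  "gmult (Gam X \<phi>) (x, k, y) (w, l, z) = (x, k + l, z)" "ginv (Gam X \<phi>) (x, k, y) = (y, - k, x)"
  "grange (Gam X \<phi>) (x, k, y) = (x, 0, x)" "gsource (Gam X \<phi>) (x, k, y) = (y, 0, y)"
  by (simp_all add: gcarrier_def Gam_def grange_def gsource_def)

lemma isotropy_Gam: "(x, k, y) \<in> isotropy (Gam X \<phi>) \<longleftrightarrow> (x, k, y) \<in> Gam_carrier X \<phi> \<and> x = y"
  by (simp add: isotropy_def)

lemma gfactor_Gam: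
  "(\<gamma>1, \<gamma>2) \<in> gfactor (Gam X \<phi>) (x, k, z) \<longleftrightarrow>
    (\<exists>y l. \<gamma>1 = (x, k - l, y) \<and> \<gamma>2 = (y, l, z) \<and> \<gamma>1 \<in> Gam_carrier X \<phi> \<and> \<gamma>2 \<in> Gam_carrier X \<phi>)"
  by (cases \<gamma>1; cases \<gamma>2) (auto simp: gfactor_def)

context locally_injective_system
begin

text \<open>The direct sum of the representations \<open>gpi\<close> over all units acts on the square summable
  families indexed by the groupoid; the entry at \<open>(\<gamma>, \<gamma>')\<close> of the matrix of \<open>f\<close> is the value of
  \<open>f\<close> at \<open>\<gamma> \<gamma>'\<^sup>-\<^sup>1\<close> when the sources agree.\<close>

definition mat :: "('a \<times> int \<times> 'a \<Rightarrow> complex) \<Rightarrow> ('a \<times> int \<times> 'a) cmat" where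
  "mat f \<gamma> \<gamma>' = (if snd (snd \<gamma>) = snd (snd \<gamma>') \<and> \<gamma> \<in> Gam_carrier X \<phi> \<and> \<gamma>' \<in> Gam_carrier X \<phi>
     then f (fst \<gamma>, fst (snd \<gamma>) - fst (snd \<gamma>'), fst \<gamma>') else 0)"

abbreviation "G \<equiv> Gam X \<phi>"

lemma mat_simps:
  "mat f (x, a, z) (y, b, w) =
     (if z = w \<and> (x, a, z) \<in> Gam_carrier X \<phi> \<and> (y, b, w) \<in> Gam_carrier X \<phi> then f (x, a - b, y) else 0)"
  by (auto simp: mat_def)

lemma mat_unit: "(x, k, y) \<in> Gam_carrier X \<phi> \<Longrightarrow> mat f (x, k, y) (y, 0, y) = f (x, k, y)"
  by (simp add: mat_simps carrier_unit carrier_topspace(2))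

text \<open>An element \<open>(w, c, z)\<close> of the source fibre at \<open>z\<close> encodes the
  factorisation passing through \<open>w\<close>; this reindexing turns convolution into a matrix
  product.\<close>

lemma infsum_gfactor:
  assumes x: "(x, a, z) \<in> Gam_carrier X \<phi>" and y: "(y, b, z) \<in> Gam_carrier X \<phi>"
  shows "(\<Sum>\<^sub>\<infinity>(\<gamma>1, \<gamma>2)\<in>gfactor G (x, a - b, y). F \<gamma>1 \<gamma>2)
    = (\<Sum>\<^sub>\<infinity>(w, c, v)\<in>{\<gamma> \<in> Gam_carrier X \<phi>. snd (snd \<gamma>) = z}. F (x, a - c, w) (w, c - b, y))"
proof -
  let ?Z = "{\<gamma> \<in> Gam_carrier X \<phi>. snd (snd \<gamma>) = z}"
  let ?g = "\<lambda>(w, c, v). ((x, a - c, w), (w, c - b, y))"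
  have "bij_betw ?g ?Z (gfactor G (x, a - b, y))"
    unfolding bij_betw_def
  proof
    show "inj_on ?g ?Z" by (auto simp: inj_on_def)
    show "?g ` ?Z = gfactor G (x, a - b, y)"
    proof (intro subset_antisym subsetI)
      fix q assume "q \<in> ?g ` ?Z"
      then obtain w c where w: "(w, c, z) \<in> Gam_carrier X \<phi>" and q: "q = ((x, a - c, w), (w, c - b, y))"
        by auto
      then show "q \<in> gfactor G (x, a - b, y)"
        using carrier_divide[OF x w] carrier_divide[OF w y] by (simp add: gfactor_Gam)
    next
      fix q assume "q \<in> gfactor G (x, a - b, y)"
      then obtain w l where q: "q = ((x, a - b - l, w), (w, l, y))" and w: "(w, l, y) \<in> Gam_carrier X \<phi>"
        by (cases q) (auto simp: gfactor_Gam)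
      have "(w, l + b, z) \<in> ?Z" using carrier_mult[OF w y] by simp
      moreover have "?g (w, l + b, z) = q" using q by (simp add: algebra_simps)
      ultimately show "q \<in> ?g ` ?Z" using image_eqI[of q ?g "(w, l + b, z)" ?Z] by simp
    qed
  qed
  from infsum_reindex_bij_betw[OF this, of "\<lambda>(\<gamma>1, \<gamma>2). F \<gamma>1 \<gamma>2", symmetric] show ?thesis
    by (simp add: case_prod_unfold)
qed

text \<open>Both sides are one and the same sum after reindexing, so the identity holds for
  arbitrary functions, whether or not the sums converge.\<close>

lemma mat_gconv: "mat (gconv G f g) = mmult (mat f) (mat g)"
proof (intro ext)
  fix \<gamma> \<gamma>' :: "'a \<times> int \<times> 'a"
  obtain x a z y b z' where g: "\<gamma> = (x, a, z)" "\<gamma>' = (y, b, z')" by (cases \<gamma>, cases \<gamma>') auto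
  show "mat (gconv G f g) \<gamma> \<gamma>' = mmult (mat f) (mat g) \<gamma> \<gamma>'"
  proof (cases "z = z' \<and> \<gamma> \<in> Gam_carrier X \<phi> \<and> \<gamma>' \<in> Gam_carrier X \<phi>")
    case True
    let ?Z = "{\<gamma> \<in> Gam_carrier X \<phi>. snd (snd \<gamma>) = z}"
    have "mat (gconv G f g) \<gamma> \<gamma>' = (\<Sum>\<^sub>\<infinity>(w, c, v)\<in>?Z. f (x, a - c, w) * g (w, c - b, y))"
    proof -
      have 1: "(x, a, z) \<in> Gam_carrier X \<phi>" "(y, b, z) \<in> Gam_carrier X \<phi>" and z: "z' = z"
        using True by (auto simp: g)
      show ?thesis using infsum_gfactor[OF 1, of "\<lambda>\<gamma>1 \<gamma>2. f \<gamma>1 * g \<gamma>2"] 1 by (simp add: g z mat_simps gconv_def)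
    qed
    also have "\<dots> = (\<Sum>\<^sub>\<infinity>\<gamma>''. mat f \<gamma> \<gamma>'' * mat g \<gamma>'' \<gamma>')"
      by (rule infsum_cong_neutral) (use True in \<open>auto simp: g mat_simps split: if_splits\<close>)
    finally show ?thesis by (simp add: mmult_def)
  next
    case False
    have "\<not> (mat f \<gamma> j \<noteq> 0 \<and> mat g j \<gamma>' \<noteq> 0)" for j
      using False by (cases j) (auto simp: g mat_simps split: if_splits)
    then have "mmult (mat f) (mat g) \<gamma> \<gamma>' = 0" by (blast elim: mmult_nonzeroE)
    then show ?thesis using False by (auto simp: g mat_simps)
  qed
qed

lemma mat_ginvolution: "mat (ginvolution G f) = madj (mat f)"
proof (intro ext)
  fix \<gamma> \<gamma>' :: "'a \<times> int \<times> 'a"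
  obtain x a z y b z' where "\<gamma> = (x, a, z)" "\<gamma>' = (y, b, z')" by (cases \<gamma>, cases \<gamma>') auto
  then show "mat (ginvolution G f) \<gamma> \<gamma>' = madj (mat f) \<gamma> \<gamma>'"
    by (auto simp: madj_def mat_simps ginvolution_def carrier_divide)
qed

text \<open>Balls are closed and compact, and every compact set lies in a ball.\<close>

lemma compact_support_iff:
  "(\<forall>\<gamma>. \<gamma> \<notin> gcarrier G \<longrightarrow> f \<gamma> = 0) \<and> compactin (gtop G) (gsupport G f)
    \<longleftrightarrow> (\<exists>n. \<forall>\<gamma>. f \<gamma> \<noteq> 0 \<longrightarrow> \<gamma> \<in> Gam_ball n)"
proof
  assume f: "(\<forall>\<gamma>. \<gamma> \<notin> gcarrier G \<longrightarrow> f \<gamma> = 0) \<and> compactin (gtop G) (gsupport G f)"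
  obtain n where n: "gsupport G f \<subseteq> Gam_ball n"
    using compactin_subset_ball[of "gsupport G f"] f by auto
  have "\<gamma> \<in> Gam_ball n" if "f \<gamma> \<noteq> 0" for \<gamma>
  proof -
    have "\<gamma> \<in> {\<gamma> \<in> gcarrier G. f \<gamma> \<noteq> 0}" using that f by blast
    then have "\<gamma> \<in> gsupport G f"
      unfolding gsupport_def using closure_of_subset[of "{\<gamma> \<in> gcarrier G. f \<gamma> \<noteq> 0}" "gtop G"] by auto
    then show ?thesis using n by blast
  qed
  then show "\<exists>n. \<forall>\<gamma>. f \<gamma> \<noteq> 0 \<longrightarrow> \<gamma> \<in> Gam_ball n" by blast
next
  assume "\<exists>n. \<forall>\<gamma>. f \<gamma> \<noteq> 0 \<longrightarrow> \<gamma> \<in> Gam_ball n"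
  then obtain n where n: "\<And>\<gamma>. f \<gamma> \<noteq> 0 \<Longrightarrow> \<gamma> \<in> Gam_ball n" by blast
  have "gsupport G f \<subseteq> Gam_ball n"
    unfolding gsupport_def using closedin_ball n by (intro closure_of_minimal) auto
  then have "compactin (Gam_top X \<phi>) (gsupport G f)"
    by (rule closed_compactin[OF compactin_ball]) (simp add: gsupport_def)
  moreover have "f \<gamma> = 0" if "\<gamma> \<notin> Gam_carrier X \<phi>" for \<gamma> using n ball_carrier that by blast
  ultimately show "(\<forall>\<gamma>. \<gamma> \<notin> gcarrier G \<longrightarrow> f \<gamma> = 0) \<and> compactin (gtop G) (gsupport G f)"
    by simp
qed

lemma Bc_iff:
  "f \<in> Bc_set G \<longleftrightarrow> bounded (range f) \<and> (\<exists>n. \<forall>\<gamma>. f \<gamma> \<noteq> 0 \<longrightarrow> \<gamma> \<in> Gam_ball n)"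
  unfolding compact_support_iff[symmetric] Bc_set_def by blast

lemma Cc_iff:
  "f \<in> Cc_set G \<longleftrightarrow> continuous_map (Gam_top X \<phi>) euclidean f \<and> (\<exists>n. \<forall>\<gamma>. f \<gamma> \<noteq> 0 \<longrightarrow> \<gamma> \<in> Gam_ball n)"
  unfolding compact_support_iff[symmetric] Cc_set_def Gam_simps by blast

lemma Cc_subset_Bc: "Cc_set G \<subseteq> Bc_set G"
proof
  fix f assume f: "f \<in> Cc_set G"
  then obtain n where n: "\<And>\<gamma>. f \<gamma> \<noteq> 0 \<Longrightarrow> \<gamma> \<in> Gam_ball n" by (auto simp: Cc_iff)
  have "compactin euclidean (f ` Gam_ball n)"
    using f by (intro image_compactin[OF compactin_ball]) (simp add: Cc_iff)
  then have "bounded (insert 0 (f ` Gam_ball n))" by (simp add: compact_imp_bounded)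
  moreover have "range f \<subseteq> insert 0 (f ` Gam_ball n)" using n by blast
  ultimately show "f \<in> Bc_set G" using n unfolding Bc_iff by (meson bounded_subset)
qed

text \<open>The non-zero entries of a column inject into a fibre of \<open>Gam_ball n\<close>, those
  of a row, by inversion, into a fibre of \<open>Gam_ball (2 * n)\<close>. Hence the matrix is
  sparse.\<close>

lemma opbound_mat:
  assumes f: "f \<in> Bc_set G"
  shows "\<exists>C. opbound C (mat f)"
proof -
  obtain n where n: "\<And>\<gamma>. f \<gamma> \<noteq> 0 \<Longrightarrow> \<gamma> \<in> Gam_ball n" and "bounded (range f)" using f by (auto simp: Bc_iff)
  then obtain c where "\<And>\<gamma>. cmod (f \<gamma>) \<le> c" unfolding bounded_iff by auto
  moreover from this have c: "0 \<le> c" by (meson norm_ge_zero order_trans)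
  ultimately have entry: "cmod (mat f \<gamma> \<gamma>') \<le> c" for \<gamma> \<gamma>' by (simp add: mat_def)
  obtain N1 where N1: "\<And>y. finite {(x, k). (x, k, y) \<in> Gam_ball n} \<and> card {(x, k). (x, k, y) \<in> Gam_ball n} \<le> N1"
    using ball_fibre[of n] by blast
  obtain N2 where N2: "\<And>y. finite {(x, k). (x, k, y) \<in> Gam_ball (2 * n)}
      \<and> card {(x, k). (x, k, y) \<in> Gam_ball (2 * n)} \<le> N2"
    using ball_fibre[of "2 * n"] by blast
  have col: "finite {\<gamma>. mat f \<gamma> \<gamma>' \<noteq> 0} \<and> card {\<gamma>. mat f \<gamma> \<gamma>' \<noteq> 0} \<le> max N1 N2" for \<gamma>'
  proof -
    obtain y b z where \<gamma>': "\<gamma>' = (y, b, z)" by (cases \<gamma>')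
    let ?S = "{(x, k). (x, k, y) \<in> Gam_ball n}"
    have "{\<gamma>. mat f \<gamma> \<gamma>' \<noteq> 0} \<subseteq> (\<lambda>(x, k). (x, k + b, z)) ` ?S"
    proof
      fix \<gamma> assume "\<gamma> \<in> {\<gamma>. mat f \<gamma> \<gamma>' \<noteq> 0}"
      then obtain x a where \<gamma>: "\<gamma> = (x, a, z)" "f (x, a - b, y) \<noteq> 0"
        by (cases \<gamma>) (auto simp: \<gamma>' mat_simps split: if_splits)
      then show "\<gamma> \<in> (\<lambda>(x, k). (x, k + b, z)) ` ?S"
        using n by (intro image_eqI[of _ _ "(x, a - b)"]) auto
    qed
    moreover have "finite ?S" "card ?S \<le> N1" using N1[of y] by auto
    ultimately show ?thesis by (meson card_image_le card_mono finite_imageI finite_subset max.coboundedI1 order_trans)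
  qed
  have row: "finite {\<gamma>'. mat f \<gamma> \<gamma>' \<noteq> 0} \<and> card {\<gamma>'. mat f \<gamma> \<gamma>' \<noteq> 0} \<le> max N1 N2" for \<gamma>
  proof -
    obtain x a z where \<gamma>: "\<gamma> = (x, a, z)" by (cases \<gamma>)
    let ?S = "{(y, k). (y, k, x) \<in> Gam_ball (2 * n)}"
    have "{\<gamma>'. mat f \<gamma> \<gamma>' \<noteq> 0} \<subseteq> (\<lambda>(y, k). (y, k + a, z)) ` ?S"
    proof
      fix \<gamma>' assume "\<gamma>' \<in> {\<gamma>'. mat f \<gamma> \<gamma>' \<noteq> 0}"
      then obtain y b where \<gamma>': "\<gamma>' = (y, b, z)" "f (x, a - b, y) \<noteq> 0"
        by (cases \<gamma>') (auto simp: \<gamma> mat_simps split: if_splits)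
      then have "(y, b - a, x) \<in> Gam_ball (2 * n)" using ball_inverse[OF n, of x "a - b" y] by simp
      then show "\<gamma>' \<in> (\<lambda>(y, k). (y, k + a, z)) ` ?S"
        using \<gamma>' by (intro image_eqI[of _ _ "(y, b - a)"]) auto
    qed
    moreover have "finite ?S" "card ?S \<le> N2" using N2[of x] by auto
    ultimately show ?thesis by (meson card_image_le card_mono finite_imageI finite_subset max.coboundedI2 order_trans)
  qed
  show ?thesis using opbound_sparse[OF c entry row col] by blast
qed

subsection \<open>The reduced norm\<close>

lemma gunits_Gam: "gunits G = (\<lambda>x. (x, 0, x)) ` topspace X"
  using carrier_unit carrier_topspace by (force simp: gunits_def image_iff)

lemma fibre_Gam: "gsource_fibre G (z, 0, z) = {\<gamma> \<in> Gam_carrier X \<phi>. snd (snd \<gamma>) = z}"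
  by (auto simp: gsource_fibre_def)

text \<open>This is the reindexing of \<open>infsum_gfactor\<close> with the unit at
  \<open>z\<close> as the second element, so that the factorisations of an element of the fibre are
  indexed by the fibre itself.\<close>

lemma gpi_eq_mvec:
  assumes z: "z \<in> topspace X" and \<psi>: "\<And>\<gamma>. \<gamma> \<notin> gsource_fibre G (z, 0, z) \<Longrightarrow> \<psi> \<gamma> = 0"
    and \<gamma>: "\<gamma> \<in> gsource_fibre G (z, 0, z)"
  shows "gpi G (z, 0, z) f \<psi> \<gamma> = mvec (mat f) \<psi> \<gamma>"
proof -
  obtain x a where x: "\<gamma> = (x, a, z)" "(x, a, z) \<in> Gam_carrier X \<phi>"
    using \<gamma> by (cases \<gamma>) (auto simp: fibre_Gam)
  let ?Z = "{\<gamma> \<in> Gam_carrier X \<phi>. snd (snd \<gamma>) = z}"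
  have "gpi G (z, 0, z) f \<psi> \<gamma> = (\<Sum>\<^sub>\<infinity>(w, c, v)\<in>?Z. f (x, a - c, w) * \<psi> (w, c, z))"
    using infsum_gfactor[OF x(2) carrier_unit[OF z], of "\<lambda>\<gamma>1 \<gamma>2. f \<gamma>1 * \<psi> \<gamma>2"] \<gamma> x by (simp add: gpi_def)
  also have "\<dots> = (\<Sum>\<^sub>\<infinity>\<gamma>''. mat f \<gamma> \<gamma>'' * \<psi> \<gamma>'')"
    by (rule infsum_cong_neutral) (use \<psi> x in \<open>auto simp: mat_simps fibre_Gam\<close>)
  finally show ?thesis by (simp add: mvec_def)
qed

lemma ell2_norm_le:
  assumes "\<And>F. finite F \<Longrightarrow> F \<subseteq> S \<Longrightarrow> L2_set (\<lambda>i. cmod (\<psi> i)) F \<le> b" "0 \<le> b"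
  shows "(\<lambda>i. (cmod (\<psi> i))\<^sup>2) summable_on S" "ell2_norm S \<psi> \<le> b"
proof -
  have le: "(\<Sum>i\<in>F. (cmod (\<psi> i))\<^sup>2) \<le> b\<^sup>2" if "finite F" "F \<subseteq> S" for F
    unfolding L2_set_square[symmetric] using assms that by (intro power_mono) auto
  show sm: "(\<lambda>i. (cmod (\<psi> i))\<^sup>2) summable_on S"
    by (rule nonneg_bdd_above_summable_on) (use le in \<open>auto intro!: bdd_aboveI[of _ "b\<^sup>2"]\<close>)
  have "(\<Sum>\<^sub>\<infinity>i\<in>S. (cmod (\<psi> i))\<^sup>2) \<le> b\<^sup>2" by (rule infsum_le_finite_sums[OF sm le])
  then show "ell2_norm S \<psi> \<le> b" unfolding ell2_norm_def using assms(2) by (intro real_le_lsqrt) (auto intro: infsum_nonneg)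
qed

lemma L2_set_le_ell2_norm:
  assumes "(\<lambda>i. (cmod (\<psi> i))\<^sup>2) summable_on S" "finite F" "F \<subseteq> S"
  shows "L2_set (\<lambda>i. cmod (\<psi> i)) F \<le> ell2_norm S \<psi>"
  unfolding L2_set_def ell2_norm_def using assms by (intro real_sqrt_le_mono finite_sum_le_infsum) auto

lemma vbound_ell2:
  assumes "\<psi> \<in> ell2_set S"
  shows "vbound (ell2_norm S \<psi>) \<psi>"
  unfolding vbound_def
proof (intro allI impI)
  fix J :: "'b set" assume J: "finite J"
  have "L2_set (\<lambda>i. cmod (\<psi> i)) J = L2_set (\<lambda>i. cmod (\<psi> i)) (J \<inter> S)"
    unfolding L2_set_def using J assms
    by (intro arg_cong[where f = sqrt] sum.mono_neutral_right) (auto simp: ell2_set_def)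
  also have "\<dots> \<le> ell2_norm S \<psi>" using assms J by (intro L2_set_le_ell2_norm) (auto simp: ell2_set_def)
  finally show "L2_set (\<lambda>i. cmod (\<psi> i)) J \<le> ell2_norm S \<psi>" .
qed

lemma gpi_bounded:
  assumes C: "opbound C (mat f)" and z: "z \<in> topspace X" and \<psi>: "\<psi> \<in> ell2_set (gsource_fibre G (z, 0, z))"
  shows "(\<lambda>\<gamma>. (cmod (gpi G (z, 0, z) f \<psi> \<gamma>))\<^sup>2) summable_on gsource_fibre G (z, 0, z)"
    and "ell2_norm (gsource_fibre G (z, 0, z)) (gpi G (z, 0, z) f \<psi>)
      \<le> C * ell2_norm (gsource_fibre G (z, 0, z)) \<psi>"
proof -
  let ?S = "gsource_fibre G (z, 0, z)"
  have v: "vbound (C * ell2_norm ?S \<psi>) (mvec (mat f) \<psi>)"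
    by (rule vbound_mvec[OF C vbound_ell2[OF \<psi>]])
  have *: "L2_set (\<lambda>i. cmod (gpi G (z, 0, z) f \<psi> i)) F \<le> C * ell2_norm ?S \<psi>" if "finite F" "F \<subseteq> ?S" for F
  proof -
    have "L2_set (\<lambda>i. cmod (gpi G (z, 0, z) f \<psi> i)) F = L2_set (\<lambda>i. cmod (mvec (mat f) \<psi> i)) F"
      using that \<psi> gpi_eq_mvec[OF z, of \<psi> _ f] by (intro L2_set_cong) (auto simp: ell2_set_def subset_iff)
    then show ?thesis using v that by (simp add: vbound_def)
  qed
  show "(\<lambda>\<gamma>. (cmod (gpi G (z, 0, z) f \<psi> \<gamma>))\<^sup>2) summable_on ?S"
    "ell2_norm ?S (gpi G (z, 0, z) f \<psi>) \<le> C * ell2_norm ?S \<psi>"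
    using ell2_norm_le[OF *] vbound_nonneg[OF v] by blast+
qed

lemma gpi_norm_le:
  assumes C: "opbound C (mat f)" and z: "z \<in> topspace X"
  shows "gpi_norm G (z, 0, z) f \<le> C"
    and "\<lbrakk>\<psi> \<in> ell2_set (gsource_fibre G (z, 0, z)); ell2_norm (gsource_fibre G (z, 0, z)) \<psi> \<le> 1\<rbrakk>
      \<Longrightarrow> ell2_norm (gsource_fibre G (z, 0, z)) (gpi G (z, 0, z) f \<psi>) \<le> gpi_norm G (z, 0, z) f"
proof -
  let ?S = "gsource_fibre G (z, 0, z)"
  let ?N = "{ell2_norm ?S (gpi G (z, 0, z) f \<psi>) | \<psi>. \<psi> \<in> ell2_set ?S \<and> ell2_norm ?S \<psi> \<le> 1}"
  have le: "r \<le> C" if r: "r \<in> ?N" for r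
  proof -
    obtain \<psi> where "r = ell2_norm ?S (gpi G (z, 0, z) f \<psi>)" "\<psi> \<in> ell2_set ?S" "ell2_norm ?S \<psi> \<le> 1"
      using r by blast
    then have "r \<le> C * ell2_norm ?S \<psi>" "ell2_norm ?S \<psi> \<le> 1" using gpi_bounded(2)[OF C z] by auto
    then show "r \<le> C" using opbound_nonneg[OF C] mult_left_mono[of "ell2_norm ?S \<psi>" 1 C] by simp
  qed
  have "(\<lambda>_. 0) \<in> ell2_set ?S" "ell2_norm ?S (\<lambda>_. 0) \<le> 1" by (simp_all add: ell2_set_def ell2_norm_def)
  then have "?N \<noteq> {}" by blast
  then show "gpi_norm G (z, 0, z) f \<le> C" unfolding gpi_norm_def using le by (rule cSup_least)
  show "ell2_norm ?S (gpi G (z, 0, z) f \<psi>) \<le> gpi_norm G (z, 0, z) f"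
    if "\<psi> \<in> ell2_set ?S" "ell2_norm ?S \<psi> \<le> 1"
    unfolding gpi_norm_def using that le by (intro cSup_upper) (auto intro!: bdd_aboveI[of _ C])
qed

lemma
  assumes C: "opbound C (mat f)"
  shows reduced_norm_le: "reduced_norm G f \<le> C"
    and gpi_norm_le_reduced_norm: "z \<in> topspace X \<Longrightarrow> gpi_norm G (z, 0, z) f \<le> reduced_norm G f"
    and reduced_norm_nonneg: "0 \<le> reduced_norm G f"
proof -
  let ?N = "insert 0 ((\<lambda>x. gpi_norm G x f) ` gunits G)"
  have le: "r \<le> C" if "r \<in> ?N" for r
    using that gpi_norm_le(1)[OF C] opbound_nonneg[OF C] by (auto simp: gunits_Gam)
  then have bdd: "bdd_above ?N" by (rule bdd_aboveI)
  show "reduced_norm G f \<le> C" unfolding reduced_norm_def by (rule cSup_least) (use le in auto)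
  show "gpi_norm G (z, 0, z) f \<le> reduced_norm G f" if "z \<in> topspace X"
    unfolding reduced_norm_def using that by (intro cSup_upper bdd) (auto simp: gunits_Gam)
  show "0 \<le> reduced_norm G f" unfolding reduced_norm_def by (intro cSup_upper bdd) auto
qed

text \<open>The matrix is block diagonal along the source map, and its block at \<open>z\<close> is
  the operator whose norm is \<open>gpi_norm\<close> at that unit.\<close>

lemma opbound_reduced_norm:
  assumes C: "opbound C (mat f)"
  shows "opbound (reduced_norm G f) (mat f)"
proof (rule opbound_blocks[where p = "\<lambda>\<gamma>. snd (snd \<gamma>)"])
  show "0 \<le> reduced_norm G f" by (rule reduced_norm_nonneg[OF C])
  show "snd (snd i) = snd (snd j)" if "mat f i j \<noteq> 0" for i j using that by (auto simp: mat_def split: if_splits)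
  fix z and I J :: "('a \<times> int \<times> 'a) set" and \<xi> :: "'a \<times> int \<times> 'a \<Rightarrow> complex"
  assume fin: "finite I" "finite J"
    and I: "\<And>i. i \<in> I \<Longrightarrow> snd (snd i) = z" and J: "\<And>j. j \<in> J \<Longrightarrow> snd (snd j) = z"
  let ?L = "L2_set (\<lambda>i. cmod (\<Sum>j\<in>J. mat f i j * \<xi> j)) I" and ?X = "L2_set (\<lambda>j. cmod (\<xi> j)) J"
  show "?L \<le> reduced_norm G f * ?X"
  \<comment> \<open>Over points outside the space the matrix vanishes, and a zero vector cannot be
    normalised; in both cases the left-hand side is 0.\<close>
  proof (cases "z \<in> topspace X \<and> ?X \<noteq> 0")
    case False
    have "?L = 0"
    proof (cases "z \<in> topspace X")
      case True
      with False have "?X = 0" by simp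
      with opbound_apply[OF C fin, of \<xi>] show ?thesis by (simp add: antisym)
    next
      case False
      then have "j \<notin> Gam_carrier X \<phi>" if "j \<in> J" for j
        using J[OF that] carrier_topspace(2) by (cases j) auto
      then have "mat f i j = 0" if "j \<in> J" for i j using that by (simp add: mat_def)
      then show ?thesis by (simp add: L2_set_0')
    qed
    then show ?thesis using reduced_norm_nonneg[OF C] by simp
  next
    case True
    then have z: "z \<in> topspace X" and X: "0 < ?X" by (auto simp: less_le)
    let ?S = "gsource_fibre G (z, 0, z)"
    let ?J = "J \<inter> Gam_carrier X \<phi>" and ?I = "I \<inter> Gam_carrier X \<phi>"
    \<comment> \<open>\<open>gpi_norm\<close> is a supremum over the unit ball of the fibre, so
      \<xi> is cut to groupoid elements and divided by its norm.\<close>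
    define \<psi> where "\<psi> j = (if j \<in> ?J then \<xi> j / of_real ?X else 0)" for j
    have S: "?J \<subseteq> ?S" "?I \<subseteq> ?S" using I J by (auto simp: fibre_Gam)
    have \<psi>v: "vbound 1 \<psi>"
    proof -
      have "vbound (L2_set (\<lambda>j. cmod (\<xi> j / of_real ?X)) ?J) \<psi>"
        unfolding \<psi>_def using fin(2) by (intro vbound_finite_support) auto
      moreover have "L2_set (\<lambda>j. cmod (\<xi> j / of_real ?X)) ?J = L2_set (\<lambda>j. cmod (\<xi> j)) ?J / ?X"
        using L2_set_cmod_mult[of "1 / of_real ?X" \<xi> ?J] by (simp add: norm_divide)
      moreover have "L2_set (\<lambda>j. cmod (\<xi> j)) ?J / ?X \<le> 1"
        using X L2_set_subset_mono[OF fin(2), of ?J] by simp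
      ultimately show ?thesis by (simp add: vbound_mono)
    qed
    have \<psi>: "\<psi> \<in> ell2_set ?S" "ell2_norm ?S \<psi> \<le> 1"
      using ell2_norm_le[of ?S \<psi> 1] \<psi>v S(1) by (auto simp: ell2_set_def vbound_def \<psi>_def subset_iff)
    have eq: "gpi G (z, 0, z) f \<psi> i = (\<Sum>j\<in>J. mat f i j * \<xi> j) / of_real ?X" if "i \<in> ?I" for i
    proof -
      have "gpi G (z, 0, z) f \<psi> i = mvec (mat f) \<psi> i"
        using that S \<psi>(1) by (intro gpi_eq_mvec[OF z]) (auto simp: ell2_set_def)
      also have "\<dots> = (\<Sum>j\<in>?J. mat f i j * (\<xi> j / of_real ?X))"
        unfolding \<psi>_def[abs_def] using fin(2) by (intro mvec_finite_support) auto
      also have "\<dots> = (\<Sum>j\<in>J. mat f i j * (\<xi> j / of_real ?X))"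
        using fin(2) by (intro sum.mono_neutral_left) (auto simp: mat_def)
      finally show ?thesis by (simp add: sum_divide_distrib)
    qed
    have "?L = L2_set (\<lambda>i. cmod (\<Sum>j\<in>J. mat f i j * \<xi> j)) ?I"
      unfolding L2_set_def using fin(1)
      by (intro arg_cong[where f = sqrt] sum.mono_neutral_right) (auto simp: mat_def)
    also have "\<dots> = L2_set (\<lambda>i. cmod (of_real ?X * gpi G (z, 0, z) f \<psi> i)) ?I"
      using X by (intro L2_set_cong refl) (simp add: eq)
    also have "\<dots> = ?X * L2_set (\<lambda>i. cmod (gpi G (z, 0, z) f \<psi> i)) ?I"
      by (simp add: L2_set_cmod_mult)
    also have "L2_set (\<lambda>i. cmod (gpi G (z, 0, z) f \<psi> i)) ?I \<le> ell2_norm ?S (gpi G (z, 0, z) f \<psi>)"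
      using fin(1) S(2) by (intro L2_set_le_ell2_norm gpi_bounded(1)[OF C z \<psi>(1)]) auto
    also have "\<dots> \<le> gpi_norm G (z, 0, z) f" by (rule gpi_norm_le(2)[OF C z \<psi>])
    also have "\<dots> \<le> reduced_norm G f" by (rule gpi_norm_le_reduced_norm[OF C z])
    finally show ?thesis using X by (simp add: mult.commute)
  qed
qed

lemma opnorm_mat:
  assumes "opbound C (mat f)"
  shows "opnorm (mat f) = reduced_norm G f"
  using opnorm_le[OF opbound_reduced_norm[OF assms]] reduced_norm_le[OF opbound_opnorm[OF assms]] by simp

lemma Bc_add:
  assumes "f \<in> Bc_set G" "g \<in> Bc_set G"
  shows "(\<lambda>\<gamma>. f \<gamma> + g \<gamma>) \<in> Bc_set G"
proof -
  obtain n m where n: "\<And>\<gamma>. f \<gamma> \<noteq> 0 \<Longrightarrow> \<gamma> \<in> Gam_ball n" and m: "\<And>\<gamma>. g \<gamma> \<noteq> 0 \<Longrightarrow> \<gamma> \<in> Gam_ball m"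
    using assms by (auto simp: Bc_iff)
  have "\<gamma> \<in> Gam_ball (max n m)" if "f \<gamma> + g \<gamma> \<noteq> 0" for \<gamma>
    using that n m ball_mono[of n "max n m"] ball_mono[of m "max n m"] by (metis add_0 max.cobounded1 max.cobounded2 subsetD)
  moreover have "bounded (range (\<lambda>\<gamma>. f \<gamma> + g \<gamma>))"
    using assms by (intro bounded_plus_comp) (auto simp: Bc_iff)
  ultimately show ?thesis by (auto simp: Bc_iff)
qed

lemma Bc_scale: "f \<in> Bc_set G \<Longrightarrow> (\<lambda>\<gamma>. c * f \<gamma>) \<in> Bc_set G"
proof -
  assume f: "f \<in> Bc_set G"
  then obtain b where "\<And>\<gamma>. cmod (f \<gamma>) \<le> b" unfolding Bc_iff bounded_iff by blast
  then have "cmod (c * f \<gamma>) \<le> cmod c * b" for \<gamma> by (simp add: norm_mult mult_left_mono)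
  then have "bounded (range (\<lambda>\<gamma>. c * f \<gamma>))" unfolding bounded_iff by blast
  with f show ?thesis by (auto simp: Bc_iff)
qed

lemma gconv_support:
  assumes "gconv G f g (x, k, z) \<noteq> 0"
  obtains y l where "f (x, k - l, y) \<noteq> 0" "g (y, l, z) \<noteq> 0"
    "(x, k - l, y) \<in> Gam_carrier X \<phi>" "(y, l, z) \<in> Gam_carrier X \<phi>"
proof -
  have "\<exists>q\<in>gfactor G (x, k, z). (case q of (\<gamma>1, \<gamma>2) \<Rightarrow> f \<gamma>1 * g \<gamma>2) \<noteq> 0"
    using assms unfolding gconv_def by (metis (no_types, lifting) infsum_0)
  then obtain \<gamma>1 \<gamma>2 where q: "(\<gamma>1, \<gamma>2) \<in> gfactor G (x, k, z)" "f \<gamma>1 \<noteq> 0" "g \<gamma>2 \<noteq> 0" by auto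
  then obtain y l where "\<gamma>1 = (x, k - l, y)" "\<gamma>2 = (y, l, z)" "\<gamma>1 \<in> Gam_carrier X \<phi>" "\<gamma>2 \<in> Gam_carrier X \<phi>"
    by (auto simp: gfactor_Gam)
  with q(2,3) show ?thesis using that by blast
qed

text \<open>Supports multiply into a larger ball. Boundedness is read off the matrix, since each
  value of the convolution on the groupoid is an entry in the column of a unit.\<close>

lemma Bc_gconv:
  assumes f: "f \<in> Bc_set G" and g: "g \<in> Bc_set G"
  shows "gconv G f g \<in> Bc_set G"
proof -
  obtain n m where n: "\<And>\<gamma>. f \<gamma> \<noteq> 0 \<Longrightarrow> \<gamma> \<in> Gam_ball n" and m: "\<And>\<gamma>. g \<gamma> \<noteq> 0 \<Longrightarrow> \<gamma> \<in> Gam_ball m"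
    using assms by (auto simp: Bc_iff)
  have ball: "(x, k, z) \<in> Gam_ball (n + m)" if nz: "gconv G f g (x, k, z) \<noteq> 0" for x k z
  proof -
    obtain y l where "f (x, k - l, y) \<noteq> 0" "g (y, l, z) \<noteq> 0" using nz by (rule gconv_support)
    then show ?thesis using ball_mult[OF n m, of x "k - l" y l z] by simp
  qed
  obtain C D where "opbound C (mat f)" "opbound D (mat g)" using opbound_mat f g by blast
  then have C: "opbound (C * D) (mat (gconv G f g))" unfolding mat_gconv by (rule opbound_mmult)
  have "cmod (gconv G f g (x, k, z)) \<le> C * D" for x k z
  proof (cases "gconv G f g (x, k, z) = 0")
    case False
    then have "(x, k, z) \<in> Gam_carrier X \<phi>" using ball ball_carrier by blast
    then show ?thesis using opbound_entry[OF C, of "(x, k, z)" "(z, 0, z)"] by (simp add: mat_unit)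
  qed (use opbound_nonneg[OF C] in simp)
  then have "bounded (range (gconv G f g))" unfolding bounded_iff by auto
  then show ?thesis using ball by (auto simp: Bc_iff)
qed

lemma Bc_ginvolution:
  assumes f: "f \<in> Bc_set G"
  shows "ginvolution G f \<in> Bc_set G"
proof -
  obtain n where n: "\<And>\<gamma>. f \<gamma> \<noteq> 0 \<Longrightarrow> \<gamma> \<in> Gam_ball n" using f by (auto simp: Bc_iff)
  have "(x, k, z) \<in> Gam_ball (2 * n)" if "ginvolution G f (x, k, z) \<noteq> 0" for x k z
    using ball_inverse[OF n, of z "- k" x] that by (auto simp: ginvolution_def split: if_splits)
  moreover obtain B where B: "\<And>\<gamma>. cmod (f \<gamma>) \<le> B" using f unfolding Bc_iff bounded_iff by blast
  have "cmod (ginvolution G f \<gamma>) \<le> \<bar>B\<bar>" for \<gamma>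
    using order_trans[OF B abs_ge_self, of "ginv G \<gamma>"] by (simp add: ginvolution_def)
  then have "bounded (range (ginvolution G f))" unfolding bounded_iff by auto
  ultimately show ?thesis by (auto simp: Bc_iff)
qed

lemma isometric_hom_mat: "isometric_hom Bmat (Bc_alg G) mat"
proof -
  interpret cstar_algebra "Bmat :: ('a \<times> int \<times> 'a) cmat star_alg" by (rule cstar_algebra_Bmat)
  have zero: "(\<lambda>_. 0) \<in> Bc_set G" by (simp add: Bc_iff)
  show ?thesis
    by unfold_locales
       (auto simp: Bc_alg_def opbound_mat zero Bc_add Bc_scale Bc_gconv Bc_ginvolution mat_gconv mat_ginvolution
         opnorm_mat mat_def fun_eq_iff dest!: opbound_mat)
qed

end


section \<open>Subalgebras of the bounded matrices\<close>

lemma opbound_diag: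
  assumes h: "\<And>i. cmod (h i) \<le> c" and "0 \<le> c"
  shows "opbound c (\<lambda>i j. if i = j then h i else 0)"
proof -
  have "opbound (real 1 * c) (\<lambda>i j. if i = j then h i else 0)"
  proof (rule opbound_sparse[OF \<open>0 \<le> c\<close>])
    show "cmod (if i = j then h i else 0) \<le> c" for i j using h \<open>0 \<le> c\<close> by simp
    have "{j. (if i = j then h i else 0) \<noteq> 0} \<subseteq> {i}" "{j. (if j = i then h j else 0) \<noteq> 0} \<subseteq> {i}" for i
      by (auto split: if_splits)
    then show "finite {j. (if i = j then h i else 0) \<noteq> 0} \<and> card {j. (if i = j then h i else 0) \<noteq> 0} \<le> 1"
      "finite {j. (if j = i then h j else 0) \<noteq> 0} \<and> card {j. (if j = i then h j else 0) \<noteq> 0} \<le> 1" for i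
      using card_mono[of "{i}"] finite_subset[of _ "{i}"] by force+
  qed
  then show ?thesis by simp
qed

lemma mmult_diag_left: "mmult (\<lambda>i j. if i = j then h i else 0) M = (\<lambda>i j. h i * M i j)"
proof (intro ext)
  fix i k
  have "mmult (\<lambda>i j. if i = j then h i else 0) M i k = (\<Sum>\<^sub>\<infinity>j\<in>{i}. h i * M i k)"
    unfolding mmult_def by (rule infsum_cong_neutral) auto
  then show "mmult (\<lambda>i j. if i = j then h i else 0) M i k = h i * M i k" by simp
qed

lemma mmult_diag_right: "mmult M (\<lambda>i j. if i = j then h i else 0) = (\<lambda>i j. M i j * h j)"
proof (intro ext)
  fix i k
  have "mmult M (\<lambda>i j. if i = j then h i else 0) i k = (\<Sum>\<^sub>\<infinity>j\<in>{k}. M i k * h k)"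
    unfolding mmult_def by (rule infsum_cong_neutral) auto
  then show "mmult M (\<lambda>i j. if i = j then h i else 0) i k = M i k * h k" by simp
qed

text \<open>Let \<open>q\<close> be the image of \<xi> under \<open>M* M\<close> and
  \<open>W\<close> the squared norm of \<open>M \<xi>\<close>. The inner product of \<xi> with
  \<open>q\<close> is \<open>W\<close>, and the squared norm of \<open>q\<close> is at most
  \<open>W\<close>; expanding the square of \<open>\<xi> - q\<close> leaves at most the squared norm
  of \<xi> minus \<open>W\<close>.\<close>

lemma opbound_id_minus:
  assumes M: "opbound 1 M"
  shows "opbound 1 (\<lambda>i j. (if i = j then 1 else 0) - mmult (madj M) M i j)"
  unfolding opbound_def
proof (intro conjI allI impI)
  fix I J :: "'a set" and \<xi> :: "'a \<Rightarrow> complex"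
  assume fin: "finite I" "finite J"
  define w where "w i = (\<Sum>j\<in>J. M i j * \<xi> j)" for i
  define q where "q = mvec (madj M) w"
  define \<eta> where "\<eta> i = (if i \<in> J then \<xi> i else 0)" for i
  define W where "W = (\<Sum>\<^sub>\<infinity>i. (cmod (w i))\<^sup>2)"
  note sq = infsum_square_apply[OF M fin(2), of \<xi>, folded w_def]
  have W0: "0 \<le> W" unfolding W_def by (intro infsum_nonneg) auto
  have "vbound (sqrt W) w"
    unfolding vbound_def
  proof (intro allI impI)
    fix K :: "'a set" assume "finite K"
    then show "L2_set (\<lambda>i. cmod (w i)) K \<le> sqrt W"
      unfolding L2_set_def W_def by (intro real_sqrt_le_mono finite_sum_le_infsum sq(1)) auto
  qed
  from vbound_mvec[OF opbound_madj[OF M] this] have q: "vbound (sqrt W) q" by (simp add: q_def)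
  \<comment> \<open>The expansion of the square needs an index set containing \<open>J\<close>, so
    that the inner product over it is the full one.\<close>
  let ?K = "I \<union> J" and ?X = "L2_set (\<lambda>j. cmod (\<xi> j)) J"
  have K: "finite ?K" using fin by simp
  have eq: "(\<Sum>j\<in>J. ((if i = j then 1 else 0) - mmult (madj M) M i j) * \<xi> j) = \<eta> i - q i" for i
  proof -
    have "(\<Sum>j\<in>J. (if i = j then 1 else 0) * \<xi> j) = \<eta> i"
      using fin(2) by (simp add: \<eta>_def if_distrib[of "\<lambda>x. x * _"] sum.delta cong: if_cong)
    then show ?thesis
      by (simp add: left_diff_distrib sum_subtractf sum_mmult[OF opbound_madj[OF M] M fin(2)] q_def w_def[abs_def])
  qed
  have "(L2_set (\<lambda>i. cmod (\<eta> i - q i)) ?K)\<^sup>2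
      = (\<Sum>i\<in>?K. (cmod (\<eta> i))\<^sup>2) + (\<Sum>i\<in>?K. (cmod (q i))\<^sup>2) - 2 * Re (\<Sum>i\<in>?K. cnj (\<eta> i) * q i)"
  proof -
    have "(cmod (a - b))\<^sup>2 = (cmod a)\<^sup>2 + (cmod b)\<^sup>2 - 2 * Re (cnj a * b)" for a b
      unfolding cmod_power2 by (simp add: power2_eq_square algebra_simps)
    then show ?thesis by (simp add: L2_set_square sum.distrib sum_subtractf sum_distrib_left)
  qed
  also have "(\<Sum>i\<in>?K. (cmod (\<eta> i))\<^sup>2) = ?X\<^sup>2"
    unfolding L2_set_square \<eta>_def using K by (intro sum.mono_neutral_cong_right) auto
  also have "(\<Sum>i\<in>?K. cnj (\<eta> i) * q i) = (\<Sum>j\<in>J. cnj (\<xi> j) * q j)"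
    unfolding \<eta>_def using K by (intro sum.mono_neutral_cong_right) auto
  also have "\<dots> = complex_of_real W" using sq(2) by (simp add: W_def q_def)
  also have "(\<Sum>i\<in>?K. (cmod (q i))\<^sup>2) \<le> W"
  proof -
    have "(\<Sum>i\<in>?K. (cmod (q i))\<^sup>2) \<le> (sqrt W)\<^sup>2"
      unfolding L2_set_square[symmetric] using q K by (intro power_mono) (auto simp: vbound_def)
    then show ?thesis using W0 by simp
  qed
  finally have "(L2_set (\<lambda>i. cmod (\<eta> i - q i)) ?K)\<^sup>2 \<le> ?X\<^sup>2 - W" by simp
  also have "\<dots> \<le> ?X\<^sup>2" using W0 by simp
  finally have "(L2_set (\<lambda>i. cmod (\<eta> i - q i)) ?K)\<^sup>2 \<le> ?X\<^sup>2" .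
  then have "L2_set (\<lambda>i. cmod (\<eta> i - q i)) ?K \<le> ?X" by (rule power2_le_imp_le) simp
  then show "L2_set (\<lambda>i. cmod (\<Sum>j\<in>J. ((if i = j then 1 else 0) - mmult (madj M) M i j) * \<xi> j)) I \<le> 1 * ?X"
    unfolding eq using L2_set_subset_mono[OF K, of I "\<lambda>i. cmod (\<eta> i - q i)"] by simp
qed simp

text \<open>The diagonal entry is the squared norm of column \<open>j\<close>, a sum of non-negative
  terms.\<close>

lemma mmult_madj_diag_eq_0:
  assumes M: "opbound C M" and "mmult (madj M) M j j = 0"
  shows "M i j = 0"
proof -
  have v: "vbound C (\<lambda>i. M i j)" by (rule opbound_column[OF M])
  then have "vbound C (\<lambda>i. cnj (M i j))" by (simp add: vbound_def)
  from abs_summable_summable[OF vbound_mult(1)[OF this v]]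
  have sm: "(\<lambda>i. cnj (M i j) * M i j) summable_on UNIV" .
  have nn: "0 \<le> cnj (M i j) * M i j" for i
    by (simp add: mult.commute[of "cnj _"] complex_norm_square[symmetric] less_eq_complex_def)
  have "(\<Sum>\<^sub>\<infinity>i. cnj (M i j) * M i j) = 0" using assms(2) by (simp add: mmult_def madj_def)
  then have "cnj (M i j) * M i j = 0"
    using nonneg_infsum_le_0D_complex[OF _ sm nn] by simp
  then show ?thesis by simp
qed

lemma opbound_uminus: "opbound C M \<Longrightarrow> opbound C (\<lambda>i j. - M i j)"
  using opbound_scale[of C M "-1"] by simp

lemma opnorm_diff_commute: "opnorm (\<lambda>i j. M i j - N i j) = opnorm (\<lambda>i j. N i j - M i j)"
proof -
  have "opbound C (\<lambda>i j. M i j - N i j) \<longleftrightarrow> opbound C (\<lambda>i j. N i j - M i j)" for C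
    using opbound_uminus[of C "\<lambda>i j. M i j - N i j"] opbound_uminus[of C "\<lambda>i j. N i j - M i j"] by auto
  then show ?thesis by (simp add: opnorm_def)
qed

lemma entry_tendsto:
  assumes u: "\<And>n. \<exists>C. opbound C (u n)" and M: "opbound D M" and lim: "(\<lambda>n. opnorm (\<lambda>i j. u n i j - M i j)) \<longlonglongrightarrow> 0"
  shows "(\<lambda>n. u n i j) \<longlonglongrightarrow> M i j"
proof -
  have "cmod (u n i j - M i j) \<le> opnorm (\<lambda>i j. u n i j - M i j)" for n
  proof -
    obtain C where "opbound C (u n)" using u by blast
    from opnorm_entry[OF opbound_diff[OF this M]] show ?thesis .
  qed
  then have "(\<lambda>n. u n i j - M i j) \<longlonglongrightarrow> 0" by (intro Lim_null_comparison[OF _ lim]) auto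
  then show ?thesis by (rule LIM_zero_cancel)
qed

locale matrix_algebra =
  fixes E :: "'i cmat set"
  assumes sub: "cstar_subalgebra Bmat E"
begin

lemma bounded: "M \<in> E \<Longrightarrow> \<exists>C. opbound C M"
  using sub by (auto simp: cstar_subalgebra_def)

lemma zero: "(\<lambda>_ _. 0) \<in> E"
  using sub by (simp add: cstar_subalgebra_def)

lemma add: "M \<in> E \<Longrightarrow> N \<in> E \<Longrightarrow> (\<lambda>i j. M i j + N i j) \<in> E"
  using sub by (simp add: cstar_subalgebra_def)

lemma mult: "M \<in> E \<Longrightarrow> N \<in> E \<Longrightarrow> mmult M N \<in> E"
  using sub by (simp add: cstar_subalgebra_def)

lemma scale: "M \<in> E \<Longrightarrow> (\<lambda>i j. c * M i j) \<in> E"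
  using sub by (simp add: cstar_subalgebra_def)

lemma star: "M \<in> E \<Longrightarrow> madj M \<in> E"
  using sub by (simp add: cstar_subalgebra_def)

lemma diff: "M \<in> E \<Longrightarrow> N \<in> E \<Longrightarrow> (\<lambda>i j. M i j - N i j) \<in> E"
  using add[of M "\<lambda>i j. (-1) * N i j"] scale[of N "-1"] by simp

lemma sum: "finite T \<Longrightarrow> (\<And>t. t \<in> T \<Longrightarrow> M t \<in> E) \<Longrightarrow> (\<lambda>i j. \<Sum>t\<in>T. M t i j) \<in> E"
  by (induction T rule: finite_induct) (auto simp: zero add)

lemma limit:
  assumes "\<And>n. u n \<in> E" "opbound C M" "(\<lambda>n. opnorm (\<lambda>i j. u n i j - M i j)) \<longlonglongrightarrow> 0"
  shows "M \<in> E"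
  using cstar_subalgebra_limit[OF sub, of u M] assms by auto

end

text \<open>The iteration \<open>y \<mapsto> (t + y\<^sup>2) / 2\<close> is dominated by the real one started at \<open>0\<close> with
  \<open>t = 1\<close>, hence converges; \<open>1 - y\<close> is then a square root of \<open>1 - t\<close>.\<close>

primrec sqrt_iter :: "nat \<Rightarrow> real" where
  "sqrt_iter 0 = 0"
| "sqrt_iter (Suc n) = (1 + (sqrt_iter n)\<^sup>2) / 2"

lemma sqrt_iter_bounds: "0 \<le> sqrt_iter n \<and> sqrt_iter n \<le> 1"
  by (induction n) (auto simp: power_le_one)

lemma sqrt_iter_incseq: "incseq sqrt_iter"
proof (rule incseq_SucI)
  fix n
  have "0 \<le> (1 - sqrt_iter n)\<^sup>2" by simp
  then show "sqrt_iter n \<le> sqrt_iter (Suc n)" by (simp add: power2_eq_square algebra_simps)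
qed

primrec mat_sqrt_iter :: "'i cmat \<Rightarrow> nat \<Rightarrow> 'i cmat" where
  "mat_sqrt_iter t 0 = (\<lambda>_ _. 0)"
| "mat_sqrt_iter t (Suc n) = (\<lambda>i j. (1/2) * (t i j + mmult (mat_sqrt_iter t n) (mat_sqrt_iter t n) i j))"

context
  fixes t :: "'i cmat"
  assumes t: "opbound 1 t" "madj t = t"
begin

lemma mat_sqrt_iter_opbound: "opbound (sqrt_iter n) (mat_sqrt_iter t n)"
proof (induction n)
  case (Suc n)
  have "opbound (cmod (1/2) * (1 + sqrt_iter n * sqrt_iter n)) (mat_sqrt_iter t (Suc n))"
    by (simp only: mat_sqrt_iter.simps) (intro opbound_scale opbound_add t opbound_mmult Suc)
  then show ?case by (simp add: power2_eq_square)
qed (simp add: opbound_zero)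

lemma mat_sqrt_iter_madj: "madj (mat_sqrt_iter t n) = mat_sqrt_iter t n"
proof (induction n)
  case (Suc n)
  have "cnj (t j i) = t i j" for i j using t(2) by (metis madj_def)
  moreover have "cnj (mmult (mat_sqrt_iter t n) (mat_sqrt_iter t n) j i)
      = mmult (mat_sqrt_iter t n) (mat_sqrt_iter t n) i j" for i j
    using madj_mmult[of "mat_sqrt_iter t n" "mat_sqrt_iter t n"] Suc by (metis madj_def)
  ultimately show ?case by (simp add: madj_def fun_eq_iff)
qed (simp add: madj_def fun_eq_iff)

lemma mat_sqrt_iter_commute: "mmult t (mat_sqrt_iter t n) = mmult (mat_sqrt_iter t n) t"
proof (induction n)
  case (Suc n)
  let ?y = "mat_sqrt_iter t n"
  note y = mat_sqrt_iter_opbound[of n]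
  note yy = opbound_mmult[OF y y]
  have "mmult t (mmult ?y ?y) = mmult (mmult ?y ?y) t"
    using Suc mmult_assoc[OF t(1) y y] mmult_assoc[OF y t(1) y] mmult_assoc[OF y y t(1)] by simp
  then show ?case
    by (simp only: mat_sqrt_iter.simps mmult_scale_right[OF t(1) opbound_add[OF t(1) yy]]
        mmult_scale_left[OF opbound_add[OF t(1) yy] t(1)] mmult_add_right[OF t(1) t(1) yy]
        mmult_add_left[OF t(1) yy t(1)])
qed (simp add: mmult_def)

text \<open>All iterates are polynomials in \<open>t\<close>. Commutation is what allows a
  difference of squares to be factored in the next estimate.\<close>

lemma mat_sqrt_iter_commute2:
  "mmult (mat_sqrt_iter t m) (mat_sqrt_iter t n) = mmult (mat_sqrt_iter t n) (mat_sqrt_iter t m)"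
proof (induction n)
  case (Suc n)
  let ?y = "mat_sqrt_iter t n" and ?z = "mat_sqrt_iter t m"
  note y = mat_sqrt_iter_opbound[of n] and z = mat_sqrt_iter_opbound[of m]
  note yy = opbound_mmult[OF y y]
  have "mmult ?z (mmult ?y ?y) = mmult (mmult ?y ?y) ?z"
    using Suc mmult_assoc[OF z y y] mmult_assoc[OF y z y] mmult_assoc[OF y y z] by simp
  then show ?case
    by (simp only: mat_sqrt_iter.simps mmult_scale_right[OF z opbound_add[OF t(1) yy]]
        mmult_scale_left[OF opbound_add[OF t(1) yy] z] mmult_add_right[OF z t(1) yy]
        mmult_add_left[OF t(1) yy z] mat_sqrt_iter_commute)
qed (simp add: mmult_def)

text \<open>With successive iterates \<open>y\<close> and \<open>z\<close>, the next difference is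
  half of \<open>z^2 - y^2 = (z - y) (z + y)\<close>. The scalar iteration satisfies the same
  recursion with equality, so its increments dominate.\<close>

lemma mat_sqrt_iter_step:
  "opbound (sqrt_iter (Suc n) - sqrt_iter n) (\<lambda>i j. mat_sqrt_iter t (Suc n) i j - mat_sqrt_iter t n i j)"
proof (induction n)
  case 0
  have "opbound (cmod (1/2) * 1) (\<lambda>i j. (1/2) * t i j)" by (intro opbound_scale t)
  then show ?case by (simp add: mmult_def)
next
  case (Suc n)
  let ?y = "mat_sqrt_iter t n" and ?z = "mat_sqrt_iter t (Suc n)"
  let ?d = "\<lambda>i j. ?z i j - ?y i j" and ?s = "\<lambda>i j. ?z i j + ?y i j"
  note y = mat_sqrt_iter_opbound[of n] and z = mat_sqrt_iter_opbound[of "Suc n"]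
  have s: "opbound (sqrt_iter (Suc n) + sqrt_iter n) ?s" by (rule opbound_add[OF z y])
  have "mmult ?d ?s = (\<lambda>i j. mmult ?z ?z i j - mmult ?y ?y i j)"
  proof -
    have m: "opbound (cmod (-1) * sqrt_iter n) (\<lambda>i j. (-1) * ?y i j)" by (rule opbound_scale[OF y])
    have "mmult ?d ?s = mmult (\<lambda>i j. ?z i j + (-1) * ?y i j) ?s" by simp
    also have "\<dots> = (\<lambda>i j. mmult ?z ?s i j + mmult (\<lambda>i j. (-1) * ?y i j) ?s i j)"
      by (rule mmult_add_left[OF z m s])
    also have "\<dots> = (\<lambda>i j. mmult ?z ?s i j - mmult ?y ?s i j)"
      by (simp only: mmult_scale_left[OF y s]) simp
    also have "\<dots> = (\<lambda>i j. mmult ?z ?z i j - mmult ?y ?y i j)"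
      unfolding mmult_add_right[OF z z y] mmult_add_right[OF y z y] mat_sqrt_iter_commute2[of n "Suc n"] by simp
    finally show ?thesis .
  qed
  then have *: "opbound ((sqrt_iter (Suc n) - sqrt_iter n) * (sqrt_iter (Suc n) + sqrt_iter n))
      (\<lambda>i j. mmult ?z ?z i j - mmult ?y ?y i j)"
    using opbound_mmult[OF Suc s] by simp
  have eq: "cmod (1/2) * ((p - q) * (p + q)) = (p\<^sup>2 - q\<^sup>2) / 2" for p q :: real
    by (simp add: power2_eq_square algebra_simps)
  have "opbound (((sqrt_iter (Suc n))\<^sup>2 - (sqrt_iter n)\<^sup>2) / 2)
      (\<lambda>i j. (1/2) * (mmult ?z ?z i j - mmult ?y ?y i j))"
    using opbound_scale[OF *, of "1/2"] unfolding eq .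
  moreover have "((sqrt_iter (Suc n))\<^sup>2 - (sqrt_iter n)\<^sup>2) / 2 = sqrt_iter (Suc (Suc n)) - sqrt_iter (Suc n)"
    by (simp only: sqrt_iter.simps(2)[of "Suc n"] sqrt_iter.simps(2)[of n]) (simp add: field_simps)
  moreover have "(\<lambda>i j. (1/2) * (mmult ?z ?z i j - mmult ?y ?y i j))
      = (\<lambda>i j. mat_sqrt_iter t (Suc (Suc n)) i j - ?z i j)"
    unfolding mat_sqrt_iter.simps(2)[of t "Suc n"] unfolding mat_sqrt_iter.simps(2)[of t n] by (simp add: algebra_simps)
  ultimately show ?case by (simp only:)
qed

lemma mat_sqrt_iter_diff:
  "opbound (sqrt_iter (n + k) - sqrt_iter n) (\<lambda>i j. mat_sqrt_iter t (n + k) i j - mat_sqrt_iter t n i j)"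
proof (induction k)
  case (Suc k)
  from opbound_add[OF mat_sqrt_iter_step[of "n + k"] Suc] show ?case
    by (simp del: sqrt_iter.simps mat_sqrt_iter.simps)
qed (simp add: opbound_zero)

end

text \<open>The unit \<open>u\<close> of the algebra stands for 1, since the identity matrix need
  not belong to \<open>E\<close>. The limit \<open>y\<close> of the iteration satisfies
  \<open>2 y = t + y^2\<close>, so the square of \<open>u - y\<close> is
  \<open>u - 2 y + y^2 = u - t\<close>.\<close>

lemma (in matrix_algebra) square_root:
  assumes u: "u \<in> E" "madj u = u" "\<And>M. M \<in> E \<Longrightarrow> mmult u M = M" "\<And>M. M \<in> E \<Longrightarrow> mmult M u = M"
    and t: "t \<in> E" "opbound 1 t" "madj t = t"
  obtains c where "c \<in> E" "madj c = c" "mmult c c = (\<lambda>i j. u i j - t i j)"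
proof -
  interpret B: cstar_algebra "Bmat :: 'i cmat star_alg" by (rule cstar_algebra_Bmat)
  let ?y = "mat_sqrt_iter t"
  have yE: "?y n \<in> E" for n
    by (induction n) (simp_all only: mat_sqrt_iter.simps zero scale add mult t(1))
  note yb = mat_sqrt_iter_opbound[OF t(2,3)]
  have "convergent sqrt_iter"
    using sqrt_iter_incseq sqrt_iter_bounds by (metis incseq_convergent convergentI)
  then have Cau: "Cauchy sqrt_iter" by (rule convergent_Cauchy)
  have le: "opnorm (\<lambda>i j. ?y m i j - ?y n i j) \<le> \<bar>sqrt_iter m - sqrt_iter n\<bar>" for m n
  proof (cases "n \<le> m")
    case True
    then show ?thesis using opnorm_le[OF mat_sqrt_iter_diff[OF t(2,3), of n "m - n"]] by simp
  next
    case False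
    then show ?thesis
      using opnorm_le[OF mat_sqrt_iter_diff[OF t(2,3), of m "n - m"]] by (simp add: opnorm_diff_commute[of "?y m"])
  qed
  have "alg_Cauchy Bmat ?y"
    unfolding alg_Cauchy_def
  proof (intro conjI allI impI)
    show "?y n \<in> alg_carrier Bmat" for n using yb by auto
    fix e :: real assume "e > 0"
    then obtain N where "\<forall>m\<ge>N. \<forall>n\<ge>N. \<bar>sqrt_iter m - sqrt_iter n\<bar> < e"
      using Cau unfolding Cauchy_def dist_real_def by blast
    then show "\<exists>N. \<forall>m\<ge>N. \<forall>n\<ge>N. alg_dist Bmat (?y m) (?y n) < e"
      using le by (metis Bmat_simps(8) le_less_trans)
  qed
  then obtain y where yb': "y \<in> alg_carrier Bmat" and lim: "(\<lambda>n. alg_dist Bmat (?y n) y) \<longlonglongrightarrow> 0"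
    using B.complete by blast
  have y: "y \<in> E" by (rule cstar_subalgebra_limit[OF sub yE yb' lim])
  obtain D where D: "opbound D y" using yb' by auto
  have yB: "?y n \<in> alg_carrier Bmat" for n using yb by auto
  have entry: "(\<lambda>n. ?y n i j) \<longlonglongrightarrow> y i j" for i j
    using entry_tendsto[of ?y, OF _ D] yb lim by auto
  have sq: "(\<lambda>n. mmult (?y n) (?y n) i j) \<longlonglongrightarrow> mmult y y i j" for i j
  proof (rule entry_tendsto[where u = "\<lambda>n. mmult (?y n) (?y n)"])
    show "\<exists>C. opbound C (mmult (?y n) (?y n))" for n using opbound_mmult[OF yb yb] by blast
    show "opbound (D * D) (mmult y y)" by (rule opbound_mmult[OF D D])
    show "(\<lambda>n. opnorm (\<lambda>i j. mmult (?y n) (?y n) i j - mmult y y i j)) \<longlonglongrightarrow> 0"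
      using B.tendsto_alg_mult[OF yB yb' yB yb' lim lim] by simp
  qed
  have fix_y: "y i j = (1/2) * (t i j + mmult y y i j)" for i j
  proof (rule LIMSEQ_unique)
    show "(\<lambda>n. ?y (Suc n) i j) \<longlonglongrightarrow> y i j" by (rule LIMSEQ_Suc[OF entry])
    show "(\<lambda>n. ?y (Suc n) i j) \<longlonglongrightarrow> (1/2) * (t i j + mmult y y i j)"
      unfolding mat_sqrt_iter.simps by (intro tendsto_intros sq)
  qed
  have adj: "madj y = y"
  proof (intro ext)
    fix i j
    have "cnj (?y n j i) = ?y n i j" for n using mat_sqrt_iter_madj[OF t(2,3), of n] by (metis madj_def)
    then have "(\<lambda>n. ?y n i j) \<longlonglongrightarrow> cnj (y j i)" using tendsto_cnj[OF entry[of j i]] by simp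
    then show "madj y i j = y i j" unfolding madj_def using entry by (rule LIMSEQ_unique)
  qed
  let ?c = "\<lambda>i j. u i j - y i j"
  obtain C where C: "opbound C u" using bounded u(1) by blast
  have "madj ?c = ?c"
  proof (intro ext)
    fix i j
    have "cnj (u j i) = u i j" "cnj (y j i) = y i j" using u(2) adj by (metis madj_def)+
    then show "madj ?c i j = ?c i j" by (simp add: madj_def)
  qed
  moreover have "mmult ?c ?c = (\<lambda>i j. u i j - t i j)"
  proof -
    have cE: "?c \<in> E" by (rule diff[OF u(1) y])
    then obtain K where K: "opbound K ?c" using bounded by blast
    have m: "opbound (cmod (-1) * D) (\<lambda>i j. (-1) * y i j)" by (rule opbound_scale[OF D])
    have "mmult ?c ?c = mmult (\<lambda>i j. u i j + (-1) * y i j) ?c" by simp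
    also have "\<dots> = (\<lambda>i j. mmult u ?c i j + mmult (\<lambda>i j. (-1) * y i j) ?c i j)"
      by (rule mmult_add_left[OF C m K])
    also have "\<dots> = (\<lambda>i j. ?c i j - mmult y ?c i j)"
      by (simp only: mmult_scale_left[OF D K] u(3)[OF cE]) simp
    also have "mmult y ?c = mmult y (\<lambda>i j. u i j + (-1) * y i j)" by simp
    also have "\<dots> = (\<lambda>i j. mmult y u i j + mmult y (\<lambda>i j. (-1) * y i j) i j)"
      by (rule mmult_add_right[OF D C m])
    also have "\<dots> = (\<lambda>i j. y i j - mmult y y i j)"
      by (simp only: mmult_scale_right[OF D D] u(4)[OF y]) simp
    also have "(\<lambda>i j. ?c i j - (y i j - mmult y y i j)) = (\<lambda>i j. u i j - t i j)"
    proof (intro ext)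
      fix i j
      have "p = (1/2) * q \<Longrightarrow> p + p = q" for p q :: complex by (auto simp: mult.commute)
      from this[OF fix_y] have "y i j + y i j = t i j + mmult y y i j" .
      moreover have "?c i j - (y i j - mmult y y i j) = u i j - (y i j + y i j) + mmult y y i j" by simp
      ultimately show "?c i j - (y i j - mmult y y i j) = u i j - t i j" by simp
    qed
    finally show ?thesis .
  qed
  ultimately show ?thesis using that[OF diff[OF u(1) y]] by blast
qed


section \<open>The reduced algebra as an algebra of matrices\<close>

context locally_injective_system
begin

definition CA :: "('a \<times> int \<times> 'a) cmat set" where
  "CA = cstar_generated Bmat (mat ` Cc_set G)"

lemma mat_bounded: "f \<in> Bc_set G \<Longrightarrow> mat f \<in> alg_carrier Bmat"
  using opbound_mat by simp

lemma matrix_algebra_CA: "matrix_algebra CA"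
proof
  interpret B: cstar_algebra "Bmat :: ('a \<times> int \<times> 'a) cmat star_alg" by (rule cstar_algebra_Bmat)
  show "cstar_subalgebra Bmat CA"
    unfolding CA_def by (intro B.cstar_subalgebra_generated) (use Cc_subset_Bc mat_bounded in blast)
qed

lemma CA_Cc: "f \<in> Cc_set G \<Longrightarrow> mat f \<in> CA"
  by (auto simp: CA_def cstar_generated_def)

lemma mat_add: "(\<lambda>i j. mat f i j + mat g i j) = mat (\<lambda>\<gamma>. f \<gamma> + g \<gamma>)"
  by (auto simp: mat_def fun_eq_iff)

lemma mat_scale: "(\<lambda>i j. c * mat f i j) = mat (\<lambda>\<gamma>. c * f \<gamma>)"
  by (auto simp: mat_def fun_eq_iff)

lemma mat_sum: "(\<lambda>i j. \<Sum>t\<in>T. mat (f t) i j) = mat (\<lambda>\<gamma>. \<Sum>t\<in>T. f t \<gamma>)"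
  by (auto simp: mat_def fun_eq_iff)

text \<open>Being the matrix of a function means vanishing off pairs of groupoid elements with equal
  sources and depending only on the quotient. Entrywise limits preserve this, and the function is
  recovered from the columns of the units.\<close>

lemma cstar_subalgebra_mat: "cstar_subalgebra Bmat {M. (\<exists>C. opbound C M) \<and> (\<exists>f. M = mat f)}" (is "cstar_subalgebra _ ?W")
  unfolding cstar_subalgebra_alt
proof (intro conjI allI ballI impI)
  have "mat (\<lambda>_. 0) = (\<lambda>_ _. 0)" by (auto simp: mat_def fun_eq_iff)
  then have zero: "(\<lambda>_ _. 0) \<in> ?W" using opbound_zero by (metis (mono_tags, lifting) mem_Collect_eq)
  have "(\<lambda>i j. M i j + N i j) \<in> ?W" "mmult M N \<in> ?W" "madj M \<in> ?W" "(\<lambda>i j. c * M i j) \<in> ?W"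
    if "M \<in> ?W" "N \<in> ?W" for M N c
  proof -
    obtain C D f g where M: "opbound C M" "M = mat f" and N: "opbound D N" "N = mat g" using \<open>M \<in> ?W\<close> \<open>N \<in> ?W\<close> by blast
    show "(\<lambda>i j. M i j + N i j) \<in> ?W"
      using opbound_add[OF M(1) N(1)] mat_add[of f g] M(2) N(2) by blast
    show "mmult M N \<in> ?W"
      using opbound_mmult[OF M(1) N(1)] mat_gconv[of f g] M(2) N(2) by (metis (mono_tags, lifting) mem_Collect_eq)
    show "madj M \<in> ?W"
      using opbound_madj[OF M(1)] mat_ginvolution[of f] M(2) by (metis (mono_tags, lifting) mem_Collect_eq)
    show "(\<lambda>i j. c * M i j) \<in> ?W"
      using opbound_scale[OF M(1), of c] mat_scale[of c f] M(2) by blast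
  qed
  then show "star_subalgebra Bmat ?W" using zero by (simp add: star_subalgebra_def) auto
next
  fix u :: "nat \<Rightarrow> ('a \<times> int \<times> 'a) cmat" and M :: "('a \<times> int \<times> 'a) cmat"
  assume "M \<in> alg_carrier Bmat" and "(\<forall>n. u n \<in> ?W) \<and> (\<lambda>n. alg_dist Bmat (u n) M) \<longlonglongrightarrow> 0"
  then have u: "\<And>n. \<exists>C. opbound C (u n)" "\<forall>n. \<exists>f. u n = mat f" and "\<exists>D. opbound D M"
    and lim: "(\<lambda>n. opnorm (\<lambda>i j. u n i j - M i j)) \<longlonglongrightarrow> 0" by auto
  then obtain D where D: "opbound D M" by blast
  obtain f where f: "\<And>n. u n = mat (f n)" using u(2) by metis
  have E: "(\<lambda>n. u n i j) \<longlonglongrightarrow> M i j" for i j by (rule entry_tendsto[OF u(1) D lim])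
  have "M \<gamma> \<gamma>' = mat (\<lambda>(x, k, y). M (x, k, y) (y, 0, y)) \<gamma> \<gamma>'" for \<gamma> \<gamma>'
  proof -
    obtain x a z y b w where g: "\<gamma> = (x, a, z)" "\<gamma>' = (y, b, w)" by (cases \<gamma>, cases \<gamma>') auto
    show ?thesis
    proof (cases "z = w \<and> (x, a, z) \<in> Gam_carrier X \<phi> \<and> (y, b, w) \<in> Gam_carrier X \<phi>")
      case True
      then have "(x, a - b, y) \<in> Gam_carrier X \<phi>" using carrier_divide by blast
      then have "u n \<gamma> \<gamma>' = u n (x, a - b, y) (y, 0, y)" for n
        using True by (simp add: f g mat_unit, auto simp: mat_simps)
      then have "(\<lambda>n. u n \<gamma> \<gamma>') \<longlonglongrightarrow> M (x, a - b, y) (y, 0, y)" using E by simp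
      then have "M \<gamma> \<gamma>' = M (x, a - b, y) (y, 0, y)" using E LIMSEQ_unique by blast
      then show ?thesis using True by (auto simp: g mat_simps)
    next
      case False
      then have "u n \<gamma> \<gamma>' = 0" for n by (auto simp: f g mat_simps)
      then have "M \<gamma> \<gamma>' = 0" using E[of \<gamma> \<gamma>'] by (simp add: LIMSEQ_const_iff)
      then show ?thesis using False by (auto simp: g mat_simps)
    qed
  qed
  then have "\<exists>f. M = mat f" by blast
  with D show "M \<in> ?W" by blast
qed

lemma CA_mat:
  assumes "M \<in> CA"
  obtains f where "M = mat f"
proof -
  have "mat ` Cc_set G \<subseteq> {M. (\<exists>C. opbound C M) \<and> (\<exists>f. M = mat f)}"
    using opbound_mat Cc_subset_Bc by blast
  then have "CA \<subseteq> {M. (\<exists>C. opbound C M) \<and> (\<exists>f. M = mat f)}"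
    unfolding CA_def cstar_generated_def using cstar_subalgebra_mat by blast
  then show ?thesis using assms that by blast
qed

lemma CA_support:
  assumes "M \<in> CA" "M \<gamma> \<gamma>' \<noteq> 0"
  shows "\<gamma> \<in> Gam_carrier X \<phi>" "\<gamma>' \<in> Gam_carrier X \<phi>" "snd (snd \<gamma>) = snd (snd \<gamma>')"
proof -
  obtain f where "M = mat f" using assms(1) by (rule CA_mat)
  then show "\<gamma> \<in> Gam_carrier X \<phi>" "\<gamma>' \<in> Gam_carrier X \<phi>" "snd (snd \<gamma>) = snd (snd \<gamma>')"
    using assms(2) by (auto simp: mat_def split: if_splits)
qed


subsection \<open>Functions on the unit space\<close>

text \<open>A function on the unit space acts on an element of the groupoid by its value at the
  range.\<close>

definition dg :: "('a \<Rightarrow> complex) \<Rightarrow> ('a \<times> int \<times> 'a) cmat" where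
  "dg h = (\<lambda>\<gamma> \<gamma>'. if \<gamma> = \<gamma>' then (if \<gamma> \<in> Gam_carrier X \<phi> then h (fst \<gamma>) else 0) else 0)"

lemma dg_left: "M \<in> CA \<Longrightarrow> mmult (dg h) M = (\<lambda>\<gamma> \<gamma>'. h (fst \<gamma>) * M \<gamma> \<gamma>')"
  unfolding dg_def mmult_diag_left using CA_support(1) by (fastforce simp: fun_eq_iff)

lemma dg_right: "M \<in> CA \<Longrightarrow> mmult M (dg h) = (\<lambda>\<gamma> \<gamma>'. M \<gamma> \<gamma>' * h (fst \<gamma>'))"
  unfolding dg_def mmult_diag_right using CA_support(2) by (fastforce simp: fun_eq_iff)

lemma opbound_dg:
  assumes "\<And>x. x \<in> topspace X \<Longrightarrow> cmod (h x) \<le> c" "0 \<le> c"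
  shows "opbound c (dg h)"
  unfolding dg_def
proof (rule opbound_diag[OF _ \<open>0 \<le> c\<close>])
  show "cmod (if \<gamma> \<in> Gam_carrier X \<phi> then h (fst \<gamma>) else 0) \<le> c" for \<gamma>
    using assms carrier_topspace(1) by (cases \<gamma>) auto
qed

lemma madj_dg: "madj (dg h) = dg (\<lambda>x. cnj (h x))"
  by (auto simp: madj_def dg_def fun_eq_iff)

text \<open>Pieces are clopen, so cutting to one keeps continuity, and they are compact, so it gives
  compact support. The weights sit at the range and at the source.\<close>

lemma Cc_cut:
  assumes f: "continuous_map (Gam_top X \<phi>) euclidean f" and k: "0 \<le> int n + k"
    and h: "continuous_map X euclideanreal h" "continuous_map X euclideanreal h'"
  shows "(\<lambda>\<gamma>. if \<gamma> \<in> Gam_piece X \<phi> k n then of_real (h (fst \<gamma>)) * f \<gamma> * of_real (h' (snd (snd \<gamma>))) else 0) \<in> Cc_set G"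
    (is "?g \<in> _")
proof -
  have r: "continuous_map (Gam_top X \<phi>) X fst" "continuous_map (Gam_top X \<phi>) X (\<lambda>\<gamma>. snd (snd \<gamma>))"
    by (simp_all add: continuous_map_Gam_iff continuous_range continuous_source)
  have o: "continuous_map euclideanreal euclidean complex_of_real" by (simp add: continuous_on_of_real continuous_on_id)
  have "continuous_map (Gam_top X \<phi>) euclidean (\<lambda>\<gamma>. complex_of_real (h (fst \<gamma>)))"
    "continuous_map (Gam_top X \<phi>) euclidean (\<lambda>\<gamma>. complex_of_real (h' (snd (snd \<gamma>))))"
    using continuous_map_compose[OF continuous_map_compose[OF r(1) h(1)] o]
      continuous_map_compose[OF continuous_map_compose[OF r(2) h(2)] o] by (simp_all add: o_def)
  then have "continuous_map (Gam_top X \<phi>) euclidean ?g"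
    by (intro continuous_map_clopen_cases openin_piece closedin_piece k continuous_map_complex_mult f) auto
  moreover have "\<exists>m. \<forall>\<gamma>. ?g \<gamma> \<noteq> 0 \<longrightarrow> \<gamma> \<in> Gam_ball m"
  proof -
    obtain m where "Gam_piece X \<phi> k n \<subseteq> Gam_ball m" using compactin_subset_ball[OF compactin_piece[OF k]] by blast
    then show ?thesis by (intro exI[of _ m]) auto
  qed
  ultimately show ?thesis unfolding Cc_iff ..
qed

text \<open>The unit space is the piece with \<open>k = 0\<close> and \<open>n = 0\<close>; as it is
  clopen and compact, a continuous function on it extends by zero to an element of
  \<open>Cc_set G\<close>.\<close>

lemma dg_in_CA:
  assumes h: "continuous_map X euclideanreal h"
  shows "dg (\<lambda>x. of_real (h x)) \<in> CA"
proof -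
  let ?g = "\<lambda>\<gamma>. if \<gamma> \<in> Gam_piece X \<phi> 0 0 then complex_of_real (h (fst \<gamma>)) * 1 * of_real 1 else 0"
  have "?g \<in> Cc_set G" by (rule Cc_cut) (use h in simp_all)
  then have "mat ?g \<in> CA" by (rule CA_Cc)
  moreover have "mat ?g \<gamma> \<gamma>' = dg (\<lambda>x. of_real (h x)) \<gamma> \<gamma>'" for \<gamma> \<gamma>'
  proof -
    obtain x a z y b w where g: "\<gamma> = (x, a, z)" "\<gamma>' = (y, b, w)" by (cases \<gamma>, cases \<gamma>') auto
    show ?thesis
      using carrier_topspace(1) by (auto simp: g mat_simps dg_def piece_iff)
  qed
  then have "mat ?g = dg (\<lambda>x. of_real (h x))" by blast
  ultimately show ?thesis by simp
qed

lemma unit_in_CA: "dg (\<lambda>_. 1) \<in> CA"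
  using dg_in_CA[of "\<lambda>_. 1"] by simp


subsection \<open>Homogeneous parts\<close>

definition lev :: "int \<Rightarrow> ('a \<times> int \<times> 'a) cmat \<Rightarrow> ('a \<times> int \<times> 'a) cmat" where
  "lev k M \<gamma> \<gamma>' = (if fst (snd \<gamma>) - fst (snd \<gamma>') = k then M \<gamma> \<gamma>' else 0)"

lemma lev_mat: "lev k (mat f) = mat (\<lambda>\<gamma>. if fst (snd \<gamma>) = k then f \<gamma> else 0)"
  by (auto simp: lev_def mat_def fun_eq_iff)

lemma lev_zero: "lev k (\<lambda>_ _. 0) = (\<lambda>_ _. 0)"
  by (auto simp: lev_def fun_eq_iff)

lemma lev_add: "lev k (\<lambda>i j. M i j + N i j) = (\<lambda>i j. lev k M i j + lev k N i j)"
  by (auto simp: lev_def fun_eq_iff)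

lemma lev_scale: "lev k (\<lambda>i j. c * M i j) = (\<lambda>i j. c * lev k M i j)"
  by (auto simp: lev_def fun_eq_iff)

lemma lev_madj: "lev k (madj M) = madj (lev (- k) M)"
  by (auto simp: lev_def madj_def fun_eq_iff)

text \<open>Degrees add under multiplication. Only degrees between \<open>-n\<close> and
  \<open>n\<close> occur in \<open>f\<close>, so the sum over them is finite and can be taken out of
  the infinite sum.\<close>

lemma lev_mmult:
  assumes f: "\<And>\<gamma>. f \<gamma> \<noteq> 0 \<Longrightarrow> \<gamma> \<in> Gam_ball n"
    and b: "\<And>k. \<exists>C. opbound C (lev k (mat f))" "\<And>k. \<exists>C. opbound C (lev k N)"
  shows "lev k (mmult (mat f) N) = (\<lambda>i j. \<Sum>l\<in>{- int n..int n}. mmult (lev l (mat f)) (lev (k - l) N) i j)"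
proof (intro ext)
  fix \<gamma> \<gamma>' :: "'a \<times> int \<times> 'a"
  let ?I = "{- int n..int n}"
  let ?F = "\<lambda>l \<gamma>''. lev l (mat f) \<gamma> \<gamma>'' * lev (k - l) N \<gamma>'' \<gamma>'"
  have sm: "?F l summable_on UNIV" for l
  proof -
    obtain C D where "opbound C (lev l (mat f))" "opbound D (lev (k - l) N)" using b by blast
    then show ?thesis by (rule mmult_summable)
  qed
  have *: "(\<Sum>l\<in>?I. ?F l \<gamma>'') = (if fst (snd \<gamma>) - fst (snd \<gamma>') = k then mat f \<gamma> \<gamma>'' * N \<gamma>'' \<gamma>' else 0)" for \<gamma>''
  proof (cases "mat f \<gamma> \<gamma>'' = 0")
    case True
    then have z: "?F l \<gamma>'' = 0" for l by (simp add: lev_def)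
    have "(\<Sum>l\<in>?I. ?F l \<gamma>'') = 0" by (rule sum.neutral) (use z in blast)
    then show ?thesis using True by simp
  next
    case False
    let ?d = "fst (snd \<gamma>) - fst (snd \<gamma>'')"
    have "f (fst \<gamma>, ?d, fst \<gamma>'') \<noteq> 0" using False by (auto simp: mat_def split: if_splits)
    then have d: "?d \<in> ?I" using f[of "(fst \<gamma>, ?d, fst \<gamma>'')"] by (auto simp: ball_iff)
    have "(\<Sum>l\<in>?I. ?F l \<gamma>'') = (\<Sum>l\<in>{?d}. ?F l \<gamma>'')"
      using d by (intro sum.mono_neutral_right) (auto simp: lev_def)
    then show ?thesis by (auto simp: lev_def)
  qed
  have "(\<Sum>l\<in>?I. mmult (lev l (mat f)) (lev (k - l) N) \<gamma> \<gamma>') = (\<Sum>\<^sub>\<infinity>\<gamma>''. \<Sum>l\<in>?I. ?F l \<gamma>'')"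
    unfolding mmult_def by (rule infsum_sum_commute[symmetric]) (use sm in auto)
  also have "\<dots> = lev k (mmult (mat f) N) \<gamma> \<gamma>'"
    unfolding * by (auto simp: lev_def mmult_def)
  finally show "lev k (mmult (mat f) N) \<gamma> \<gamma>' = (\<Sum>l\<in>?I. mmult (lev l (mat f)) (lev (k - l) N) \<gamma> \<gamma>')" ..
qed

text \<open>Functions in \<open>Bc_set\<close> have only finitely many non-zero levels, so these elements of \<open>CA\<close> are
  finite sums of homogeneous ones.\<close>

definition Fin :: "('a \<times> int \<times> 'a) cmat set" where
  "Fin = {M \<in> CA. M \<in> mat ` Bc_set G \<and> (\<forall>k. lev k M \<in> CA)}"

text \<open>The only critical point is a level of a product: since the left factor has finitely many
  levels, it is a finite sum of products of levels.\<close>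

lemma star_subalgebra_Fin: "star_subalgebra Bmat Fin"
proof -
  interpret CA: matrix_algebra CA by (rule matrix_algebra_CA)
  interpret H: isometric_hom Bmat "Bc_alg G" mat by (rule isometric_hom_mat)
  have im: "star_subalgebra Bmat (mat ` Bc_set G)" using H.image_star_subalgebra by (simp add: Bc_alg_def)
  have "lev k (mmult M N) \<in> CA" if M: "M \<in> Fin" and N: "N \<in> Fin" for M N k
  proof -
    obtain f where f: "M = mat f" "f \<in> Bc_set G" using M by (auto simp: Fin_def)
    obtain n where n: "\<And>\<gamma>. f \<gamma> \<noteq> 0 \<Longrightarrow> \<gamma> \<in> Gam_ball n" using f(2) unfolding Bc_iff by blast
    have "lev k (mmult M N) = (\<lambda>i j. \<Sum>l\<in>{- int n..int n}. mmult (lev l M) (lev (k - l) N) i j)"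
      unfolding f(1) by (rule lev_mmult[OF n]) (use M N f(1) CA.bounded in \<open>auto simp: Fin_def\<close>)
    also have "\<dots> \<in> CA" using M N by (intro CA.sum CA.mult) (auto simp: Fin_def)
    finally show ?thesis .
  qed
  then show ?thesis
    using im unfolding star_subalgebra_def Bmat_simps Fin_def
    by (auto simp: CA.zero CA.add CA.mult CA.scale CA.star CA.bounded lev_zero lev_add lev_scale lev_madj)
qed

text \<open>On the ball containing the support, a level is the same as a piece, so taking a level of
  \<open>f\<close> is a cut by a clopen set.\<close>

lemma Cc_Fin: "mat ` Cc_set G \<subseteq> Fin"
proof
  fix M assume "M \<in> mat ` Cc_set G"
  then obtain f where f: "f \<in> Cc_set G" "M = mat f" by blast
  obtain n where n: "\<And>\<gamma>. f \<gamma> \<noteq> 0 \<Longrightarrow> \<gamma> \<in> Gam_ball n" using f(1) by (auto simp: Cc_iff)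
  have "lev k M \<in> CA" for k
  proof (cases "\<bar>k\<bar> \<le> int n")
    case True
    let ?g = "\<lambda>\<gamma>. if \<gamma> \<in> Gam_piece X \<phi> k n then complex_of_real 1 * f \<gamma> * of_real 1 else 0"
    have "?g \<in> Cc_set G" using True f(1) by (intro Cc_cut) (auto simp: Cc_iff)
    moreover have "?g = (\<lambda>\<gamma>. if fst (snd \<gamma>) = k then f \<gamma> else 0)"
    proof
      fix \<gamma>
      have "f \<gamma> \<noteq> 0 \<Longrightarrow> \<gamma> \<in> Gam_piece X \<phi> k n \<longleftrightarrow> fst (snd \<gamma>) = k"
        using n[of \<gamma>] True by (cases \<gamma>) (auto simp: ball_iff piece_iff)
      then show "?g \<gamma> = (if fst (snd \<gamma>) = k then f \<gamma> else 0)" by auto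
    qed
    ultimately show ?thesis using CA_Cc by (simp add: f(2) lev_mat)
  next
    case False
    have "f \<gamma> = 0" if "fst (snd \<gamma>) = k" for \<gamma>
      using n[of \<gamma>] False that by (cases \<gamma>) (auto simp: ball_iff)
    then have "lev k M = (\<lambda>_ _. 0)" by (auto simp: f(2) lev_def mat_def fun_eq_iff)
    then show ?thesis using matrix_algebra.zero[OF matrix_algebra_CA] by simp
  qed
  then show "M \<in> Fin" using f Cc_subset_Bc CA_Cc by (auto simp: Fin_def)
qed

text \<open>\<open>Fin\<close> is a *-algebra that contains the generators and lies in the algebra
  they generate.\<close>

lemma CA_eq_closure: "CA = alg_closure Bmat Fin"
proof -
  interpret CA: matrix_algebra CA by (rule matrix_algebra_CA)
  interpret B: cstar_algebra "Bmat :: ('a \<times> int \<times> 'a) cmat star_alg" by (rule cstar_algebra_Bmat)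
  have "cstar_subalgebra Bmat (alg_closure Bmat Fin)"
    by (rule B.cstar_subalgebra_closure[OF star_subalgebra_Fin])
  moreover have "mat ` Cc_set G \<subseteq> alg_closure Bmat Fin"
    using Cc_Fin B.closure_superset[of Fin] star_subalgebra_Fin by (auto simp: star_subalgebra_def)
  ultimately have "CA \<subseteq> alg_closure Bmat Fin" unfolding CA_def cstar_generated_def by blast
  moreover have "alg_closure Bmat Fin \<subseteq> CA"
    by (rule B.closure_subset[OF CA.sub]) (auto simp: Fin_def)
  ultimately show ?thesis ..
qed

lemma CA_approx:
  assumes "M \<in> CA"
  obtains u where "\<And>n. u n \<in> Fin" "(\<lambda>n. opnorm (\<lambda>i j. u n i j - M i j)) \<longlonglongrightarrow> 0"
proof -
  interpret B: cstar_algebra "Bmat :: ('a \<times> int \<times> 'a) cmat star_alg" by (rule cstar_algebra_Bmat)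
  have "M \<in> alg_closure Bmat Fin" "Fin \<subseteq> alg_carrier Bmat"
    using assms CA_eq_closure star_subalgebra_Fin by (auto simp: star_subalgebra_def)
  then show ?thesis using that by (rule B.closure_seq) auto
qed


subsection \<open>The diagonal and its isotropy extension\<close>

text \<open>The model of D': the entry at \<open>(\<gamma>, \<gamma>')\<close> is the value of a
  function at an element with range \<open>fst \<gamma>\<close> and source
  \<open>fst \<gamma>'\<close>, so the condition means support in the isotropy.\<close>

definition DA :: "('a \<times> int \<times> 'a) cmat set" where
  "DA = {M \<in> CA. \<forall>\<gamma> \<gamma>'. M \<gamma> \<gamma>' \<noteq> 0 \<longrightarrow> fst \<gamma> = fst \<gamma>'}"

lemma DA_CA: "M \<in> DA \<Longrightarrow> M \<in> CA"
  by (simp add: DA_def)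

lemma DA_support: "M \<in> DA \<Longrightarrow> M \<gamma> \<gamma>' \<noteq> 0 \<Longrightarrow> fst \<gamma> = fst \<gamma>'"
  unfolding DA_def by blast

lemma DA_I: "M \<in> CA \<Longrightarrow> (\<And>\<gamma> \<gamma>'. M \<gamma> \<gamma>' \<noteq> 0 \<Longrightarrow> fst \<gamma> = fst \<gamma>') \<Longrightarrow> M \<in> DA"
  unfolding DA_def by blast

lemma dg_in_DA: "continuous_map X euclideanreal h \<Longrightarrow> dg (\<lambda>x. of_real (h x)) \<in> DA"
  by (rule DA_I[OF dg_in_CA]) (auto simp: dg_def split: if_splits)

lemma matrix_algebra_DA: "matrix_algebra DA"
proof
  interpret CA: matrix_algebra CA by (rule matrix_algebra_CA)
  have mult: "mmult M N \<in> DA" if MN: "M \<in> DA" "N \<in> DA" for M N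
  proof -
    have "fst \<gamma> = fst \<gamma>'" if nz: "mmult M N \<gamma> \<gamma>' \<noteq> 0" for \<gamma> \<gamma>'
      using nz MN DA_support by (elim mmult_nonzeroE) metis
    then show ?thesis using MN CA.mult DA_CA DA_I by blast
  qed
  have add: "(\<lambda>i j. M i j + N i j) \<in> DA" if "M \<in> DA" "N \<in> DA" for M N
    using that DA_CA CA.add DA_support by (intro DA_I) (blast, metis add_0)
  have star: "madj M \<in> DA" if "M \<in> DA" for M
  proof (rule DA_I)
    show "madj M \<in> CA" using that DA_CA CA.star by blast
    show "fst \<gamma> = fst \<gamma>'" if "madj M \<gamma> \<gamma>' \<noteq> 0" for \<gamma> \<gamma>'
      using DA_support[OF \<open>M \<in> DA\<close>, of \<gamma>' \<gamma>] that by (simp add: madj_def)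
  qed
  have scale: "(\<lambda>i j. c * M i j) \<in> DA" if "M \<in> DA" for M c
    using that DA_CA CA.scale DA_support by (intro DA_I) auto
  have "(\<lambda>_ _. 0) \<in> DA" using CA.zero by (intro DA_I) auto
  then have "star_subalgebra Bmat DA"
    unfolding star_subalgebra_def Bmat_simps
    using mult add star scale CA.bounded[OF DA_CA] by auto
  moreover have "M \<in> DA" if "M \<in> alg_carrier Bmat" and u: "\<And>n. u n \<in> DA" and lim: "(\<lambda>n. alg_dist Bmat (u n) M) \<longlonglongrightarrow> 0" for u M
  proof -
    obtain D where D: "opbound D M" using \<open>M \<in> alg_carrier Bmat\<close> by auto
    have uC: "u n \<in> CA" for n using u by (simp add: DA_def)
    have "M \<in> CA" using CA.limit[OF uC D] lim by simp
    moreover have "M \<gamma> \<gamma>' = 0" if "fst \<gamma> \<noteq> fst \<gamma>'" for \<gamma> \<gamma>'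
    proof -
      have "u n \<gamma> \<gamma>' = 0" for n using DA_support[OF u] that by blast
      moreover have "(\<lambda>n. u n \<gamma> \<gamma>') \<longlonglongrightarrow> M \<gamma> \<gamma>'"
        using CA.bounded[OF uC] lim by (intro entry_tendsto[OF _ D]) simp_all
      ultimately show ?thesis by (simp add: LIMSEQ_const_iff)
    qed
    ultimately show ?thesis by (intro DA_I) blast+
  qed
  ultimately show "cstar_subalgebra Bmat DA" unfolding cstar_subalgebra_alt by blast
qed

text \<open>Both products are sums over the isotropy group at a point, a subgroup of the integers; the
  substitution \<open>c \<mapsto> a + b - c\<close> interchanges them.\<close>

lemma DA_commute:
  assumes M: "M \<in> DA" and N: "N \<in> DA"
  shows "mmult M N = mmult N M"
proof (intro ext)
  fix \<gamma> \<gamma>' :: "'a \<times> int \<times> 'a"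
  have MC: "M \<in> CA" and NC: "N \<in> CA" using M N by (auto simp: DA_def)
  obtain f g where f: "M = mat f" and g: "N = mat g" using CA_mat[OF MC] CA_mat[OF NC] by metis
  obtain x a z y b w where xy: "\<gamma> = (x, a, z)" "\<gamma>' = (y, b, w)" by (cases \<gamma>, cases \<gamma>') auto
  have Mz: "M p q = 0" and Nz: "N p q = 0" if "fst p \<noteq> fst q \<or> snd (snd p) \<noteq> snd (snd q) \<or> p \<notin> Gam_carrier X \<phi> \<or> q \<notin> Gam_carrier X \<phi>" for p q
    using that DA_support[OF M, of p q] DA_support[OF N, of p q] CA_support[OF MC, of p q] CA_support[OF NC, of p q]
    by blast+
  show "mmult M N \<gamma> \<gamma>' = mmult N M \<gamma> \<gamma>'"
  proof (cases "x = y \<and> z = w \<and> \<gamma> \<in> Gam_carrier X \<phi> \<and> \<gamma>' \<in> Gam_carrier X \<phi>")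
    case False
    have "\<not> (P \<gamma> j \<noteq> 0 \<and> Q j \<gamma>' \<noteq> 0)" if "P \<in> {M, N}" "Q \<in> {M, N}" for P Q j
      using False that Mz[of \<gamma> j] Nz[of \<gamma> j] Mz[of j \<gamma>'] Nz[of j \<gamma>'] by (auto simp: xy)
    then have "mmult M N \<gamma> \<gamma>' = 0" "mmult N M \<gamma> \<gamma>' = 0" by (meson insertI1 insertI2 mmult_nonzeroE)+
    then show ?thesis by simp
  next
    case True
    then have G: "(x, a, z) \<in> Gam_carrier X \<phi>" "(x, b, z) \<in> Gam_carrier X \<phi>" by (auto simp: xy)
    let ?\<sigma> = "\<lambda>\<delta> :: 'a \<times> int \<times> 'a. (fst \<delta>, a + b - fst (snd \<delta>), snd (snd \<delta>))"
    have bij: "bij_betw ?\<sigma> UNIV UNIV"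
      by (rule bij_betw_byWitness[where f' = ?\<sigma>]) auto
    have "M \<gamma> (?\<sigma> \<delta>) * N (?\<sigma> \<delta>) \<gamma>' = N \<gamma> \<delta> * M \<delta> \<gamma>'" for \<delta>
    proof (cases "fst \<delta> = x \<and> snd (snd \<delta>) = z")
      case False
      then show ?thesis using Mz[of \<gamma> "?\<sigma> \<delta>"] Nz[of \<gamma> \<delta>] by (auto simp: xy)
    next
      case True
      then obtain c where \<delta>: "\<delta> = (x, c, z)" by (metis prod.collapse)
      have inv: "(x, a + b - c, z) \<in> Gam_carrier X \<phi>" if "(x, c, z) \<in> Gam_carrier X \<phi>" for c
        using carrier_mult[OF carrier_divide[OF G(1) that] G(2)] by (simp add: algebra_simps)
      have "(x, c, z) \<in> Gam_carrier X \<phi> \<longleftrightarrow> (x, a + b - c, z) \<in> Gam_carrier X \<phi>"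
        using inv[of c] inv[of "a + b - c"] by auto
      then show ?thesis
        using \<open>x = y \<and> z = w \<and> _\<close> G by (auto simp: \<delta> xy f g mat_simps)
    qed
    then have "mmult N M \<gamma> \<gamma>' = (\<Sum>\<^sub>\<infinity>\<delta>. M \<gamma> (?\<sigma> \<delta>) * N (?\<sigma> \<delta>) \<gamma>')" by (simp add: mmult_def)
    also have "\<dots> = mmult M N \<gamma> \<gamma>'"
      unfolding mmult_def by (rule infsum_reindex_bij_betw[OF bij])
    finally show ?thesis ..
  qed
qed

text \<open>Commuting with \<open>dg h\<close> forces an entry to vanish whenever \<open>h\<close>
  takes different values at its two ranges, and continuous functions separate points.\<close>

lemma commutant_DA:
  assumes M: "M \<in> CA" and comm: "\<And>N. N \<in> DA \<Longrightarrow> mmult M N = mmult N M"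
  shows "M \<in> DA"
proof -
  have "fst \<gamma> = fst \<gamma>'" if nz: "M \<gamma> \<gamma>' \<noteq> 0" for \<gamma> \<gamma>'
  proof (rule ccontr)
    assume ne: "fst \<gamma> \<noteq> fst \<gamma>'"
    have "fst \<gamma> \<in> topspace X" "fst \<gamma>' \<in> topspace X"
      using CA_support(1,2)[OF M nz] carrier_topspace(1) by (metis prod.collapse)+
    then obtain h where h: "continuous_map X euclideanreal h" "h (fst \<gamma>) \<noteq> h (fst \<gamma>')"
      using separating_function ne by metis
    have "mmult M (dg (\<lambda>x. of_real (h x))) \<gamma> \<gamma>' = mmult (dg (\<lambda>x. of_real (h x))) M \<gamma> \<gamma>'"
      using comm[OF dg_in_DA[OF h(1)]] by simp
    then have "M \<gamma> \<gamma>' * of_real (h (fst \<gamma>')) = of_real (h (fst \<gamma>)) * M \<gamma> \<gamma>'"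
      by (simp add: dg_left[OF M] dg_right[OF M])
    then show False using nz h(2) by simp
  qed
  with M show ?thesis by (rule DA_I)
qed


subsection \<open>Normalizers\<close>

text \<open>Where \<open>f\<close> is non-zero, range and source determine each other. A conjugation
  passes from one end to the other, through isotropy, and back, so it ends where it started.\<close>

lemma normalizer_mat:
  assumes f: "mat f \<in> CA"
    and src: "\<And>\<gamma> \<gamma>'. \<lbrakk>f \<gamma> \<noteq> 0; f \<gamma>' \<noteq> 0; fst \<gamma> = fst \<gamma>'\<rbrakk> \<Longrightarrow> snd (snd \<gamma>) = snd (snd \<gamma>')"
    and rng: "\<And>\<gamma> \<gamma>'. \<lbrakk>f \<gamma> \<noteq> 0; f \<gamma>' \<noteq> 0; snd (snd \<gamma>) = snd (snd \<gamma>')\<rbrakk> \<Longrightarrow> fst \<gamma> = fst \<gamma>'"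
  shows "mat f \<in> normalizers (alg_restrict Bmat CA) DA"
proof -
  interpret CA: matrix_algebra CA by (rule matrix_algebra_CA)
  have nz: "f (fst \<gamma>, fst (snd \<gamma>) - fst (snd \<gamma>'), fst \<gamma>') \<noteq> 0" if "mat f \<gamma> \<gamma>' \<noteq> 0" for \<gamma> \<gamma>'
    using that by (auto simp: mat_def split: if_splits)
  have "mmult (mmult (madj (mat f)) d) (mat f) \<in> DA" if d: "d \<in> DA" for d
  proof -
    have "fst \<gamma> = fst \<gamma>'" if "mmult (mmult (madj (mat f)) d) (mat f) \<gamma> \<gamma>' \<noteq> 0" for \<gamma> \<gamma>'
      using that
    proof (elim mmult_nonzeroE)
      fix i j assume "mat f i \<gamma>' \<noteq> 0" "madj (mat f) \<gamma> j \<noteq> 0" "d j i \<noteq> 0"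
      then have "mat f i \<gamma>' \<noteq> 0" "mat f j \<gamma> \<noteq> 0" "fst j = fst i" using DA_support[OF d] by (auto simp: madj_def)
      then show "fst \<gamma> = fst \<gamma>'" using src[OF nz nz, of j \<gamma> i \<gamma>'] by simp
    qed
    then show ?thesis using DA_CA[OF d] f by (intro DA_I) (simp_all add: CA.mult CA.star)
  qed
  moreover have "mmult (mmult (mat f) d) (madj (mat f)) \<in> DA" if d: "d \<in> DA" for d
  proof -
    have "fst \<gamma> = fst \<gamma>'" if "mmult (mmult (mat f) d) (madj (mat f)) \<gamma> \<gamma>' \<noteq> 0" for \<gamma> \<gamma>'
      using that
    proof (elim mmult_nonzeroE)
      fix i j assume "madj (mat f) i \<gamma>' \<noteq> 0" "mat f \<gamma> j \<noteq> 0" "d j i \<noteq> 0"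
      then have "mat f \<gamma>' i \<noteq> 0" "mat f \<gamma> j \<noteq> 0" "fst j = fst i" using DA_support[OF d] by (auto simp: madj_def)
      then show "fst \<gamma> = fst \<gamma>'" using rng[OF nz nz, of \<gamma> j \<gamma>' i] by simp
    qed
    then show ?thesis using DA_CA[OF d] f by (intro DA_I) (simp_all add: CA.mult CA.star)
  qed
  ultimately show ?thesis using f by (simp add: normalizers_def)
qed

lemma Cc_in_generated:
  assumes E: "cstar_subalgebra Bmat E" and N: "normalizers (alg_restrict Bmat CA) DA \<subseteq> E" and f: "f \<in> Cc_set G"
  shows "mat f \<in> E"
proof -
  interpret E: matrix_algebra E by unfold_locales (rule E)
  obtain n where n: "\<And>\<gamma>. f \<gamma> \<noteq> 0 \<Longrightarrow> \<gamma> \<in> Gam_ball n" using f by (auto simp: Cc_iff)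
  \<comment> \<open>The pieces involved use the iterates with exponents \<open>n\<close> and
    \<open>k + n\<close>, both at most \<open>2 * n\<close>, so one partition of unity serves both
    ends and all degrees.\<close>
  from partition_of_unity[of "2 * n"] obtain T and h :: "'a \<Rightarrow> 'a \<Rightarrow> real" where T: "finite T"
    and h: "\<forall>t\<in>T. continuous_map X euclideanreal (h t)"
    and one: "\<forall>x\<in>topspace X. (\<Sum>t\<in>T. (h t x)\<^sup>2) = 1"
    and inj: "\<forall>t\<in>T. \<forall>x\<in>topspace X. \<forall>y\<in>topspace X.
         h t x \<noteq> 0 \<longrightarrow> h t y \<noteq> 0 \<longrightarrow> (\<phi> ^^ (2 * n)) x = (\<phi> ^^ (2 * n)) y \<longrightarrow> x = y"
    by blast
  let ?I = "{- int n..int n}"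
  \<comment> \<open>Each summand lives on one piece and has its ends in sets on which the iterate is
    injective, so either end determines the other. The squared weights sum to 1 at each end.\<close>
  define F where "F = (\<lambda>(k, s, t) \<gamma>. if \<gamma> \<in> Gam_piece X \<phi> k n
    then complex_of_real ((h s (fst \<gamma>))\<^sup>2) * f \<gamma> * of_real ((h t (snd (snd \<gamma>)))\<^sup>2) else 0)"
  have F: "mat (F q) \<in> E" if qI: "q \<in> ?I \<times> T \<times> T" for q
  proof -
    obtain k s t where q: "q = (k, s, t)" and k: "\<bar>k\<bar> \<le> int n" and st: "s \<in> T" "t \<in> T"
      using qI by (cases q) auto
    have k': "0 \<le> int n + k" using k by simp
    have "F q \<in> Cc_set G"
      unfolding F_def q prod.case using f h st k'
      by (intro Cc_cut continuous_map_real_pow) (auto simp: Cc_iff)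
    then have C: "mat (F q) \<in> CA" by (rule CA_Cc)
    have pow: "(\<phi> ^^ (2 * n)) x = (\<phi> ^^ (2 * n)) x'" if eq: "(\<phi> ^^ m) x = (\<phi> ^^ m) x'" and m: "m \<le> 2 * n" for m x x'
    proof -
      have "2 * n = (2 * n - m) + m" using m by simp
      then show ?thesis using eq by (metis comp_apply funpow_add)
    qed
    have "mat (F q) \<in> normalizers (alg_restrict Bmat CA) DA"
    proof (rule normalizer_mat[OF C])
      fix \<gamma> \<gamma>' assume "F q \<gamma> \<noteq> 0" "F q \<gamma>' \<noteq> 0"
      moreover obtain x l y x' l' y' where g: "\<gamma> = (x, l, y)" "\<gamma>' = (x', l', y')" by (cases \<gamma>, cases \<gamma>') auto
      ultimately have P: "(x, l, y) \<in> Gam_piece X \<phi> k n" "(x', l', y') \<in> Gam_piece X \<phi> k n"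
        and nz: "h s x \<noteq> 0" "h s x' \<noteq> 0" "h t y \<noteq> 0" "h t y' \<noteq> 0"
        by (auto simp: F_def q split: if_splits)
      then have X: "x \<in> topspace X" "x' \<in> topspace X" "y \<in> topspace X" "y' \<in> topspace X"
        and e: "(\<phi> ^^ nat (k + int n)) x = (\<phi> ^^ n) y" "(\<phi> ^^ nat (k + int n)) x' = (\<phi> ^^ n) y'"
        using k' by (simp_all add: piece_iff)
      show "snd (snd \<gamma>) = snd (snd \<gamma>')" if "fst \<gamma> = fst \<gamma>'"
      proof -
        have "(\<phi> ^^ n) y = (\<phi> ^^ n) y'" using that e by (simp add: g)
        then have "(\<phi> ^^ (2 * n)) y = (\<phi> ^^ (2 * n)) y'" by (rule pow) simp
        then show ?thesis using inj st nz X by (simp add: g)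
      qed
      show "fst \<gamma> = fst \<gamma>'" if "snd (snd \<gamma>) = snd (snd \<gamma>')"
      proof -
        have "(\<phi> ^^ nat (k + int n)) x = (\<phi> ^^ nat (k + int n)) x'" using that e by (simp add: g)
        then have "(\<phi> ^^ (2 * n)) x = (\<phi> ^^ (2 * n)) x'" by (rule pow) (use k in simp)
        then show ?thesis using inj st nz X by (simp add: g)
      qed
    qed
    then show ?thesis using N by blast
  qed
  have "f \<gamma> = (\<Sum>q\<in>?I \<times> T \<times> T. F q \<gamma>)" for \<gamma>
  proof (cases "f \<gamma> = 0")
    case True
    then have "F q \<gamma> = 0" for q by (cases q) (simp add: F_def)
    then show ?thesis using True by simp
  next
    case False
    obtain x l y where g: "\<gamma> = (x, l, y)" by (cases \<gamma>)
    have B: "(x, l, y) \<in> Gam_ball n" using n[OF False] by (simp add: g)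
    then have l: "l \<in> ?I" and X: "x \<in> topspace X" "y \<in> topspace X" by (auto simp: ball_iff)
    have P: "\<gamma> \<in> Gam_piece X \<phi> k n \<longleftrightarrow> k = l" if "k \<in> ?I" for k
      using B that by (auto simp: g ball_iff piece_iff)
    have "(\<Sum>q\<in>?I \<times> T \<times> T. F q \<gamma>) = (\<Sum>k\<in>?I. \<Sum>s\<in>T. \<Sum>t\<in>T. F (k, s, t) \<gamma>)"
      by (simp add: sum.cartesian_product)
    also have "\<dots> = (\<Sum>k\<in>{l}. \<Sum>s\<in>T. \<Sum>t\<in>T. F (k, s, t) \<gamma>)"
      using l P by (intro sum.mono_neutral_right) (auto simp: F_def)
    also have "\<dots> = (\<Sum>s\<in>T. \<Sum>t\<in>T. of_real ((h s x)\<^sup>2) * f \<gamma> * of_real ((h t y)\<^sup>2))"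
      using P[OF l] by (simp add: F_def g)
    also have "\<dots> = of_real (\<Sum>s\<in>T. (h s x)\<^sup>2) * f \<gamma> * of_real (\<Sum>t\<in>T. (h t y)\<^sup>2)"
      unfolding of_real_sum sum_distrib_left sum_distrib_right by (rule sum.swap)
    also have "\<dots> = f \<gamma>" using one X by simp
    finally show ?thesis ..
  qed
  then have "mat f = mat (\<lambda>\<gamma>. \<Sum>q\<in>?I \<times> T \<times> T. F q \<gamma>)" by presburger
  also have "\<dots> = (\<lambda>i j. \<Sum>q\<in>?I \<times> T \<times> T. mat (F q) i j)" by (rule mat_sum[symmetric])
  also have "\<dots> \<in> E" using F T by (intro E.sum) auto
  finally show ?thesis .
qed

end


section \<open>The conditional expectation\<close>

lemma opbound_block_diff:
  assumes "opbound C (\<lambda>i j. M i j - N i j)"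
  shows "opbound C (\<lambda>i j. block_part p M i j - block_part p N i j)"
proof -
  have "(\<lambda>i j. block_part p M i j - block_part p N i j) = block_part p (\<lambda>i j. M i j - N i j)"
    by (auto simp: block_part_def fun_eq_iff)
  then show ?thesis using opbound_block_part[OF assms, of p] by simp
qed

lemma opnorm_block_diff:
  assumes "opbound C (\<lambda>i j. M i j - N i j)"
  shows "opnorm (\<lambda>i j. block_part p M i j - block_part p N i j) \<le> opnorm (\<lambda>i j. M i j - N i j)"
  by (intro opnorm_le opbound_block_diff opbound_opnorm[OF assms])

lemma opnorm_tendsto_0:
  assumes "\<And>n. opnorm (a n) \<le> b n" "\<And>n. \<exists>C. opbound C (a n)" "b \<longlonglongrightarrow> 0"
  shows "(\<lambda>n. opnorm (a n)) \<longlonglongrightarrow> 0"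
proof (rule tendsto_sandwich[OF _ _ tendsto_const assms(3)])
  show "\<forall>\<^sub>F n in sequentially. 0 \<le> opnorm (a n)"
    using assms(2) opnorm_nonneg by (intro always_eventually allI) blast
  show "\<forall>\<^sub>F n in sequentially. opnorm (a n) \<le> b n" using assms(1) by (intro always_eventually allI)
qed

context discrete_periodic_system
begin

text \<open>For a set \<open>S\<close> of points, the compression to the blocks of \<open>cls S\<close> restricts a function on the
  groupoid to the units together with the isotropy groups at the points of \<open>S\<close>.\<close>

definition cls :: "'a set \<Rightarrow> 'a \<times> int \<times> 'a \<Rightarrow> 'a \<times> 'a \<times> int" where
  "cls S \<gamma> = (fst \<gamma>, snd (snd \<gamma>), if fst \<gamma> \<in> S then 0 else fst (snd \<gamma>))"

text \<open>A point mass is discontinuous unless the point is isolated, so membership in the algebra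
  is a genuine condition.\<close>

definition pt :: "'a \<Rightarrow> ('a \<times> int \<times> 'a) cmat" where
  "pt x0 = dg (\<lambda>x. if x = x0 then 1 else 0)"

definition good :: "'a set" where
  "good = {x \<in> topspace X. pt x \<in> CA}"

text \<open>With a partition of unity \<open>\<Sum> h\<^sub>t\<^sup>2 = 1\<close> such that \<open>\<phi>\<^sup>n\<close> is injective on each \<open>{h\<^sub>t \<noteq> 0}\<close>, an element
  \<open>M\<close> of degree \<open>0\<close> supported in \<open>Gam_ball n\<close> has \<open>\<Sum> h\<^sub>t M h\<^sub>t\<close> as its restriction to the units.\<close>

lemma cls_lev_zero:
  assumes M: "M \<in> Fin" and S: "S \<subseteq> good"
  shows "block_part (cls S) (lev 0 M) \<in> CA"
proof -
  interpret CA: matrix_algebra CA by (rule matrix_algebra_CA)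
  obtain f where f: "M = mat f" "f \<in> Bc_set G" using M by (auto simp: Fin_def)
  obtain n where n: "\<And>\<gamma>. f \<gamma> \<noteq> 0 \<Longrightarrow> \<gamma> \<in> Gam_ball n" using f(2) unfolding Bc_iff by blast
  from partition_of_unity[of n] obtain T and h :: "'a \<Rightarrow> 'a \<Rightarrow> real" where T: "finite T"
    and h: "\<forall>t\<in>T. continuous_map X euclideanreal (h t)"
    and one: "\<forall>x\<in>topspace X. (\<Sum>t\<in>T. (h t x)\<^sup>2) = 1"
    and inj: "\<forall>t\<in>T. \<forall>x\<in>topspace X. \<forall>y\<in>topspace X.
         h t x \<noteq> 0 \<longrightarrow> h t y \<noteq> 0 \<longrightarrow> (\<phi> ^^ n) x = (\<phi> ^^ n) y \<longrightarrow> x = y"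
    by blast
  let ?D = "\<lambda>t. dg (\<lambda>x. of_real (h t x))"
  have L: "lev 0 M \<in> CA" using M by (simp add: Fin_def)
  have D: "?D t \<in> CA" if "t \<in> T" for t using h that dg_in_CA by blast
  have "block_part (cls S) (lev 0 M) \<gamma> \<gamma>' = (\<Sum>t\<in>T. mmult (mmult (?D t) (lev 0 M)) (?D t) \<gamma> \<gamma>')" for \<gamma> \<gamma>'
  proof -
    have "mmult (mmult (?D t) (lev 0 M)) (?D t) \<gamma> \<gamma>'
        = of_real (h t (fst \<gamma>)) * lev 0 M \<gamma> \<gamma>' * of_real (h t (fst \<gamma>'))" if "t \<in> T" for t
      using dg_right[OF CA.mult[OF D[OF that] L]] dg_left[OF L] by simp
    then have rhs: "(\<Sum>t\<in>T. mmult (mmult (?D t) (lev 0 M)) (?D t) \<gamma> \<gamma>')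
        = (\<Sum>t\<in>T. of_real (h t (fst \<gamma>)) * lev 0 M \<gamma> \<gamma>' * of_real (h t (fst \<gamma>')))" by simp
    show ?thesis
    proof (cases "lev 0 M \<gamma> \<gamma>' = 0")
      case True
      then show ?thesis unfolding rhs by (simp add: block_part_def)
    next
      case False
      obtain x a z y b w where g: "\<gamma> = (x, a, z)" "\<gamma>' = (y, b, w)" by (cases \<gamma>, cases \<gamma>') auto
      have ab: "a = b" "z = w" and "f (x, 0, y) \<noteq> 0"
        using False by (auto simp: g f lev_def mat_simps split: if_splits)
      then have B: "x \<in> topspace X" "y \<in> topspace X" "(\<phi> ^^ n) x = (\<phi> ^^ n) y"
        using n[of "(x, 0, y)"] by (auto simp: ball_iff)
      show ?thesis
      proof (cases "x = y")
        case True
        have "(\<Sum>t\<in>T. of_real (h t x) * lev 0 M \<gamma> \<gamma>' * of_real (h t x)) = of_real (\<Sum>t\<in>T. (h t x)\<^sup>2) * lev 0 M \<gamma> \<gamma>'"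
          by (simp add: sum_distrib_left sum_distrib_right power2_eq_square mult_ac)
        then show ?thesis unfolding rhs using True ab B one by (simp add: g block_part_def cls_def)
      next
        case False
        have "of_real (h t x) * lev 0 M \<gamma> \<gamma>' * of_real (h t y) = 0" if "t \<in> T" for t
          using inj that B False by auto
        then have "(\<Sum>t\<in>T. of_real (h t x) * lev 0 M \<gamma> \<gamma>' * of_real (h t y)) = 0" by (intro sum.neutral) blast
        then show ?thesis unfolding rhs using False by (simp add: g block_part_def cls_def)
      qed
    qed
  qed
  then have "block_part (cls S) (lev 0 M) = (\<lambda>\<gamma> \<gamma>'. \<Sum>t\<in>T. mmult (mmult (?D t) (lev 0 M)) (?D t) \<gamma> \<gamma>')" by blast
  also have "\<dots> \<in> CA" using T D L by (intro CA.sum CA.mult)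
  finally show ?thesis .
qed

text \<open>In non-zero degree the classes retain only isotropy at points of \<open>S\<close>, and a
  ball meets it over finitely many points. Cutting from both sides by the masses of these points,
  which lie in the algebra, gives exactly the block part.\<close>

lemma cls_lev_nonzero:
  assumes M: "M \<in> Fin" and S: "S \<subseteq> good" and k: "k \<noteq> 0"
  shows "block_part (cls S) (lev k M) \<in> CA"
proof -
  interpret CA: matrix_algebra CA by (rule matrix_algebra_CA)
  obtain f where f: "M = mat f" "f \<in> Bc_set G" using M by (auto simp: Fin_def)
  obtain n where n: "\<And>\<gamma>. f \<gamma> \<noteq> 0 \<Longrightarrow> \<gamma> \<in> Gam_ball n" using f(2) unfolding Bc_iff by blast
  let ?F = "S \<inter> fst ` {(x, k). k \<noteq> 0 \<and> (x, k, x) \<in> Gam_ball n}"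
  have fin: "finite ?F" using finite_isotropy_ball by blast
  have L: "lev k M \<in> CA" using M by (simp add: Fin_def)
  have D: "pt x \<in> CA" if "x \<in> ?F" for x using S that by (auto simp: good_def)
  have "block_part (cls S) (lev k M) \<gamma> \<gamma>' = (\<Sum>x0\<in>?F. mmult (mmult (pt x0) (lev k M)) (pt x0) \<gamma> \<gamma>')" for \<gamma> \<gamma>'
  proof -
    have "mmult (mmult (pt x0) (lev k M)) (pt x0) \<gamma> \<gamma>'
        = (if fst \<gamma> = x0 \<and> fst \<gamma>' = x0 then lev k M \<gamma> \<gamma>' else 0)" if "x0 \<in> ?F" for x0
      using dg_right[OF CA.mult[OF D[OF that] L]] dg_left[OF L] by (simp add: pt_def)
    then have "(\<Sum>x0\<in>?F. mmult (mmult (pt x0) (lev k M)) (pt x0) \<gamma> \<gamma>')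
        = (\<Sum>x0\<in>?F. if fst \<gamma> = x0 then (if fst \<gamma>' = x0 then lev k M \<gamma> \<gamma>' else 0) else 0)"
      by (intro sum.cong refl) auto
    also have "\<dots> = (if fst \<gamma> \<in> ?F then (if fst \<gamma>' = fst \<gamma> then lev k M \<gamma> \<gamma>' else 0) else 0)"
      using fin by (rule sum.delta')
    also have "\<dots> = block_part (cls S) (lev k M) \<gamma> \<gamma>'"
    proof (cases "lev k M \<gamma> \<gamma>' = 0")
      case True
      then show ?thesis by (simp add: block_part_def)
    next
      case False
      obtain x a z y b w where g: "\<gamma> = (x, a, z)" "\<gamma>' = (y, b, w)" by (cases \<gamma>, cases \<gamma>') auto
      have ab: "a - b = k" "z = w" and "f (x, k, y) \<noteq> 0"
        using False by (auto simp: g f lev_def mat_simps split: if_splits)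
      then have "(x, k, y) \<in> Gam_ball n" using n by blast
      then have "x = y \<Longrightarrow> x \<in> fst ` {(x, k). k \<noteq> 0 \<and> (x, k, x) \<in> Gam_ball n}"
        using k by (intro image_eqI[of _ _ "(x, k)"]) auto
      then show ?thesis using ab k by (auto simp: g block_part_def cls_def)
    qed
    finally show ?thesis ..
  qed
  then have "block_part (cls S) (lev k M) = (\<lambda>\<gamma> \<gamma>'. \<Sum>x0\<in>?F. mmult (mmult (pt x0) (lev k M)) (pt x0) \<gamma> \<gamma>')" by blast
  also have "\<dots> \<in> CA" using fin D L by (intro CA.sum CA.mult)
  finally show ?thesis .
qed

lemma cls_Fin:
  assumes M: "M \<in> Fin" and S: "S \<subseteq> good"
  shows "block_part (cls S) M \<in> CA"
proof -
  interpret CA: matrix_algebra CA by (rule matrix_algebra_CA)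
  obtain f where f: "M = mat f" "f \<in> Bc_set G" using M by (auto simp: Fin_def)
  obtain n where n: "\<And>\<gamma>. f \<gamma> \<noteq> 0 \<Longrightarrow> \<gamma> \<in> Gam_ball n" using f(2) unfolding Bc_iff by blast
  let ?I = "{- int n..int n}"
  have "block_part (cls S) M \<gamma> \<gamma>' = (\<Sum>k\<in>?I. block_part (cls S) (lev k M) \<gamma> \<gamma>')" for \<gamma> \<gamma>'
  proof (cases "M \<gamma> \<gamma>' = 0")
    case True
    then have "block_part (cls S) (lev k M) \<gamma> \<gamma>' = 0" for k by (simp add: block_part_def lev_def)
    then show ?thesis using True by (simp add: block_part_def)
  next
    case False
    let ?d = "fst (snd \<gamma>) - fst (snd \<gamma>')"
    have "f (fst \<gamma>, ?d, fst \<gamma>') \<noteq> 0" using False by (auto simp: f mat_def split: if_splits)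
    then have d: "?d \<in> ?I" using n[of "(fst \<gamma>, ?d, fst \<gamma>')"] by (auto simp: ball_iff)
    have "(\<Sum>k\<in>?I. block_part (cls S) (lev k M) \<gamma> \<gamma>') = (\<Sum>k\<in>{?d}. block_part (cls S) (lev k M) \<gamma> \<gamma>')"
      using d by (intro sum.mono_neutral_right) (auto simp: block_part_def lev_def)
    then show ?thesis by (simp add: block_part_def lev_def)
  qed
  then have "block_part (cls S) M = (\<lambda>\<gamma> \<gamma>'. \<Sum>k\<in>?I. block_part (cls S) (lev k M) \<gamma> \<gamma>')" by blast
  also have "\<dots> \<in> CA"
  proof (rule CA.sum)
    show "block_part (cls S) (lev k M) \<in> CA" for k
      using cls_lev_zero[OF M S] cls_lev_nonzero[OF M S] by (cases "k = 0") auto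
  qed simp
  finally show ?thesis .
qed

text \<open>Compression to blocks is contractive, so it passes from \<open>Fin\<close> to norm
  limits.\<close>

lemma cls_CA:
  assumes M: "M \<in> CA" and S: "S \<subseteq> good"
  shows "block_part (cls S) M \<in> CA"
proof -
  interpret CA: matrix_algebra CA by (rule matrix_algebra_CA)
  obtain u where u: "\<And>n. u n \<in> Fin" and lim: "(\<lambda>n. opnorm (\<lambda>i j. u n i j - M i j)) \<longlonglongrightarrow> 0"
    using CA_approx[OF M] by blast
  have "u n \<in> CA" for n using u by (simp add: Fin_def)
  then have b: "\<exists>C. opbound C (\<lambda>i j. u n i j - M i j)" for n using CA.diff M CA.bounded by blast
  obtain D where D: "opbound D M" using CA.bounded M by blast
  show ?thesis
  proof (rule CA.limit)
    show "block_part (cls S) (u n) \<in> CA" for n by (rule cls_Fin[OF u S])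
    show "opbound D (block_part (cls S) M)" by (rule opbound_block_part[OF D])
    show "(\<lambda>n. opnorm (\<lambda>i j. block_part (cls S) (u n) i j - block_part (cls S) M i j)) \<longlonglongrightarrow> 0"
      using b opnorm_block_diff opbound_block_diff by (intro opnorm_tendsto_0[OF _ _ lim]) blast+
  qed
qed

lemma cls_DA: "M \<in> CA \<Longrightarrow> S \<subseteq> good \<Longrightarrow> block_part (cls S) M \<in> DA"
  by (rule DA_I[OF cls_CA]) (auto simp: block_part_def cls_def split: if_splits)

text \<open>The relabelling \<open>cls {}\<close> is injective, so its block part is the diagonal,
  that is, the restriction to the units. What remains is the isotropy of non-zero degree.\<close>

definition off_units :: "('a \<times> int \<times> 'a) cmat \<Rightarrow> ('a \<times> int \<times> 'a) cmat" where
  "off_units M = (\<lambda>i j. block_part (\<lambda>\<gamma>. (fst \<gamma>, snd (snd \<gamma>))) M i j - block_part (cls {}) M i j)"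

lemma off_units_eq:
  "off_units M \<gamma> \<gamma>' = (if fst \<gamma> = fst \<gamma>' \<and> snd (snd \<gamma>) = snd (snd \<gamma>') \<and> fst (snd \<gamma>) \<noteq> fst (snd \<gamma>') then M \<gamma> \<gamma>' else 0)"
  by (auto simp: off_units_def block_part_def cls_def)

text \<open>An element of \<open>DA\<close> equals its own restriction to the isotropy, so only the
  diagonal is subtracted, and that stays in the algebra by the case \<open>S = {}\<close> of
  \<open>cls_CA\<close>.\<close>

lemma off_units_DA: "d \<in> DA \<Longrightarrow> off_units d \<in> CA"
proof -
  interpret CA: matrix_algebra CA by (rule matrix_algebra_CA)
  assume d: "d \<in> DA"
  have "off_units d = (\<lambda>i j. d i j - block_part (cls {}) d i j)"
    using DA_support[OF d] CA_support(3)[OF DA_CA[OF d]]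
    by (fastforce simp: off_units_def block_part_def fun_eq_iff)
  then show "off_units d \<in> CA" using CA.diff[OF DA_CA[OF d] cls_CA[OF DA_CA[OF d]]] by simp
qed

text \<open>Off the units an element of \<open>DA\<close> is a norm limit of elements supported over finitely many
  points, so it can be cut down to a single point by continuous functions.\<close>

lemma pt_off_units:
  assumes d: "d \<in> DA" and x0: "x0 \<in> topspace X"
  shows "mmult (pt x0) (off_units d) \<in> CA"
proof -
  interpret CA: matrix_algebra CA by (rule matrix_algebra_CA)
  let ?d = "off_units d"
  have dC: "?d \<in> CA" by (rule off_units_DA[OF d])
  obtain u where u: "\<And>n. u n \<in> Fin" and lim: "(\<lambda>n. opnorm (\<lambda>i j. u n i j - d i j)) \<longlonglongrightarrow> 0"
    using CA_approx[OF DA_CA[OF d]] by blast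
  have uC: "u n \<in> CA" for n using u by (simp add: Fin_def)
  have b: "\<exists>C. opbound C (\<lambda>i j. u n i j - d i j)" for n using CA.diff uC DA_CA[OF d] CA.bounded by blast
  have "\<exists>h. continuous_map X euclideanreal h \<and> (\<forall>x\<in>topspace X. 0 \<le> h x \<and> h x \<le> 1) \<and> h x0 = 1
      \<and> (\<forall>\<gamma> \<gamma>'. off_units (u n) \<gamma> \<gamma>' \<noteq> 0 \<longrightarrow> fst \<gamma> \<noteq> x0 \<longrightarrow> h (fst \<gamma>) = 0)" for n
  proof -
    obtain f where f: "u n = mat f" "f \<in> Bc_set G" using u[of n] by (auto simp: Fin_def)
    obtain m where m: "\<And>\<gamma>. f \<gamma> \<noteq> 0 \<Longrightarrow> \<gamma> \<in> Gam_ball m" using f(2) unfolding Bc_iff by blast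
    \<comment> \<open>Finitely many points other than \<open>x0\<close> carry non-unit isotropy in
      the ball supporting \<open>u n\<close>; a peak function at \<open>x0\<close> vanishing on them
      acts on \<open>off_units (u n)\<close> like the point mass.\<close>
    let ?F = "fst ` {(x, k). k \<noteq> 0 \<and> (x, k, x) \<in> Gam_ball m} - {x0}"
    have "finite ?F" using finite_isotropy_ball by blast
    moreover have "?F \<subseteq> topspace X" by (auto simp: ball_iff)
    ultimately obtain h where h: "continuous_map X euclideanreal h" "h x0 = 1" "\<And>x. x \<in> ?F \<Longrightarrow> h x = 0"
      "\<And>x. 0 \<le> h x" "\<And>x. x \<in> topspace X \<Longrightarrow> h x \<le> 1"
      using peak_function[OF x0, of ?F] by blast
    have "h (fst \<gamma>) = 0" if nz: "off_units (u n) \<gamma> \<gamma>' \<noteq> 0" and ne: "fst \<gamma> \<noteq> x0" for \<gamma> \<gamma>'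
    proof -
      obtain x a z y b w where g: "\<gamma> = (x, a, z)" "\<gamma>' = (y, b, w)" by (cases \<gamma>, cases \<gamma>') auto
      have "a \<noteq> b" "f (x, a - b, x) \<noteq> 0"
        using nz by (auto simp: g off_units_eq f mat_simps split: if_splits)
      then have "(x, a - b) \<in> {(x, k). k \<noteq> 0 \<and> (x, k, x) \<in> Gam_ball m}" using m by auto
      then have "x \<in> fst ` {(x, k). k \<noteq> 0 \<and> (x, k, x) \<in> Gam_ball m}" by (rule image_eqI[rotated]) simp
      then show ?thesis using h(3)[of x] ne by (simp add: g)
    qed
    then have "\<forall>\<gamma> \<gamma>'. off_units (u n) \<gamma> \<gamma>' \<noteq> 0 \<longrightarrow> fst \<gamma> \<noteq> x0 \<longrightarrow> h (fst \<gamma>) = 0" by blast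
    with h(1,2,4,5) show ?thesis by (intro exI[of _ h] conjI ballI)
  qed
  then obtain h where H: "\<And>n. continuous_map X euclideanreal (h n) \<and> (\<forall>x\<in>topspace X. 0 \<le> h n x \<and> h n x \<le> 1) \<and> h n x0 = 1
      \<and> (\<forall>\<gamma> \<gamma>'. off_units (u n) \<gamma> \<gamma>' \<noteq> 0 \<longrightarrow> fst \<gamma> \<noteq> x0 \<longrightarrow> h n (fst \<gamma>) = 0)"
    by metis
  have h: "\<And>n. continuous_map X euclideanreal (h n)"
    "\<And>n x. x \<in> topspace X \<Longrightarrow> 0 \<le> h n x \<and> h n x \<le> 1" "\<And>n. h n x0 = 1"
    "\<And>n \<gamma> \<gamma>'. off_units (u n) \<gamma> \<gamma>' \<noteq> 0 \<Longrightarrow> fst \<gamma> \<noteq> x0 \<Longrightarrow> h n (fst \<gamma>) = 0"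
    using H by blast+
  let ?v = "\<lambda>n. mmult (dg (\<lambda>x. of_real (h n x))) ?d"
  have ptd: "mmult (pt x0) ?d = (\<lambda>\<gamma> \<gamma>'. (if fst \<gamma> = x0 then 1 else 0) * ?d \<gamma> \<gamma>')"
    unfolding pt_def by (rule dg_left[OF dC])
  obtain D where D: "opbound D ?d" using CA.bounded dC by blast
  \<comment> \<open>The factor 2 arises because \<open>off_units\<close> is a difference of two
    contractive compressions. The bound does not depend on the shape of \<open>h n\<close>, only on
    its values lying between 0 and 1.\<close>
  have est: "opbound (2 * opnorm (\<lambda>i j. u n i j - d i j)) (\<lambda>i j. ?v n i j - mmult (pt x0) ?d i j)" for n
  proof -
    obtain C where "opbound C (\<lambda>i j. u n i j - d i j)" using b by blast
    then have C: "opbound (opnorm (\<lambda>i j. u n i j - d i j)) (\<lambda>i j. u n i j - d i j)" (is "opbound ?C _")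
      by (rule opbound_opnorm)
    let ?q = "\<lambda>x. complex_of_real (h n x) - (if x = x0 then 1 else 0)"
    have "opbound 1 (dg ?q)"
    proof (rule opbound_dg)
      show "cmod (?q x) \<le> 1" if "x \<in> topspace X" for x
        using h(2)[OF that, of n] h(3)[of n] by auto
    qed simp
    moreover have "opbound (?C + ?C) (\<lambda>i j. off_units (u n) i j - ?d i j)"
    proof -
      have "(\<lambda>i j. off_units (u n) i j - ?d i j)
          = (\<lambda>i j. (block_part (\<lambda>\<gamma>. (fst \<gamma>, snd (snd \<gamma>))) (u n) i j - block_part (\<lambda>\<gamma>. (fst \<gamma>, snd (snd \<gamma>))) d i j)
            - (block_part (cls {}) (u n) i j - block_part (cls {}) d i j))"
        by (auto simp: off_units_def fun_eq_iff)
      then show ?thesis using opbound_diff[OF opbound_block_diff[OF C] opbound_block_diff[OF C]] by simp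
    qed
    ultimately have "opbound (1 * (?C + ?C)) (mmult (dg ?q) (\<lambda>i j. off_units (u n) i j - ?d i j))"
      by (rule opbound_mmult)
    moreover have "mmult (dg ?q) (\<lambda>i j. off_units (u n) i j - ?d i j) = (\<lambda>i j. - (?v n i j - mmult (pt x0) ?d i j))"
    proof (intro ext)
      fix \<gamma> \<gamma>' :: "'a \<times> int \<times> 'a"
      \<comment> \<open>At \<open>x0\<close> the peak function and the point mass agree, and at any
        other point where \<open>off_units (u n)\<close> is non-zero both vanish.\<close>
      have "?q (fst \<gamma>) * off_units (u n) \<gamma> \<gamma>' = 0"
        using h(3)[of n] h(4)[of n \<gamma> \<gamma>'] by auto
      moreover have "?d \<gamma> \<gamma>' \<noteq> 0 \<Longrightarrow> \<gamma> \<in> Gam_carrier X \<phi>" using CA_support(1)[OF dC] by blast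
      ultimately show "mmult (dg ?q) (\<lambda>i j. off_units (u n) i j - ?d i j) \<gamma> \<gamma>' = - (?v n \<gamma> \<gamma>' - mmult (pt x0) ?d \<gamma> \<gamma>')"
        unfolding ptd dg_left[OF dC] unfolding dg_def mmult_diag_left by (auto simp: algebra_simps)
    qed
    ultimately have "opbound (2 * ?C) (\<lambda>i j. - (?v n i j - mmult (pt x0) ?d i j))" by simp
    from opbound_uminus[OF this] show ?thesis by simp
  qed
  show ?thesis
  proof (rule CA.limit)
    show "?v n \<in> CA" for n by (intro CA.mult dC dg_in_CA h(1))
    have "opbound 1 (pt x0)" unfolding pt_def by (rule opbound_dg) auto
    then show "opbound (1 * D) (mmult (pt x0) ?d)" using D by (rule opbound_mmult)
    have "(\<lambda>n. 2 * opnorm (\<lambda>i j. u n i j - d i j)) \<longlonglongrightarrow> 2 * 0" by (intro tendsto_intros lim)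
    then have lim2: "(\<lambda>n. 2 * opnorm (\<lambda>i j. u n i j - d i j)) \<longlonglongrightarrow> 0" by simp
    show "(\<lambda>n. opnorm (\<lambda>i j. ?v n i j - mmult (pt x0) ?d i j)) \<longlonglongrightarrow> 0"
      by (rule opnorm_tendsto_0[OF _ _ lim2]) (use est opnorm_le in blast)+
  qed
qed

text \<open>The restriction to the units of \<open>e e\<^sup>*\<close>, where \<open>e\<close> is an off-unit part cut down to the point, is a
  non-zero multiple of the point mass.\<close>

lemma good_if_DA:
  assumes d: "d \<in> DA" and nz: "d \<gamma> \<gamma>' \<noteq> 0" and ne: "fst (snd \<gamma>) \<noteq> fst (snd \<gamma>')"
  shows "fst \<gamma> \<in> good"
proof -
  interpret CA: matrix_algebra CA by (rule matrix_algebra_CA)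
  let ?x = "fst \<gamma>"
  note C = DA_CA[OF d]
  have G: "\<gamma> \<in> Gam_carrier X \<phi>" by (rule CA_support(1)[OF C nz])
  have x: "?x \<in> topspace X" using carrier_topspace(1) G by (metis prod.collapse)
  let ?e = "mmult (pt ?x) (off_units d)"
  have eC: "?e \<in> CA" by (rule pt_off_units[OF d x])
  have e: "?e i j = (if fst i = ?x then off_units d i j else 0)" for i j
    unfolding pt_def dg_left[OF off_units_DA[OF d]] by simp
  have e_nz: "?e \<gamma> \<gamma>' \<noteq> 0"
    unfolding e off_units_eq using nz ne DA_support[OF d nz] CA_support(3)[OF C nz] by simp
  let ?p = "mmult ?e (madj ?e)"
  have pC: "?p \<in> CA" by (intro CA.mult CA.star eC)
  obtain g where g: "?p = mat g" using pC by (rule CA_mat)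
  \<comment> \<open>Diagonal entries depend only on the range, so those over the point
    \<open>?x\<close> all equal the value at its unit.\<close>
  let ?c = "g (?x, 0, ?x)"
  have diag: "?p i i = (if i \<in> Gam_carrier X \<phi> \<and> fst i = ?x then ?c else 0)" for i
  proof (cases "i \<in> Gam_carrier X \<phi> \<and> fst i = ?x")
    case True
    then show ?thesis by (auto simp: g mat_def)
  next
    case False
    have "?e i j = 0" for j
    proof (rule ccontr)
      assume nz: "?e i j \<noteq> 0"
      then have "fst i = ?x" unfolding e by (simp split: if_splits)
      with CA_support(1)[OF eC nz] False show False by blast
    qed
    then have "?p i i = 0" by (simp add: mmult_def)
    then show ?thesis using False by auto
  qed
  \<comment> \<open>The diagonal entry of \<open>e e*\<close> is the squared norm of a row of
    \<open>e\<close>, and the row of \<gamma> contains a non-zero entry.\<close>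
  have c: "?c \<noteq> 0"
  proof
    assume "?c = 0"
    then have "?p \<gamma> \<gamma> = 0" by (simp add: diag)
    moreover obtain K where "opbound K ?e" using CA.bounded eC by blast
    then have "opbound K (madj ?e)" by simp
    ultimately have "madj ?e \<gamma>' \<gamma> = 0" by (intro mmult_madj_diag_eq_0[of K "madj ?e" \<gamma> \<gamma>']) simp_all
    then show False using e_nz by (simp add: madj_def)
  qed
  have "block_part (cls {}) ?p = (\<lambda>i j. ?c * pt ?x i j)"
  proof (intro ext)
    fix i j :: "'a \<times> int \<times> 'a"
    show "block_part (cls {}) ?p i j = ?c * pt ?x i j"
    proof (cases "i = j")
      case True
      then show ?thesis using diag[of j] by (auto simp: block_part_def pt_def dg_def)
    next
      case False
      then have "cls {} i \<noteq> cls {} j" by (auto simp: cls_def prod_eq_iff)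
      then show ?thesis using False by (simp add: block_part_def pt_def dg_def)
    qed
  qed
  then have "(\<lambda>i j. ?c * pt ?x i j) \<in> CA" using cls_CA[OF pC, of "{}"] by simp
  from CA.scale[OF this, of "1 / ?c"] have "pt ?x \<in> CA" using c by simp
  with x show ?thesis by (simp add: good_def)
qed

text \<open>A non-zero entry between different degrees forces its point into \<open>good\<close>,
  where \<open>cls\<close> forgets the degree; so every non-zero entry stays within one
  block.\<close>

lemma expectation_fixes:
  assumes d: "d \<in> DA"
  shows "block_part (cls good) d = d"
proof -
  have *: "cls good \<gamma> = cls good \<gamma>'" if nz: "d \<gamma> \<gamma>' \<noteq> 0" for \<gamma> \<gamma>'
    using good_if_DA[OF d nz] DA_support[OF d nz] CA_support(3)[OF DA_CA[OF d] nz] by (auto simp: cls_def)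
  show ?thesis
  proof (intro ext)
    show "block_part (cls good) d \<gamma> \<gamma>' = d \<gamma> \<gamma>'" for \<gamma> \<gamma>'
      using *[of \<gamma> \<gamma>'] by (cases "d \<gamma> \<gamma>' = 0") (simp_all add: block_part_def)
  qed
qed

lemma unit_left: "M \<in> CA \<Longrightarrow> mmult (dg (\<lambda>_. 1)) M = M"
  by (simp add: dg_left)

lemma unit_right: "M \<in> CA \<Longrightarrow> mmult M (dg (\<lambda>_. 1)) = M"
  by (simp add: dg_right)

lemma madj_block_part: "madj (block_part p M) = block_part p (madj M)"
  by (auto simp: madj_def block_part_def fun_eq_iff)

text \<open>The factor \<open>c\<close> must lie in the algebra. After \<open>b\<close> is scaled to
  a contraction, the block part \<open>t\<close> of \<open>1 - b* b\<close> is a self-adjoint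
  contraction in the algebra, and the square root of \<open>1 - t\<close> is a factor for the block
  part of \<open>b* b\<close>.\<close>

lemma expectation_positive:
  assumes b: "b \<in> CA"
  obtains c where "c \<in> CA" "block_part (cls good) (mmult (madj b) b) = mmult (madj c) c"
proof -
  interpret CA: matrix_algebra CA by (rule matrix_algebra_CA)
  let ?P = "block_part (cls good)" and ?u = "dg (\<lambda>_. 1)"
  obtain B where "opbound B b" using CA.bounded b by blast
  \<comment> \<open>A bound of at least 1 can be divided by, also when \<open>b\<close> is
    zero.\<close>
  then have "opbound (max 1 B) b" by (rule opbound_mono) simp
  then obtain r where r: "r > 0" "opbound r b" by (meson less_max_iff_disj zero_less_one)
  let ?b = "\<lambda>i j. complex_of_real (1 / r) * b i j"
  have "opbound (cmod (complex_of_real (1 / r)) * r) ?b" by (rule opbound_scale[OF r(2)])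
  then have b1: "opbound 1 ?b" using r(1) by (simp add: norm_divide)
  have bC: "?b \<in> CA" by (rule CA.scale[OF b])
  let ?bb = "mmult (madj ?b) ?b"
  have bbC: "?bb \<in> CA" by (intro CA.mult CA.star bC)
  let ?t = "?P (\<lambda>i j. ?u i j - ?bb i j)"
  have t: "?t \<in> CA" by (intro cls_CA CA.diff unit_in_CA bbC order_refl)
  have t1: "opbound 1 ?t"
  proof (rule opbound_block_part)
    \<comment> \<open>The estimate is known for the identity matrix, which is non-zero at indices
      outside the groupoid as well; multiplying by \<open>?u\<close> removes these and leaves the
      unit of the algebra.\<close>
    have "opbound (1 * 1) (mmult ?u (\<lambda>i j. (if i = j then 1 else 0) - ?bb i j))"
      by (intro opbound_mmult opbound_id_minus b1 opbound_dg) auto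
    moreover have "mmult ?u (\<lambda>i j. (if i = j then 1 else 0) - ?bb i j) = (\<lambda>i j. ?u i j - ?bb i j)"
    proof (intro ext)
      fix i j :: "'a \<times> int \<times> 'a"
      have "?bb i j \<noteq> 0 \<Longrightarrow> i \<in> Gam_carrier X \<phi>" using CA_support(1)[OF bbC] by blast
      then show "mmult ?u (\<lambda>i j. (if i = j then 1 else 0) - ?bb i j) i j = ?u i j - ?bb i j"
        unfolding dg_def mmult_diag_left by auto
    qed
    ultimately show "opbound 1 (\<lambda>i j. ?u i j - ?bb i j)" by simp
  qed
  have u_adj: "madj ?u = ?u" by (simp add: madj_dg)
  have "madj (\<lambda>i j. ?u i j - ?bb i j) = (\<lambda>i j. madj ?u i j - madj ?bb i j)" by (simp add: madj_def fun_eq_iff)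
  then have "madj (\<lambda>i j. ?u i j - ?bb i j) = (\<lambda>i j. ?u i j - ?bb i j)" by (simp add: u_adj madj_mmult)
  then have t_adj: "madj ?t = ?t" by (simp add: madj_block_part)
  obtain c where c: "c \<in> CA" "madj c = c" "mmult c c = (\<lambda>i j. ?u i j - ?t i j)"
    by (rule CA.square_root[OF unit_in_CA u_adj unit_left unit_right t t1 t_adj])
  have "?P ?u = ?u" using expectation_fixes[OF dg_in_DA[of "\<lambda>_. 1"]] by simp
  then have Pu: "?P ?u i j = ?u i j" for i j by simp
  have "mmult c c = ?P ?bb"
  proof (intro ext)
    fix i j
    show "mmult c c i j = ?P ?bb i j" unfolding c(3) using Pu[of i j] by (auto simp: block_part_def)
  qed
  moreover have "?bb = (\<lambda>i j. complex_of_real (1 / r^2) * mmult (madj b) b i j)"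
  proof -
    have "madj ?b = (\<lambda>i j. complex_of_real (1 / r) * madj b i j)" by (simp add: madj_def fun_eq_iff)
    then have "?bb = (\<lambda>i j. complex_of_real (1 / r) * (complex_of_real (1 / r) * mmult (madj b) b i j))"
      by (simp only: mmult_scale_left[OF opbound_madj[OF r(2)] opbound_scale[OF r(2)]]
          mmult_scale_right[OF opbound_madj[OF r(2)] r(2)])
    then show ?thesis by (simp add: power2_eq_square)
  qed
  ultimately have cc: "mmult c c i j = complex_of_real (1 / r^2) * ?P (mmult (madj b) b) i j" for i j
    by (simp add: block_part_def)
  let ?c = "\<lambda>i j. complex_of_real r * c i j"
  obtain K where K: "opbound K c" using CA.bounded c(1) by blast
  have "madj ?c = (\<lambda>i j. complex_of_real r * madj c i j)" by (simp add: madj_def fun_eq_iff)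
  then have "mmult (madj ?c) ?c = (\<lambda>i j. complex_of_real r * (complex_of_real r * mmult c c i j))"
    by (simp only: c(2) mmult_scale_left[OF K opbound_scale[OF K]] mmult_scale_right[OF K K])
  also have "\<dots> = ?P (mmult (madj b) b)" using r(1) by (simp add: cc power2_eq_square fun_eq_iff)
  finally have "?P (mmult (madj b) b) = mmult (madj ?c) ?c" ..
  with CA.scale[OF c(1)] show ?thesis by (rule that)
qed

lemma expectation:
  "conditional_expectation (alg_restrict Bmat CA) DA (block_part (cls good))"
  unfolding conditional_expectation_def alg_restrict_simps Bmat_simps
proof (intro conjI ballI allI impI)
  interpret CA: matrix_algebra CA by (rule matrix_algebra_CA)
  let ?P = "block_part (cls good)"
  have fix_zero: "cls good i = cls good j" if "d \<in> DA" "d i j \<noteq> 0" for d i j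
    using expectation_fixes[OF that(1)] that(2) by (metis block_part_def)
  fix a assume a: "a \<in> CA"
  show "?P a \<in> DA" by (rule cls_DA[OF a]) simp
  show "?P (\<lambda>i j. a i j + b i j) = (\<lambda>i j. ?P a i j + ?P b i j)" for b
    by (simp add: block_part_def fun_eq_iff)
  show "?P (\<lambda>i j. c * a i j) = (\<lambda>i j. c * ?P a i j)" for c
    by (simp add: block_part_def fun_eq_iff)
  show "opnorm (?P a) \<le> opnorm a"
    using CA.bounded[OF a] by (blast intro: opnorm_le opbound_block_part opbound_opnorm)
  show "alg_positive (alg_restrict Bmat CA) (?P a)" if pos: "alg_positive (alg_restrict Bmat CA) a"
  proof -
    obtain b where b: "b \<in> CA" "a = mmult (madj b) b" using pos by (auto simp: alg_positive_def)
    obtain c where "c \<in> CA" "?P (mmult (madj b) b) = mmult (madj c) c" using b(1) by (rule expectation_positive)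
    then show ?thesis by (auto simp: alg_positive_def b(2))
  qed
  fix d d' assume d: "d \<in> DA" "d' \<in> DA"
  show "?P (mmult (mmult d a) d') = mmult (mmult d (?P a)) d'"
    using block_part_mmult_right[of d' "cls good" "mmult d a"] block_part_mmult_left[of d "cls good" a]
      fix_zero[OF d(1)] fix_zero[OF d(2)] by simp
qed (rule expectation_fixes)

text \<open>Block parts retain the diagonal, and the diagonal of \<open>a* a\<close> consists of the
  squared norms of the columns of \<open>a\<close>.\<close>

lemma expectation_faithful: "faithful_map (alg_restrict Bmat CA) (block_part (cls good))"
  unfolding faithful_map_def alg_restrict_simps Bmat_simps
proof (intro ballI impI ext)
  interpret CA: matrix_algebra CA by (rule matrix_algebra_CA)
  fix a i j assume a: "a \<in> CA" and P: "block_part (cls good) (mmult (madj a) a) = (\<lambda>_ _. 0)"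
  obtain K where K: "opbound K a" using CA.bounded a by blast
  have "block_part (cls good) (mmult (madj a) a) j j = 0" by (simp add: P)
  then have "mmult (madj a) a j j = 0" by (simp add: block_part_def)
  then show "a i j = 0" by (rule mmult_madj_diag_eq_0[OF K])
qed

theorem cartan_matrices: "cartan_subalgebra (alg_restrict Bmat CA) DA"
proof -
  interpret B: cstar_algebra "Bmat :: ('a \<times> int \<times> 'a) cmat star_alg" by (rule cstar_algebra_Bmat)
  interpret CA: matrix_algebra CA by (rule matrix_algebra_CA)
  interpret DA: matrix_algebra DA by (rule matrix_algebra_DA)
  interpret A: cstar_algebra "alg_restrict Bmat CA" by (rule B.cstar_algebra_restrict[OF CA.sub])
  note restrict_iff = B.cstar_subalgebra_restrict_iff[OF CA.sub]
  have DA_sub: "DA \<subseteq> CA" using DA_CA by blast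
  have sub: "cstar_subalgebra (alg_restrict Bmat CA) DA"
    using DA_sub DA.sub by (simp add: restrict_iff)
  have ab: "alg_abelian (alg_restrict Bmat CA) DA"
    by (simp add: alg_abelian_def DA_commute)
  have unit: "contains_approximate_unit (alg_restrict Bmat CA) DA"
  proof -
    \<comment> \<open>The space is compact, so the algebra has a unit, which lies in
      \<open>DA\<close>; the principal filter at it is an approximate unit.\<close>
    let ?u = "dg (\<lambda>_. 1)"
    have u: "?u \<in> DA" using dg_in_DA[of "\<lambda>_. 1"] by simp
    have "mmult (madj ?u) ?u = ?u" by (simp add: madj_dg unit_left[OF unit_in_CA])
    then have "alg_positive (alg_restrict Bmat CA) ?u"
      unfolding alg_positive_def by (intro bexI[of _ ?u]) (simp_all add: unit_in_CA)
    moreover have "opnorm ?u \<le> 1" by (intro opnorm_le opbound_dg) auto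
    moreover have "alg_dist Bmat a a = 0" if "a \<in> CA" for a
      using B.dist_zero_iff[of a a] CA.bounded[OF that] by auto
    then have "((\<lambda>e. alg_dist Bmat (mmult e a) a) \<longlongrightarrow> 0) (principal {?u})"
      "((\<lambda>e. alg_dist Bmat (mmult a e) a) \<longlongrightarrow> 0) (principal {?u})" if "a \<in> CA" for a
      using that tendsto_principal_singleton[of "\<lambda>e. alg_dist Bmat (mmult e a) a" ?u]
        tendsto_principal_singleton[of "\<lambda>e. alg_dist Bmat (mmult a e) a" ?u]
      by (simp_all add: unit_left unit_right del: Bmat_simps(8))
    ultimately show ?thesis
      unfolding contains_approximate_unit_def using u
      by (intro exI[of _ "principal {?u}"])
         (simp add: principal_eq_bot_iff eventually_principal del: Bmat_simps(8))
  qed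
  have max: "maximal_abelian (alg_restrict Bmat CA) DA"
    unfolding maximal_abelian_def
  proof (intro conjI allI impI sub ab)
    fix E assume E: "cstar_subalgebra (alg_restrict Bmat CA) E \<and> alg_abelian (alg_restrict Bmat CA) E \<and> DA \<subseteq> E"
    then have EC: "E \<subseteq> CA" by (simp add: restrict_iff)
    have "M \<in> DA" if "M \<in> E" for M
    proof (rule commutant_DA)
      show "M \<in> CA" using that EC by blast
      show "mmult M N = mmult N M" if "N \<in> DA" for N
        using E \<open>M \<in> E\<close> that by (auto simp: alg_abelian_def)
    qed
    then show "E = DA" using E by blast
  qed
  have gen: "cstar_generated (alg_restrict Bmat CA) (normalizers (alg_restrict Bmat CA) DA) = CA"
  proof
    show "cstar_generated (alg_restrict Bmat CA) (normalizers (alg_restrict Bmat CA) DA) \<subseteq> CA"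
      using A.cstar_generated_subset[of "normalizers (alg_restrict Bmat CA) DA"]
      by (auto simp: normalizers_def)
    show "CA \<subseteq> cstar_generated (alg_restrict Bmat CA) (normalizers (alg_restrict Bmat CA) DA)"
      unfolding cstar_generated_def[of "alg_restrict Bmat CA"]
    proof (rule Inter_greatest)
      fix E assume "E \<in> {D. cstar_subalgebra (alg_restrict Bmat CA) D \<and> normalizers (alg_restrict Bmat CA) DA \<subseteq> D}"
      then have E: "cstar_subalgebra Bmat E" "normalizers (alg_restrict Bmat CA) DA \<subseteq> E"
        by (simp_all add: restrict_iff)
      then have "mat ` Cc_set G \<subseteq> E" using Cc_in_generated by blast
      then show "CA \<subseteq> E" using E(1) unfolding CA_def cstar_generated_def by blast
    qed
  qed
  show ?thesis
    unfolding cartan_subalgebra_def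
    using A.cstar_algebra_axioms sub ab unit max gen expectation expectation_faithful by auto
qed

end

section \<open>Transfer from matrices to the completion\<close>

context locally_injective_system
begin

text \<open>On each piece it is the coincidence set of range and source. Since supports are
  closures, this lets support in the isotropy be tested on non-zero values.\<close>

lemma closedin_isotropy: "closedin (Gam_top X \<phi>) (isotropy G)"
  unfolding closedin_def openin_Gam_top_piece
proof (intro conjI allI impI)
  fix k n assume k: "0 \<le> int n + k"
  let ?T = "Gam_piece_top X \<phi> k n"
  have "(topspace (Gam_top X \<phi>) - isotropy G) \<inter> Gam_piece X \<phi> k n
      = topspace ?T - {\<gamma> \<in> topspace ?T. fst \<gamma> = snd (snd \<gamma>)}"
    using piece_carrier[OF k] by (auto simp: isotropy_Gam)
  moreover have "openin ?T \<dots>"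
    by (intro openin_diff openin_topspace closedin_continuous_maps_eq[OF Hausdorff continuous_range continuous_source])
  ultimately show "openin ?T ((topspace (Gam_top X \<phi>) - isotropy G) \<inter> Gam_piece X \<phi> k n)" by simp
qed (auto simp: isotropy_Gam)

lemma support_in_isotropy_iff:
  "gsupport G f \<subseteq> isotropy G \<longleftrightarrow> (\<forall>x k y. (x, k, y) \<in> Gam_carrier X \<phi> \<longrightarrow> f (x, k, y) \<noteq> 0 \<longrightarrow> x = y)"
proof
  assume s: "gsupport G f \<subseteq> isotropy G"
  have "{\<gamma> \<in> gcarrier G. f \<gamma> \<noteq> 0} \<subseteq> gsupport G f"
    unfolding gsupport_def by (rule closure_of_subset) auto
  with s show "\<forall>x k y. (x, k, y) \<in> Gam_carrier X \<phi> \<longrightarrow> f (x, k, y) \<noteq> 0 \<longrightarrow> x = y"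
    by (metis (mono_tags, lifting) Gam_simps(1) isotropy_Gam mem_Collect_eq subsetD)
next
  assume "\<forall>x k y. (x, k, y) \<in> Gam_carrier X \<phi> \<longrightarrow> f (x, k, y) \<noteq> 0 \<longrightarrow> x = y"
  then have "{\<gamma> \<in> gcarrier G. f \<gamma> \<noteq> 0} \<subseteq> isotropy G" by (auto simp: isotropy_Gam)
  then show "gsupport G f \<subseteq> isotropy G"
    unfolding gsupport_def using closedin_isotropy by (intro closure_of_minimal) auto
qed

end

context discrete_periodic_system
begin

lemma cartan_Cr: "cartan_subalgebra (Cr_alg G) (D'_set G)"
proof -
  interpret H: isometric_hom Bmat "Bc_alg G" mat by (rule isometric_hom_mat)
  have S: "Cc_set G \<subseteq> alg_carrier (Bc_alg G)" using Cc_subset_Bc by (simp add: Bc_alg_def)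
  note gen = H.extension_generated[OF S, folded CA_def Br_alg_def]
  interpret I: star_iso "alg_restrict Bmat CA" "Cr_alg G" H.extension
    using gen(2) by (simp add: Cr_alg_def)
  have car: "H.extension ` alg_carrier (Cr_alg G) = CA" using gen(1) by (simp add: Cr_alg_def)
  have in_compl: "a \<in> alg_carrier (completion (Bc_alg G))" if "a \<in> alg_carrier (Cr_alg G)" for a
  proof -
    interpret K: cstar_algebra "completion (Bc_alg G)" by (rule H.cstar_algebra_completion)
    have "completion_embed (Bc_alg G) ` Cc_set G \<subseteq> alg_carrier (completion (Bc_alg G))"
      using S H.extension_embed(1) by blast
    then show ?thesis using that K.cstar_generated_subset by (auto simp: Cr_alg_def Br_alg_def)
  qed
  \<comment> \<open>The norm dominates the entries, so the pointwise limit defining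
    \<open>jmap\<close> is the entry of the limit matrix in the column of a unit.\<close>
  have j: "jmap a (x, k, y) = H.extension a (x, k, y) (y, 0, y)"
    if a: "a \<in> alg_carrier (Cr_alg G)" and g: "(x, k, y) \<in> Gam_carrier X \<phi>" for a x k y
  proof -
    note c = in_compl[OF a]
    obtain D where D: "opbound D (H.extension a)" using H.extension_in[OF c] by auto
    have "crep a n \<in> Bc_set G" for n using H.Cauchy_in[OF H.crep_Cauchy[OF c]] by (simp add: Bc_alg_def)
    then have "\<exists>C. opbound C (mat (crep a n))" for n by (rule opbound_mat)
    then have "(\<lambda>n. mat (crep a n) (x, k, y) (y, 0, y)) \<longlonglongrightarrow> H.extension a (x, k, y) (y, 0, y)"
      using H.extension_tendsto[OF c] by (intro entry_tendsto[OF _ D]) simp_all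
    then show ?thesis unfolding jmap_def using g by (simp add: mat_unit limI)
  qed
  have mem: "a \<in> D'_set G \<longleftrightarrow> H.extension a \<in> DA" if a: "a \<in> alg_carrier (Cr_alg G)" for a
  proof -
    have C: "H.extension a \<in> CA" using car a by blast
    obtain f where f: "H.extension a = mat f" using C by (rule CA_mat)
    have "a \<in> D'_set G \<longleftrightarrow> (\<forall>x k y. (x, k, y) \<in> Gam_carrier X \<phi> \<longrightarrow> f (x, k, y) \<noteq> 0 \<longrightarrow> x = y)"
      using a j[OF a] by (simp add: D'_set_def support_in_isotropy_iff f mat_unit)
    also have "\<dots> \<longleftrightarrow> mat f \<in> DA"
    proof
      assume s: "\<forall>x k y. (x, k, y) \<in> Gam_carrier X \<phi> \<longrightarrow> f (x, k, y) \<noteq> 0 \<longrightarrow> x = y"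
      show "mat f \<in> DA"
      proof (rule DA_I)
        show "mat f \<in> CA" using C f by simp
        fix \<gamma> \<gamma>' assume nz: "mat f \<gamma> \<gamma>' \<noteq> 0"
        obtain x a z y b w where g: "\<gamma> = (x, a, z)" "\<gamma>' = (y, b, w)" by (cases \<gamma>, cases \<gamma>') auto
        have "z = w" "(x, a, z) \<in> Gam_carrier X \<phi>" "(y, b, z) \<in> Gam_carrier X \<phi>" "f (x, a - b, y) \<noteq> 0"
          using nz by (auto simp: g mat_simps split: if_splits)
        then show "fst \<gamma> = fst \<gamma>'" using s carrier_divide g by (metis fst_conv)
      qed
    next
      assume d: "mat f \<in> DA"
      show "\<forall>x k y. (x, k, y) \<in> Gam_carrier X \<phi> \<longrightarrow> f (x, k, y) \<noteq> 0 \<longrightarrow> x = y"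
        using DA_support[OF d] by (metis mat_unit fst_conv)
    qed
    finally show ?thesis by (simp add: f)
  qed
  have sub: "D'_set G \<subseteq> alg_carrier (Cr_alg G)" by (auto simp: D'_set_def)
  have "H.extension ` D'_set G = DA"
  proof
    show "H.extension ` D'_set G \<subseteq> DA" using mem sub by blast
    show "DA \<subseteq> H.extension ` D'_set G"
    proof
      fix d assume d: "d \<in> DA"
      then obtain a where a: "a \<in> alg_carrier (Cr_alg G)" "d = H.extension a" using car DA_CA by blast
      then show "d \<in> H.extension ` D'_set G" using mem d by blast
    qed
  qed
  with cartan_matrices have "cartan_subalgebra (alg_restrict Bmat CA) (H.extension ` D'_set G)" by simp
  then show ?thesis by (rule I.cartan_transfer[OF sub])
qed

end

theorem theorem4p2:
  fixes X :: "'a topology" and \<phi> :: "'a \<Rightarrow> 'a"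
  assumes "compact_space X" and "metrizable_space X" and "Hausdorff_space X"
    and "continuous_map X X \<phi>" and "locally_injective_map X \<phi>"
    and "\<And>k::nat. k \<ge> 1 \<Longrightarrow>
      subtopology X {x \<in> topspace X. (\<phi> ^^ k) x = x} = discrete_topology {x \<in> topspace X. (\<phi> ^^ k) x = x}"
  shows "cartan_subalgebra (Cr_alg (Gam X \<phi>)) (D'_set (Gam X \<phi>))"
proof -
  interpret discrete_periodic_system X \<phi> by unfold_locales (fact assms)+
  show ?thesis by (rule cartan_Cr)
qed

end
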